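(* Suppose $G$ is a group, $P\cong\mathbb N^k$ for some $k\ge 1$ or $P\cong\bigoplus_{\mathbb N}\mathbb N$, and $\theta$ is an action of $P$ on $G$ by injective group endomorphisms respecting the order. Let $S=G\rtimes_\theta P$. Assume that $\bigcap_{p\in P}\theta_p(G)=\{1_G\}$, that the index $[G:\theta_p(G)]$ is infinite for every $p\neq 1_P$, and that the conditional expectation $\Phi_{\mathcal D}:C^*(S)\to\mathcal D$ is faithful. Then $C^*(S)$ is purely infinite and simple.
   Context: $\mathbb N=\{0,1,2,\dots\}$, and $P$ is a countably generated free abelian semigroup with identity $1_P$. An action $\theta$ of $P$ on $G$ is a homomorphism $p\mapsto\theta_p$ into the endomorphisms of $G$ ($\theta_p\theta_q=\theta_{pq}$, $\theta_{1_P}=\mathrm{id}$). The semidirect product $G\rtimes_\theta P$ is $G\times P$ with multiplication $(g,p)(h,q)=(g\theta_p(h),pq)$. The action respects the order if for all $p,q\in P$ with $pP\cap qP\neq\emptyset$ one has $\theta_p(G)\cap\theta_q(G)=\theta_r(G)$, where $r\in P$ is any element with $pP\cap qP=rP$. For a left cancellative semigroup $S$, a right ideal $X$ and $p\in S$ put $pX=\{px: x\in X\}$ and $p^{-1}X=\{y\in S: py\in X\}$. The family $\mathcal J(S)$ of constructible right ideals is the smallest family of right ideals (including the empty set) containing $\emptyset$ and $S$ and closed under $X\mapsto pX$ and $X\mapsto p^{-1}X$ for all $p\in S$. $C^*(S)$ is the universal unital $C^*$-algebra generated by isometries $(v_p)_{p\in S}$ and projections $(e_X)_{X\in\mathcal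 J(S)}$ satisfying, for all $p,q\in S$ and $X,Y\in\mathcal J(S)$: $v_pv_q=v_{pq}$; $v_pe_Xv_p^*=e_{pX}$; $e_\emptyset=0$ and $e_S=1$; $e_Xe_Y=e_{X\cap Y}$. $\mathcal D=C^*(\{e_X: X\in\mathcal J(S)\})\subseteq C^*(S)$. $\Phi_{\mathcal D}$ is the map determined by $\Phi_{\mathcal D}(v_sv_t^* )=v_sv_s^*$ if $s=t$ and $0$ if $s\neq t$, for $s,t\in S$; the hypothesis says that it extends to a conditional expectation $C^*(S)\to\mathcal D$ that is faithful on positive elements. *)

theory Defs
  imports Complex_Main "HOL-Algebra.Coset" "HOL-Algebra.Module" "HOL-Algebra.Ideal"
begin

section \<open>Unital C*-algebras\<close>

definition complex_ring :: "complex ring" where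
  "complex_ring = \<lparr>carrier = UNIV, mult = (*), one = 1, zero = 0, add = (+)\<rparr>"

text \<open>C*-algebras are carrier-based structures in the style of HOL-Algebra rather than a type
  class, because the universal property of the semigroup C*-algebra quantifies over C*-algebras.
  The zero algebra is allowed.\<close>

record 'a cstar_algebra = "(complex, 'a) module" +
  adj :: "'a \<Rightarrow> 'a"  (\<open>_\<^sup>\<star>\<index>\<close> [1000] 1000)
  cnorm :: "'a \<Rightarrow> real"

definition cstar_tendsto :: "('a, 'm) cstar_algebra_scheme \<Rightarrow> (nat \<Rightarrow> 'a) \<Rightarrow> 'a \<Rightarrow> bool" where
  "cstar_tendsto A x l \<longleftrightarrow> (\<lambda>n. cnorm A (x n \<ominus>\<^bsub>A\<^esub> l)) \<longlonglongrightarrow> 0"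

locale unital_cstar_algebra = ring A for A :: "('a, 'm) cstar_algebra_scheme" (structure) +
  assumes module: "module complex_ring A"
    and smult_mult_left: "\<lbrakk>x \<in> carrier A; y \<in> carrier A\<rbrakk> \<Longrightarrow> (c \<odot> x) \<otimes> y = c \<odot> (x \<otimes> y)"
    and smult_mult_right: "\<lbrakk>x \<in> carrier A; y \<in> carrier A\<rbrakk> \<Longrightarrow> x \<otimes> (c \<odot> y) = c \<odot> (x \<otimes> y)"
    and adj_closed: "x \<in> carrier A \<Longrightarrow> x\<^sup>\<star> \<in> carrier A"
    and adj_adj: "x \<in> carrier A \<Longrightarrow> x\<^sup>\<star>\<^sup>\<star> = x"
    and adj_add: "\<lbrakk>x \<in> carrier A; y \<in> carrier A\<rbrakk> \<Longrightarrow> (x \<oplus> y)\<^sup>\<star> = x\<^sup>\<star> \<oplus> y\<^sup>\<star>"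
    and adj_smult: "x \<in> carrier A \<Longrightarrow> (c \<odot> x)\<^sup>\<star> = cnj c \<odot> x\<^sup>\<star>"
    and adj_mult: "\<lbrakk>x \<in> carrier A; y \<in> carrier A\<rbrakk> \<Longrightarrow> (x \<otimes> y)\<^sup>\<star> = y\<^sup>\<star> \<otimes> x\<^sup>\<star>"
    and norm_nonneg: "x \<in> carrier A \<Longrightarrow> 0 \<le> cnorm A x"
    and norm_eq_0: "x \<in> carrier A \<Longrightarrow> cnorm A x = 0 \<longleftrightarrow> x = \<zero>"
    and norm_add: "\<lbrakk>x \<in> carrier A; y \<in> carrier A\<rbrakk> \<Longrightarrow> cnorm A (x \<oplus> y) \<le> cnorm A x + cnorm A y"
    and norm_smult: "x \<in> carrier A \<Longrightarrow> cnorm A (c \<odot> x) = cmod c * cnorm A x"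
    and norm_mult: "\<lbrakk>x \<in> carrier A; y \<in> carrier A\<rbrakk> \<Longrightarrow> cnorm A (x \<otimes> y) \<le> cnorm A x * cnorm A y"
    and cstar_identity: "x \<in> carrier A \<Longrightarrow> cnorm A (x\<^sup>\<star> \<otimes> x) = (cnorm A x)\<^sup>2"
    and complete: "\<lbrakk>\<forall>n. z n \<in> carrier A;
        \<forall>\<epsilon>>0. \<exists>N. \<forall>m\<ge>N. \<forall>n\<ge>N. cnorm A (z m \<ominus> z n) < \<epsilon>\<rbrakk>
      \<Longrightarrow> \<exists>l\<in>carrier A. cstar_tendsto A z l"

definition cstar_closed :: "('a, 'm) cstar_algebra_scheme \<Rightarrow> 'a set \<Rightarrow> bool" where
  "cstar_closed A B \<longleftrightarrow>
    (\<forall>x l. (\<forall>n. x n \<in> B) \<longrightarrow> l \<in> carrier A \<longrightarrow> cstar_tendsto A x l \<longrightarrow> l \<in> B)"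

text \<open>C*-subalgebras need not contain the unit.\<close>

definition cstar_subalgebra :: "('a, 'm) cstar_algebra_scheme \<Rightarrow> 'a set \<Rightarrow> bool" where
  "cstar_subalgebra A B \<longleftrightarrow> B \<subseteq> carrier A \<and> \<zero>\<^bsub>A\<^esub> \<in> B \<and>
    (\<forall>x\<in>B. \<forall>y\<in>B. x \<oplus>\<^bsub>A\<^esub> y \<in> B \<and> x \<otimes>\<^bsub>A\<^esub> y \<in> B) \<and>
    (\<forall>x\<in>B. \<forall>c. c \<odot>\<^bsub>A\<^esub> x \<in> B) \<and> (\<forall>x\<in>B. x\<^sup>\<star>\<^bsub>A\<^esub> \<in> B) \<and> cstar_closed A B"

definition cstar_generated :: "('a, 'm) cstar_algebra_scheme \<Rightarrow> 'a set \<Rightarrow> 'a set" where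
  "cstar_generated A X = \<Inter>{B. cstar_subalgebra A B \<and> X \<subseteq> B}"

definition isometry :: "('a, 'm) cstar_algebra_scheme \<Rightarrow> 'a \<Rightarrow> bool" where
  "isometry A v \<longleftrightarrow> v \<in> carrier A \<and> v\<^sup>\<star>\<^bsub>A\<^esub> \<otimes>\<^bsub>A\<^esub> v = \<one>\<^bsub>A\<^esub>"

definition projection :: "('a, 'm) cstar_algebra_scheme \<Rightarrow> 'a \<Rightarrow> bool" where
  "projection A p \<longleftrightarrow> p \<in> carrier A \<and> p\<^sup>\<star>\<^bsub>A\<^esub> = p \<and> p \<otimes>\<^bsub>A\<^esub> p = p"

definition cstar_positive :: "('a, 'm) cstar_algebra_scheme \<Rightarrow> 'a \<Rightarrow> bool" where
  "cstar_positive A a \<longleftrightarrow> (\<exists>b\<in>carrier A. a = b\<^sup>\<star>\<^bsub>A\<^esub> \<otimes>\<^bsub>A\<^esub> b)"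

definition cstar_le :: "('a, 'm) cstar_algebra_scheme \<Rightarrow> 'a \<Rightarrow> 'a \<Rightarrow> bool" where
  "cstar_le A a b \<longleftrightarrow> cstar_positive A (b \<ominus>\<^bsub>A\<^esub> a)"

definition unital_star_hom ::
  "('a, 'm) cstar_algebra_scheme \<Rightarrow> ('b, 'n) cstar_algebra_scheme \<Rightarrow> ('a \<Rightarrow> 'b) \<Rightarrow> bool" where
  "unital_star_hom A B \<phi> \<longleftrightarrow> \<phi> \<in> ring_hom A B \<and>
    (\<forall>x\<in>carrier A. \<forall>c. \<phi> (c \<odot>\<^bsub>A\<^esub> x) = c \<odot>\<^bsub>B\<^esub> \<phi> x) \<and>
    (\<forall>x\<in>carrier A. \<phi> (x\<^sup>\<star>\<^bsub>A\<^esub>) = (\<phi> x)\<^sup>\<star>\<^bsub>B\<^esub>)"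

text \<open>By Tomiyama's theorem the contractive linear idempotents onto a C*-subalgebra are
  automatically (completely) positive and bimodule maps.\<close>

definition conditional_expectation ::
  "('a, 'm) cstar_algebra_scheme \<Rightarrow> 'a set \<Rightarrow> ('a \<Rightarrow> 'a) \<Rightarrow> bool" where
  "conditional_expectation A B E \<longleftrightarrow> cstar_subalgebra A B \<and> E \<in> carrier A \<rightarrow> B \<and>
    (\<forall>x\<in>carrier A. \<forall>y\<in>carrier A. E (x \<oplus>\<^bsub>A\<^esub> y) = E x \<oplus>\<^bsub>A\<^esub> E y) \<and>
    (\<forall>x\<in>carrier A. \<forall>c. E (c \<odot>\<^bsub>A\<^esub> x) = c \<odot>\<^bsub>A\<^esub> E x) \<and>
    (\<forall>x\<in>carrier A. cnorm A (E x) \<le> cnorm A x) \<and>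
    (\<forall>x. cstar_positive A x \<longrightarrow> cstar_positive A (E x)) \<and>
    (\<forall>b\<in>B. E b = b) \<and>
    (\<forall>x\<in>carrier A. \<forall>b\<in>B. \<forall>c\<in>B. E (b \<otimes>\<^bsub>A\<^esub> x \<otimes>\<^bsub>A\<^esub> c) = b \<otimes>\<^bsub>A\<^esub> E x \<otimes>\<^bsub>A\<^esub> c)"

definition faithful_on_positive ::
  "('a, 'm) cstar_algebra_scheme \<Rightarrow> ('a \<Rightarrow> 'a) \<Rightarrow> bool" where
  "faithful_on_positive A E \<longleftrightarrow> (\<forall>a. cstar_positive A a \<and> E a = \<zero>\<^bsub>A\<^esub> \<longrightarrow> a = \<zero>\<^bsub>A\<^esub>)"

definition simple_cstar :: "('a, 'm) cstar_algebra_scheme \<Rightarrow> bool" where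
  "simple_cstar A \<longleftrightarrow> carrier A \<noteq> {\<zero>\<^bsub>A\<^esub>} \<and>
    (\<forall>I. ideal I A \<and> cstar_closed A I \<longrightarrow> I = {\<zero>\<^bsub>A\<^esub>} \<or> I = carrier A)"

definition hereditary_subalgebra :: "('a, 'm) cstar_algebra_scheme \<Rightarrow> 'a set \<Rightarrow> bool" where
  "hereditary_subalgebra A H \<longleftrightarrow> cstar_subalgebra A H \<and>
    (\<forall>a\<in>H. \<forall>b\<in>carrier A. cstar_positive A b \<and> cstar_le A b a \<longrightarrow> b \<in> H)"

text \<open>A projection is infinite if it is Murray-von Neumann equivalent to a proper
  subprojection of itself.\<close>

definition infinite_projection :: "('a, 'm) cstar_algebra_scheme \<Rightarrow> 'a \<Rightarrow> bool" where
  "infinite_projection A p \<longleftrightarrow> projection A p \<and>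
    (\<exists>q. projection A q \<and> cstar_le A q p \<and> q \<noteq> p \<and>
      (\<exists>u\<in>carrier A. u\<^sup>\<star>\<^bsub>A\<^esub> \<otimes>\<^bsub>A\<^esub> u = p \<and> u \<otimes>\<^bsub>A\<^esub> u\<^sup>\<star>\<^bsub>A\<^esub> = q))"

text \<open>Cuntz's notion, which is the standard one for simple C*-algebras.\<close>

definition purely_infinite :: "('a, 'm) cstar_algebra_scheme \<Rightarrow> bool" where
  "purely_infinite A \<longleftrightarrow>
    (\<forall>H. hereditary_subalgebra A H \<and> H \<noteq> {\<zero>\<^bsub>A\<^esub>} \<longrightarrow> (\<exists>p\<in>H. infinite_projection A p))"


section \<open>The C*-algebra of a left cancellative semigroup\<close>

inductive_set constructible_ideals :: "('s, 'm) monoid_scheme \<Rightarrow> 's set set" for S where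
  empty: "{} \<in> constructible_ideals S"
| whole: "carrier S \<in> constructible_ideals S"
| image: "\<lbrakk>p \<in> carrier S; X \<in> constructible_ideals S\<rbrakk> \<Longrightarrow> p <#\<^bsub>S\<^esub> X \<in> constructible_ideals S"
| preimage: "\<lbrakk>p \<in> carrier S; X \<in> constructible_ideals S\<rbrakk>
    \<Longrightarrow> {y \<in> carrier S. p \<otimes>\<^bsub>S\<^esub> y \<in> X} \<in> constructible_ideals S"

text \<open>Families of isometries and projections satisfying the defining relations of C*(S). The
  relation for \<open>X \<inter> Y\<close> makes sense because \<^const>\<open>constructible_ideals\<close> is closed under finite
  intersections when S is left cancellative.\<close>

definition semigroup_cstar_relations ::
  "('s, 'k) monoid_scheme \<Rightarrow> ('a, 'm) cstar_algebra_scheme \<Rightarrow> ('s \<Rightarrow> 'a) \<Rightarrow> ('s set \<Rightarrow> 'a) \<Rightarrow> bool" where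
  "semigroup_cstar_relations S A v e \<longleftrightarrow>
    (\<forall>p\<in>carrier S. isometry A (v p)) \<and>
    (\<forall>X\<in>constructible_ideals S. projection A (e X)) \<and>
    (\<forall>p\<in>carrier S. \<forall>q\<in>carrier S. v p \<otimes>\<^bsub>A\<^esub> v q = v (p \<otimes>\<^bsub>S\<^esub> q)) \<and>
    (\<forall>p\<in>carrier S. \<forall>X\<in>constructible_ideals S.
      v p \<otimes>\<^bsub>A\<^esub> e X \<otimes>\<^bsub>A\<^esub> (v p)\<^sup>\<star>\<^bsub>A\<^esub> = e (p <#\<^bsub>S\<^esub> X)) \<and>
    e {} = \<zero>\<^bsub>A\<^esub> \<and> e (carrier S) = \<one>\<^bsub>A\<^esub> \<and>
    (\<forall>X\<in>constructible_ideals S. \<forall>Y\<in>constructible_ideals S. e X \<otimes>\<^bsub>A\<^esub> e Y = e (X \<inter> Y))"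

text \<open>\<open>A\<close> with the families \<open>v\<close> and \<open>e\<close> is the universal unital C*-algebra C*(S). Uniqueness of
  \<open>\<phi>\<close> on the carrier follows from generation. HOL cannot quantify over all types inside a
  formula, so the test algebras \<open>B\<close> live on one fixed type, which is no restriction: in any C*-algebra
  the C*-subalgebra generated by such families has a dense subset of cardinality at most
  \<open>max |S| \<aleph>\<^sub>0\<close>, hence has at most \<open>2 ^ max |S| \<aleph>\<^sub>0\<close> elements and is isomorphic to one carried by a
  subset of \<open>('s \<Rightarrow> complex) \<Rightarrow> 's \<Rightarrow> complex\<close>. This type also contains the bounded operators on
  \<open>\<ell>\<^sup>2(S)\<close>, extended by zero.\<close>

definition is_semigroup_cstar ::
  "('s, 'k) monoid_scheme \<Rightarrow> ('a, 'm) cstar_algebra_scheme \<Rightarrow> ('s \<Rightarrow> 'a) \<Rightarrow> ('s set \<Rightarrow> 'a) \<Rightarrow> bool" where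
  "is_semigroup_cstar S A v e \<longleftrightarrow>
    unital_cstar_algebra A \<and> semigroup_cstar_relations S A v e \<and>
    cstar_generated A (v ` carrier S \<union> e ` constructible_ideals S) = carrier A \<and>
    (\<forall>(B :: (('s \<Rightarrow> complex) \<Rightarrow> 's \<Rightarrow> complex) cstar_algebra) w f.
      unital_cstar_algebra B \<and> semigroup_cstar_relations S B w f \<longrightarrow>
      (\<exists>\<phi>. unital_star_hom A B \<phi> \<and> (\<forall>p\<in>carrier S. \<phi> (v p) = w p) \<and>
        (\<forall>X\<in>constructible_ideals S. \<phi> (e X) = f X)))"

definition diagonal_subalgebra ::
  "('s, 'k) monoid_scheme \<Rightarrow> ('a, 'm) cstar_algebra_scheme \<Rightarrow> ('s set \<Rightarrow> 'a) \<Rightarrow> 'a set" where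
  "diagonal_subalgebra S A e = cstar_generated A (e ` constructible_ideals S)"


section \<open>Semigroup actions and semidirect products\<close>

definition nat_power :: "nat \<Rightarrow> (nat \<Rightarrow> nat) monoid" where
  "nat_power k = \<lparr>carrier = {f. \<forall>i\<ge>k. f i = 0}, mult = (\<lambda>f g i. f i + g i), one = (\<lambda>_. 0)\<rparr>"

definition nat_direct_sum :: "(nat \<Rightarrow> nat) monoid" where
  "nat_direct_sum =
    \<lparr>carrier = {f. finite {i. f i \<noteq> 0}}, mult = (\<lambda>f g i. f i + g i), one = (\<lambda>_. 0)\<rparr>"

definition semigroup_action ::
  "('p, 'k) monoid_scheme \<Rightarrow> ('g, 'm) monoid_scheme \<Rightarrow> ('p \<Rightarrow> 'g \<Rightarrow> 'g) \<Rightarrow> bool" where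
  "semigroup_action P G \<theta> \<longleftrightarrow> (\<forall>p\<in>carrier P. \<theta> p \<in> hom G G) \<and>
    (\<forall>p\<in>carrier P. \<forall>q\<in>carrier P. \<forall>g\<in>carrier G. \<theta> p (\<theta> q g) = \<theta> (p \<otimes>\<^bsub>P\<^esub> q) g) \<and>
    (\<forall>g\<in>carrier G. \<theta> \<one>\<^bsub>P\<^esub> g = g)"

definition respects_order ::
  "('p, 'k) monoid_scheme \<Rightarrow> ('g, 'm) monoid_scheme \<Rightarrow> ('p \<Rightarrow> 'g \<Rightarrow> 'g) \<Rightarrow> bool" where
  "respects_order P G \<theta> \<longleftrightarrow> (\<forall>p\<in>carrier P. \<forall>q\<in>carrier P.
    (p <#\<^bsub>P\<^esub> carrier P) \<inter> (q <#\<^bsub>P\<^esub> carrier P) \<noteq> {} \<longrightarrow>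
    (\<forall>r\<in>carrier P. (p <#\<^bsub>P\<^esub> carrier P) \<inter> (q <#\<^bsub>P\<^esub> carrier P) = r <#\<^bsub>P\<^esub> carrier P \<longrightarrow>
      \<theta> p ` carrier G \<inter> \<theta> q ` carrier G = \<theta> r ` carrier G))"

definition semidirect_product ::
  "('g, 'm) monoid_scheme \<Rightarrow> ('p, 'k) monoid_scheme \<Rightarrow> ('p \<Rightarrow> 'g \<Rightarrow> 'g) \<Rightarrow> ('g \<times> 'p) monoid" where
  "semidirect_product G P \<theta> =
    \<lparr>carrier = carrier G \<times> carrier P,
     mult = (\<lambda>(g, p) (h, q). (g \<otimes>\<^bsub>G\<^esub> \<theta> p h, p \<otimes>\<^bsub>P\<^esub> q)),
     one = (\<one>\<^bsub>G\<^esub>, \<one>\<^bsub>P\<^esub>)\<rparr>"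

end

theory Submission
  imports Defs "HOL-Analysis.Analysis"
begin

text \<open>The constructible right ideals of \<open>S\<close> are the principal ones and \<open>{}\<close>, so the monomials
  \<open>v\<^sub>s v\<^sub>t\<^sup>\<star>\<close> span a dense *-subalgebra. Given \<open>x \<noteq> 0\<close>, faithfulness gives \<open>\<Phi>(x\<^sup>\<star>x) \<noteq> 0\<close>; let \<open>b\<close> be a
  linear combination of monomials close to \<open>x\<^sup>\<star>x\<close>. The norm of \<open>\<Phi>(b)\<close> is attained as the modulus of a
  scalar \<open>\<kappa>\<close> on a minimal projection of the finite-dimensional algebra generated by the \<open>e\<^bsub>sS\<^esub>\<close> involved.
  The infinite index of the subgroups \<open>\<theta>\<^sub>p(G)\<close> (by Neumann's coset covering lemma) and
  the triviality of their intersection provide \<open>t \<in> S\<close> with \<open>v\<^sub>t\<^sup>\<star> b v\<^sub>t = \<kappa> 1\<close>. So \<open>v\<^sub>t\<^sup>\<star> x\<^sup>\<star> x v\<^sub>t\<close> is close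
  to \<open>\<kappa> 1\<close>, where \<open>\<kappa>\<close> is almost positive because the left regular representation excludes
  \<open>w\<^sup>\<star>w = - \<mu> 1\<close> with \<open>\<mu> > 0\<close>. Rescaling by an inverse square root yields \<open>y\<close> with \<open>(x y)\<^sup>\<star> (x y) = 1\<close>, which
  gives simplicity, and the projection \<open>(x y) (x y)\<^sup>\<star>\<close> gives pure infiniteness.\<close>

section \<open>Square roots and orthogonality in C*-algebras\<close>

text \<open>Positivity and spectra are not presupposed: the analytic half works from the C*-identity
  and completeness. Inverses and square roots are therefore fixed points of contractions, available
  only within distance 1/2 of the unit, and norms of orthogonal sums come from repeated squaring.
  The sign of the scalar is decided on square-summable functions, where inner products are at hand.

  The two conditions on the subgroups deal with two kinds of monomials. One with equal indices
  \<open>s\<close> compresses to 1 if the compressing element \<open>r\<close> lies in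
  \<open>sS\<close>. If it does not, \<open>r\<close> has to be moved within \<open>rS\<close> to an
  element whose ideal misses \<open>sS\<close>; the first components for which this fails fill one
  coset of a subgroup of infinite index, and finitely many such cosets never cover \<open>G\<close>.
  A monomial with distinct indices either compresses to 0 or becomes
  \<open>v\<^sub>a\<^sup>\<star> v\<^sub>b\<close> with \<open>a\<close> and \<open>b\<close>
  distinct; since the \<open>\<theta>\<^sub>n(G)\<close> shrink to the identity, further compression
  drives \<open>a\<close> and \<open>b\<close> into disjoint ideals. Right multiplication of the
  compressing element preserves what was achieved before, so finitely many monomials can be handled
  in turn.\<close>

context unital_cstar_algebra
begin

lemma smult_closed [simp, intro]: "x \<in> carrier A \<Longrightarrow> c \<odot> x \<in> carrier A"
  using module.smult_closed[OF module] by (simp add: complex_ring_def)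

lemma smult_add_left: "x \<in> carrier A \<Longrightarrow> (a + b) \<odot> x = a \<odot> x \<oplus> b \<odot> x"
  using module.smult_l_distr[OF module] by (simp add: complex_ring_def)

lemma smult_add_right:
  "\<lbrakk>x \<in> carrier A; y \<in> carrier A\<rbrakk> \<Longrightarrow> c \<odot> (x \<oplus> y) = c \<odot> x \<oplus> c \<odot> y"
  using module.smult_r_distr[OF module] by (simp add: complex_ring_def)

lemma smult_smult: "x \<in> carrier A \<Longrightarrow> a \<odot> (b \<odot> x) = (a * b) \<odot> x"
  using module.smult_assoc1[OF module, of a b x] by (simp add: complex_ring_def)

lemma smult_one [simp]: "x \<in> carrier A \<Longrightarrow> 1 \<odot> x = x"
  using module.smult_one[OF module] by (simp add: complex_ring_def)

lemma smult_zero_left [simp]: "x \<in> carrier A \<Longrightarrow> 0 \<odot> x = \<zero>"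
  using norm_smult[of x 0] norm_eq_0[of "0 \<odot> x"] by simp

lemma smult_zero_right [simp]: "c \<odot> \<zero> = \<zero>"
  using norm_smult[of \<zero> c] norm_eq_0[of "c \<odot> \<zero>"] norm_eq_0[of \<zero>] by simp

lemma smult_uminus_left: "x \<in> carrier A \<Longrightarrow> (- c) \<odot> x = \<ominus> (c \<odot> x)"
  using smult_add_left[of x "- c" c] by (simp add: minus_equality)

lemma smult_uminus_right: "x \<in> carrier A \<Longrightarrow> c \<odot> (\<ominus> x) = \<ominus> (c \<odot> x)"
  using smult_add_right[of "\<ominus> x" x c] by (simp add: minus_equality l_neg)

lemma smult_minus_right:
  "\<lbrakk>x \<in> carrier A; y \<in> carrier A\<rbrakk> \<Longrightarrow> c \<odot> (x \<ominus> y) = c \<odot> x \<ominus> c \<odot> y"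
  by (simp add: minus_eq smult_add_right smult_uminus_right)

lemma smult_minus_left:
  "x \<in> carrier A \<Longrightarrow> (a - b) \<odot> x = a \<odot> x \<ominus> b \<odot> x"
  using smult_add_left[of x a "- b"] by (simp add: minus_eq smult_uminus_left)

lemma adj_zero [simp]: "\<zero>\<^sup>\<star> = \<zero>"
  using adj_smult[of \<zero> 0] adj_closed[of \<zero>] by simp

lemma adj_one [simp]: "\<one>\<^sup>\<star> = \<one>"
  using adj_mult[of "\<one>\<^sup>\<star>" \<one>] adj_closed[of \<one>] adj_adj[of \<one>] by simp

lemma adj_uminus: "x \<in> carrier A \<Longrightarrow> (\<ominus> x)\<^sup>\<star> = \<ominus> x\<^sup>\<star>"
  using adj_smult[of x "- 1"] by (simp add: smult_uminus_left adj_closed)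

lemma adj_minus: "\<lbrakk>x \<in> carrier A; y \<in> carrier A\<rbrakk> \<Longrightarrow> (x \<ominus> y)\<^sup>\<star> = x\<^sup>\<star> \<ominus> y\<^sup>\<star>"
  by (simp add: minus_eq adj_add adj_uminus)

lemma norm_zero [simp]: "cnorm A \<zero> = 0"
  using norm_eq_0[of \<zero>] by simp

lemma norm_uminus: "x \<in> carrier A \<Longrightarrow> cnorm A (\<ominus> x) = cnorm A x"
  using norm_smult[of x "- 1"] by (simp add: smult_uminus_left)

lemma norm_minus_commute:
  assumes "x \<in> carrier A" "y \<in> carrier A"
  shows "cnorm A (x \<ominus> y) = cnorm A (y \<ominus> x)"
proof -
  have "x \<ominus> y = \<ominus> (y \<ominus> x)"
    using assms by algebra
  then show ?thesis
    using norm_uminus[of "y \<ominus> x"] assms by simp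
qed

lemma norm_minus_triangle:
  assumes "x \<in> carrier A" "y \<in> carrier A" "z \<in> carrier A"
  shows "cnorm A (x \<ominus> z) \<le> cnorm A (x \<ominus> y) + cnorm A (y \<ominus> z)"
proof -
  have "x \<ominus> z = (x \<ominus> y) \<oplus> (y \<ominus> z)"
    using assms by algebra
  then show ?thesis
    using norm_add[of "x \<ominus> y" "y \<ominus> z"] assms by simp
qed

lemma norm_le_norm_minus_add:
  assumes "x \<in> carrier A" "y \<in> carrier A"
  shows "cnorm A x \<le> cnorm A (x \<ominus> y) + cnorm A y"
  using norm_minus_triangle[of x y \<zero>] assms by (simp add: minus_eq)

lemma norm_minus_eq_0:
  assumes "x \<in> carrier A" "y \<in> carrier A"
  shows "cnorm A (x \<ominus> y) = 0 \<longleftrightarrow> x = y"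
proof -
  have "x = (x \<ominus> y) \<oplus> y"
    using assms by algebra
  then have "x \<ominus> y = \<zero> \<longleftrightarrow> x = y"
    using assms by (metis l_zero minus_eq r_neg)
  then show ?thesis
    using norm_eq_0[of "x \<ominus> y"] assms by simp
qed

lemma norm_adj [simp]:
  assumes "x \<in> carrier A"
  shows "cnorm A (x\<^sup>\<star>) = cnorm A x"
proof -
  have le: "cnorm A y \<le> cnorm A (y\<^sup>\<star>)" if "y \<in> carrier A" for y
  proof (cases "cnorm A y = 0")
    case False
    then have "0 < cnorm A y"
      using norm_nonneg[OF that] by simp
    moreover have "cnorm A y * cnorm A y \<le> cnorm A (y\<^sup>\<star>) * cnorm A y"
      using cstar_identity[OF that] norm_mult[of "y\<^sup>\<star>" y] that
      by (simp add: adj_closed power2_eq_square)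
    ultimately show ?thesis
      by simp
  qed (simp add: norm_nonneg adj_closed that)
  show ?thesis
    using le[OF assms] le[of "x\<^sup>\<star>"] assms by (simp add: adj_closed adj_adj)
qed

lemma adj_mult_self_eq_0:
  assumes "x \<in> carrier A" "x\<^sup>\<star> \<otimes> x = \<zero>"
  shows "x = \<zero>"
  using cstar_identity[of x] norm_eq_0[of x] assms by simp

lemma norm_projection_le_1:
  assumes "projection A p"
  shows "cnorm A p \<le> 1"
proof -
  have "cnorm A p = (cnorm A p)\<^sup>2"
    using cstar_identity[of p] assms by (simp add: projection_def)
  then have "cnorm A p = 0 \<or> cnorm A p = 1"
    by (simp add: power2_eq_square)
  then show ?thesis
    by auto
qed

lemma norm_isometry_le_1:
  assumes "isometry A w"
  shows "cnorm A w \<le> 1"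
proof -
  have "cnorm A \<one> \<le> 1"
    by (rule norm_projection_le_1) (simp add: projection_def)
  then have "(cnorm A w)\<^sup>2 \<le> 1"
    using cstar_identity[of w] assms by (simp add: isometry_def)
  then show ?thesis
    by (simp add: power2_le_iff_abs_le abs_square_le_1)
qed

section \<open>Inverses and square roots near the unit\<close>

lemma contraction_fixpoint:
  assumes "0 \<le> r"
    and maps: "\<And>x. \<lbrakk>x \<in> carrier A; cnorm A x \<le> r\<rbrakk> \<Longrightarrow> F x \<in> carrier A \<and> cnorm A (F x) \<le> r"
    and contr: "\<And>x y. \<lbrakk>x \<in> carrier A; cnorm A x \<le> r; y \<in> carrier A; cnorm A y \<le> r\<rbrakk>
      \<Longrightarrow> cnorm A (F x \<ominus> F y) \<le> k * cnorm A (x \<ominus> y)"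
    and "k < 1"
  obtains x where "x \<in> carrier A" "cnorm A x \<le> r" "F x = x"
proof -
  define M where "M = {x \<in> carrier A. cnorm A x \<le> r}"
  \<comment> \<open>\<open>Metric_space\<close> asks for symmetry and nonnegativity on the whole
    type, whereas the norm axioms speak about the carrier only; hence the value 0 elsewhere.\<close>
  define d where "d x y = (if x \<in> carrier A \<and> y \<in> carrier A then cnorm A (x \<ominus> y) else 0)" for x y
  interpret Metric_space M d
  proof
    show "0 \<le> d x y" for x y
      by (simp add: d_def norm_nonneg)
    show "d x y = d y x" for x y
      by (simp add: d_def norm_minus_commute)
    show "d x y = 0 \<longleftrightarrow> x = y" if "x \<in> M" "y \<in> M" for x y
      using that by (simp add: d_def M_def norm_minus_eq_0)
    show "d x z \<le> d x y + d y z" if "x \<in> M" "y \<in> M" "z \<in> M" for x y z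
      using that by (simp add: d_def M_def norm_minus_triangle)
  qed
  have "mcomplete"
    unfolding mcomplete_def
  proof (intro allI impI)
    fix \<sigma> assume "MCauchy \<sigma>"
    then have range: "\<And>n. \<sigma> n \<in> M"
      and cauchy: "\<And>\<epsilon>. \<epsilon> > 0 \<Longrightarrow> \<exists>N. \<forall>n n'. N \<le> n \<longrightarrow> N \<le> n' \<longrightarrow> d (\<sigma> n) (\<sigma> n') < \<epsilon>"
      by (auto simp: MCauchy_def)
    have carr: "\<sigma> n \<in> carrier A" "cnorm A (\<sigma> n) \<le> r" for n
      using range by (auto simp: M_def)
    have "\<forall>\<epsilon>>0. \<exists>N. \<forall>m\<ge>N. \<forall>n\<ge>N. cnorm A (\<sigma> m \<ominus> \<sigma> n) < \<epsilon>"
      using cauchy carr(1) by (simp add: d_def)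
    then obtain l where l: "l \<in> carrier A" "(\<lambda>n. cnorm A (\<sigma> n \<ominus> l)) \<longlonglongrightarrow> 0"
      using complete[of \<sigma>] carr(1) by (auto simp: cstar_tendsto_def)
    have "cnorm A l \<le> cnorm A (\<sigma> n \<ominus> l) + r" for n
      using norm_le_norm_minus_add[of l "\<sigma> n"] norm_minus_commute[of l "\<sigma> n"] carr[of n] l(1) by simp
    moreover have "(\<lambda>n. cnorm A (\<sigma> n \<ominus> l) + r) \<longlonglongrightarrow> 0 + r"
      by (intro tendsto_intros l)
    ultimately have "cnorm A l \<le> 0 + r"
      by (intro LIMSEQ_le_const) auto
    then have "l \<in> M"
      using l(1) by (simp add: M_def)
    moreover have "\<forall>\<^sub>F n in sequentially. \<sigma> n \<in> M \<and> d (\<sigma> n) l < \<epsilon>" if "\<epsilon> > 0" for \<epsilon>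
      using order_tendstoD(2)[OF l(2) that] range carr(1) l(1) by (simp add: d_def)
    ultimately show "\<exists>x. limitin mtopology \<sigma> x sequentially"
      by (auto simp: limitin_metric)
  qed
  moreover have "M \<noteq> {}"
    using \<open>0 \<le> r\<close> by (auto simp: M_def intro!: exI[of _ \<zero>])
  moreover have "F \<in> M \<rightarrow> M"
    using maps by (auto simp: M_def)
  ultimately obtain x where "x \<in> M" "F x = x"
    using Banach_fixedpoint_thm[of F k] contr maps \<open>k < 1\<close> by (auto simp: M_def d_def)
  then show thesis
    using that[of x] by (simp add: M_def)
qed

lemma norm_mult_left_minus:
  assumes "w \<in> carrier A" "x \<in> carrier A" "y \<in> carrier A"
  shows "cnorm A (w \<otimes> x \<ominus> w \<otimes> y) \<le> cnorm A w * cnorm A (x \<ominus> y)"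
proof -
  have "w \<otimes> x \<ominus> w \<otimes> y = w \<otimes> (x \<ominus> y)"
    using assms by algebra
  then show ?thesis
    using norm_mult[of w "x \<ominus> y"] assms by simp
qed

text \<open>The Neumann series is \<open>1 + z\<close> for the fixed point \<open>z\<close> of
  \<open>z \<mapsto> w + w z\<close> in the unit ball. As \<open>w\<close> is self-adjoint, the
  adjoint of this right inverse is a left inverse, so the two coincide, which also makes
  \<open>c\<close> self-adjoint.\<close>

lemma inverse_one_minus:
  assumes w: "w \<in> carrier A" "w\<^sup>\<star> = w" "cnorm A w \<le> 1/2"
  obtains c where "c \<in> carrier A" "c\<^sup>\<star> = c" "(\<one> \<ominus> w) \<otimes> c = \<one>" "c \<otimes> (\<one> \<ominus> w) = \<one>"
proof -
  obtain z where z: "z \<in> carrier A" "w \<oplus> w \<otimes> z = z"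
  proof (rule contraction_fixpoint[of 1 "\<lambda>z. w \<oplus> w \<otimes> z" "1/2"])
    fix x assume x: "x \<in> carrier A" "cnorm A x \<le> 1"
    have "cnorm A w * cnorm A x \<le> 1/2 * 1"
      using w(1,3) x by (intro mult_mono) (auto simp: norm_nonneg)
    then show "w \<oplus> w \<otimes> x \<in> carrier A \<and> cnorm A (w \<oplus> w \<otimes> x) \<le> 1"
      using norm_add[of w "w \<otimes> x"] norm_mult[of w x] w x by simp
  next
    fix x y assume xy: "x \<in> carrier A" "y \<in> carrier A"
    have "(w \<oplus> w \<otimes> x) \<ominus> (w \<oplus> w \<otimes> y) = w \<otimes> x \<ominus> w \<otimes> y"
      using w(1) xy by algebra
    moreover have "cnorm A w * cnorm A (x \<ominus> y) \<le> 1/2 * cnorm A (x \<ominus> y)"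
      using w(3) xy by (intro mult_right_mono) (auto simp: norm_nonneg)
    ultimately show "cnorm A ((w \<oplus> w \<otimes> x) \<ominus> (w \<oplus> w \<otimes> y)) \<le> 1/2 * cnorm A (x \<ominus> y)"
      using norm_mult_left_minus[of w x y] w(1) xy by simp
  qed auto
  define c where "c = \<one> \<oplus> z"
  have c: "c \<in> carrier A"
    using z by (simp add: c_def)
  have "(\<one> \<ominus> w) \<otimes> c = \<one> \<oplus> z \<ominus> (w \<oplus> w \<otimes> z)"
    unfolding c_def using w(1) z(1) by algebra simp
  also have "\<dots> = \<one>"
    unfolding z(2) using z(1) by algebra
  finally have right: "(\<one> \<ominus> w) \<otimes> c = \<one>" .
  have left: "c\<^sup>\<star> \<otimes> (\<one> \<ominus> w) = \<one>"
    using arg_cong[OF right, of "adj A"] w(1,2) c by (simp add: adj_mult adj_minus)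
  have "c\<^sup>\<star> = c\<^sup>\<star> \<otimes> ((\<one> \<ominus> w) \<otimes> c)"
    unfolding right using c by (simp add: adj_closed)
  also have "\<dots> = c"
    using left w(1) c by (simp add: adj_closed flip: m_assoc)
  finally show thesis
    using that[of c] right left c by simp
qed

lemma smult_half_double: "x \<in> carrier A \<Longrightarrow> (1/2) \<odot> x \<oplus> (1/2) \<odot> x = x"
  using smult_add_left[of x "1/2" "1/2"] by simp

lemma norm_square_minus_square:
  assumes "x \<in> carrier A" "y \<in> carrier A"
  shows "cnorm A (x \<otimes> x \<ominus> y \<otimes> y) \<le> (cnorm A x + cnorm A y) * cnorm A (x \<ominus> y)"
proof -
  have "x \<otimes> x \<ominus> y \<otimes> y = x \<otimes> (x \<ominus> y) \<oplus> (x \<ominus> y) \<otimes> y"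
    using assms by algebra
  then have "cnorm A (x \<otimes> x \<ominus> y \<otimes> y) \<le> cnorm A (x \<otimes> (x \<ominus> y)) + cnorm A ((x \<ominus> y) \<otimes> y)"
    using norm_add[of "x \<otimes> (x \<ominus> y)" "(x \<ominus> y) \<otimes> y"] assms by simp
  also have "\<dots> \<le> cnorm A x * cnorm A (x \<ominus> y) + cnorm A (x \<ominus> y) * cnorm A y"
    using assms by (intro add_mono norm_mult) auto
  finally show ?thesis
    by (simp add: algebra_simps)
qed

text \<open>The square root is \<open>1 - w\<close> for the fixed point \<open>w\<close> of \<open>w \<mapsto> (u + w\<^sup>2) / 2\<close> in the
  ball of radius \<open>1/2\<close>.\<close>

lemma sqrt_one_minus:
  assumes u: "u \<in> carrier A" "u\<^sup>\<star> = u" "cnorm A u \<le> 1/2"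
  obtains s c where "s \<in> carrier A" "s\<^sup>\<star> = s" "s \<otimes> s = \<one> \<ominus> u"
    "c \<in> carrier A" "c\<^sup>\<star> = c" "s \<otimes> c = \<one>" "c \<otimes> s = \<one>"
proof -
  define F where "F w = (1/2) \<odot> (u \<oplus> w \<otimes> w)" for w
  have diff: "cnorm A (F x \<ominus> F y) \<le> 1/2 * ((cnorm A x + cnorm A y) * cnorm A (x \<ominus> y))"
    if xy: "x \<in> carrier A" "y \<in> carrier A" for x y
  proof -
    have "(u \<oplus> x \<otimes> x) \<ominus> (u \<oplus> y \<otimes> y) = x \<otimes> x \<ominus> y \<otimes> y"
      using u(1) xy by algebra
    then have "F x \<ominus> F y = (1/2) \<odot> (x \<otimes> x \<ominus> y \<otimes> y)"
      unfolding F_def using u(1) xy by (simp flip: smult_minus_right)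
    then show ?thesis
      using norm_square_minus_square[OF xy] norm_smult[of "x \<otimes> x \<ominus> y \<otimes> y" "1/2"] xy by simp
  qed
  have diff': "cnorm A (F x \<ominus> F y) \<le> 1/2 * cnorm A (x \<ominus> y)"
    if "x \<in> carrier A" "y \<in> carrier A" "cnorm A x \<le> 1/2" "cnorm A y \<le> 1/2" for x y
  proof -
    have "(cnorm A x + cnorm A y) * cnorm A (x \<ominus> y) \<le> 1 * cnorm A (x \<ominus> y)"
      using that by (intro mult_right_mono) (auto simp: norm_nonneg)
    then show ?thesis
      using diff[of x y] that by simp
  qed
  obtain w where w: "w \<in> carrier A" "cnorm A w \<le> 1/2" "F w = w"
  proof (rule contraction_fixpoint[of "1/2" F "1/2"])
    fix x assume x: "x \<in> carrier A" "cnorm A x \<le> 1/2"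
    have "cnorm A x * cnorm A x \<le> 1/2 * (1/2)"
      using x by (intro mult_mono) (auto simp: norm_nonneg)
    then have "cnorm A (u \<oplus> x \<otimes> x) \<le> 1"
      using norm_add[of u "x \<otimes> x"] norm_mult[of x x] u x by simp
    then show "F x \<in> carrier A \<and> cnorm A (F x) \<le> 1/2"
      using norm_smult[of "u \<oplus> x \<otimes> x" "1/2"] u(1) x by (simp add: F_def)
  qed (use diff' in auto)
  \<comment> \<open>Since \<open>u\<close> is self-adjoint, the adjoint of \<open>w\<close> is a
    fixed point as well, and the contraction property allows only one in the ball.\<close>
  have "F (w\<^sup>\<star>) = (F w)\<^sup>\<star>"
    using w(1) u(1,2) by (simp add: adj_closed F_def adj_smult adj_add adj_mult)
  then have adj: "w\<^sup>\<star> \<in> carrier A" "cnorm A (w\<^sup>\<star>) \<le> 1/2" "F (w\<^sup>\<star>) = w\<^sup>\<star>"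
    using w by (simp_all add: adj_closed)
  have "cnorm A (w \<ominus> w\<^sup>\<star>) \<le> 1/2 * cnorm A (w \<ominus> w\<^sup>\<star>)"
    using diff'[of w "w\<^sup>\<star>"] w adj by simp
  then have "cnorm A (w \<ominus> w\<^sup>\<star>) = 0"
    using norm_nonneg[of "w \<ominus> w\<^sup>\<star>"] w(1) adj(1) by simp
  then have sa: "w\<^sup>\<star> = w"
    using norm_minus_eq_0 w(1) adj(1) by simp
  have "w \<oplus> w = u \<oplus> w \<otimes> w"
    using smult_half_double[of "u \<oplus> w \<otimes> w"] w(1,3) u(1) by (simp add: F_def)
  moreover have "(\<one> \<ominus> w) \<otimes> (\<one> \<ominus> w) = \<one> \<ominus> (w \<oplus> w) \<oplus> w \<otimes> w"
    using w(1) by algebra simp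
  moreover have "\<one> \<ominus> (u \<oplus> w \<otimes> w) \<oplus> w \<otimes> w = \<one> \<ominus> u"
    using w(1) u(1) by algebra
  ultimately have square: "(\<one> \<ominus> w) \<otimes> (\<one> \<ominus> w) = \<one> \<ominus> u"
    by simp
  obtain c where "c \<in> carrier A" "c\<^sup>\<star> = c" "(\<one> \<ominus> w) \<otimes> c = \<one>" "c \<otimes> (\<one> \<ominus> w) = \<one>"
    using inverse_one_minus[of w] w(1,2) sa by blast
  then show thesis
    using that[of "\<one> \<ominus> w" c] square w(1) sa by (simp add: adj_minus)
qed

text \<open>Orthogonality turns the square of \<open>h + k\<close> into the sum of the squares,
  again an orthogonal pair, and the C*-identity squares the norm of a self-adjoint element. The
  triangle inequality is thus spent only once, on the \<open>2 ^ n\<close>-th powers, and its factor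
  2 does not grow with \<open>n\<close>.\<close>

lemma norm_add_orthogonal_sa:
  assumes "h \<in> carrier A" "k \<in> carrier A" "h\<^sup>\<star> = h" "k\<^sup>\<star> = k" "h \<otimes> k = \<zero>" "k \<otimes> h = \<zero>"
  shows "cnorm A (h \<oplus> k) ^ 2 ^ n \<le> 2 * max (cnorm A h) (cnorm A k) ^ 2 ^ n"
  using assms
proof (induction n arbitrary: h k)
  case 0
  then show ?case
    using norm_add[of h k] by simp
next
  case (Suc n)
  have sq: "cnorm A (x \<otimes> x) = (cnorm A x)\<^sup>2" if "x \<in> carrier A" "x\<^sup>\<star> = x" for x
    using cstar_identity[of x] that by simp
  have "(h \<oplus> k) \<otimes> (h \<oplus> k) = h \<otimes> h \<oplus> h \<otimes> k \<oplus> (k \<otimes> h \<oplus> k \<otimes> k)"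
    using Suc.prems(1,2) by algebra
  then have eq: "(h \<oplus> k) \<otimes> (h \<oplus> k) = h \<otimes> h \<oplus> k \<otimes> k"
    using Suc.prems by simp
  have "h \<otimes> h \<otimes> (k \<otimes> k) = h \<otimes> (h \<otimes> k) \<otimes> k" "k \<otimes> k \<otimes> (h \<otimes> h) = k \<otimes> (k \<otimes> h) \<otimes> h"
    using Suc.prems(1,2) by algebra+
  then have "cnorm A (h \<otimes> h \<oplus> k \<otimes> k) ^ 2 ^ n \<le> 2 * max (cnorm A (h \<otimes> h)) (cnorm A (k \<otimes> k)) ^ 2 ^ n"
    using Suc.prems by (intro Suc.IH) (auto simp: adj_mult)
  moreover have "max ((cnorm A h)\<^sup>2) ((cnorm A k)\<^sup>2) = (max (cnorm A h) (cnorm A k))\<^sup>2"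
    using norm_nonneg Suc.prems(1,2) by (auto simp: max_def power2_le_iff_abs_le power_mono)
  ultimately show ?case
    using sq[of "h \<oplus> k"] sq[of h] sq[of k] Suc.prems
    by (simp add: eq adj_add power_mult)
qed

text \<open>Disposes of that factor 2: if \<open>x / y\<close> exceeded 1, one of its powers would
  exceed 2.\<close>

lemma le_if_power_le_const_mult:
  fixes x y :: real
  assumes "0 \<le> y" "\<And>n. x ^ 2 ^ n \<le> 2 * y ^ 2 ^ n"
  shows "x \<le> y"
proof (rule ccontr)
  assume "\<not> x \<le> y"
  then have "y < x"
    by simp
  show False
  proof (cases "y = 0")
    case True
    then show False
      using assms(2)[of 0] \<open>y < x\<close> by simp
  next
    case False
    then have "1 < x / y"
      using \<open>y < x\<close> assms(1) by simp
    then obtain n where "2 < (x / y) ^ n"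
      using real_arch_pow by blast
    also have "\<dots> \<le> (x / y) ^ 2 ^ n"
      using \<open>1 < x / y\<close> less_exp[of n] by (intro power_increasing) auto
    finally show False
      using assms(2)[of n] False assms(1) by (simp add: power_divide field_simps)
  qed
qed

text \<open>Passing to \<open>x\<^sup>\<star> x\<close> and \<open>y\<^sup>\<star> y\<close> reduces
  to self-adjoint elements. The vanishing of \<open>x y\<^sup>\<star>\<close> makes these two
  orthogonal; the vanishing of \<open>x\<^sup>\<star> y\<close> removes the mixed terms when
  \<open>x + y\<close> is multiplied by its adjoint.\<close>

lemma norm_add_orthogonal:
  assumes xy: "x \<in> carrier A" "y \<in> carrier A"
    and "x\<^sup>\<star> \<otimes> y = \<zero>" "x \<otimes> y\<^sup>\<star> = \<zero>"
  shows "cnorm A (x \<oplus> y) \<le> max (cnorm A x) (cnorm A y)"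
proof -
  have swap: "y\<^sup>\<star> \<otimes> x = \<zero>" "y \<otimes> x\<^sup>\<star> = \<zero>"
    using arg_cong[OF assms(3), of "adj A"] arg_cong[OF assms(4), of "adj A"] xy
    by (simp_all add: adj_mult adj_closed adj_adj)
  define h k where "h = x\<^sup>\<star> \<otimes> x" and "k = y\<^sup>\<star> \<otimes> y"
  have hk: "h \<in> carrier A" "k \<in> carrier A" "h\<^sup>\<star> = h" "k\<^sup>\<star> = k"
    using xy by (simp_all add: h_def k_def adj_closed adj_mult adj_adj)
  have "h \<otimes> k = x\<^sup>\<star> \<otimes> (x \<otimes> y\<^sup>\<star>) \<otimes> y" "k \<otimes> h = y\<^sup>\<star> \<otimes> (y \<otimes> x\<^sup>\<star>) \<otimes> x"
    using xy by (simp_all add: h_def k_def adj_closed m_assoc)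
  then have "h \<otimes> k = \<zero>" "k \<otimes> h = \<zero>"
    using assms swap by (simp_all add: adj_closed)
  then have "cnorm A (h \<oplus> k) \<le> max (cnorm A h) (cnorm A k)"
    using norm_add_orthogonal_sa[of h k] hk
    by (intro le_if_power_le_const_mult[of _ "cnorm A (h \<oplus> k)"]) (simp_all add: le_max_iff_disj norm_nonneg)
  moreover have "(x \<oplus> y)\<^sup>\<star> \<otimes> (x \<oplus> y) = h \<oplus> k"
    using xy assms swap by (simp add: h_def k_def adj_add adj_closed l_distr r_distr)
  ultimately have "(cnorm A (x \<oplus> y))\<^sup>2 \<le> max ((cnorm A x)\<^sup>2) ((cnorm A y)\<^sup>2)"
    using cstar_identity[of "x \<oplus> y"] cstar_identity[of x] cstar_identity[of y] xy
    by (simp add: h_def k_def)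
  then show ?thesis
    using xy norm_nonneg by (auto simp: le_max_iff_disj power2_le_iff_abs_le)
qed

subsection \<open>Closures and a criterion for pure infiniteness\<close>

definition norm_closure :: "'a set \<Rightarrow> 'a set" where
  "norm_closure L = {x \<in> carrier A. \<forall>\<epsilon>>0. \<exists>y\<in>L. cnorm A (x \<ominus> y) < \<epsilon>}"

lemma norm_mult_diff:
  assumes "x \<in> carrier A" "y \<in> carrier A" "x' \<in> carrier A" "y' \<in> carrier A"
  shows "cnorm A (x \<otimes> y \<ominus> x' \<otimes> y')
    \<le> cnorm A x * cnorm A (y \<ominus> y') + cnorm A (x \<ominus> x') * (cnorm A y + cnorm A (y \<ominus> y'))"
proof -
  have "x \<otimes> y \<ominus> x' \<otimes> y' = x \<otimes> (y \<ominus> y') \<oplus> (x \<ominus> x') \<otimes> y'"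
    using assms by algebra
  then have "cnorm A (x \<otimes> y \<ominus> x' \<otimes> y')
      \<le> cnorm A (x \<otimes> (y \<ominus> y')) + cnorm A ((x \<ominus> x') \<otimes> y')"
    using norm_add[of "x \<otimes> (y \<ominus> y')" "(x \<ominus> x') \<otimes> y'"] assms by simp
  also have "\<dots> \<le> cnorm A x * cnorm A (y \<ominus> y') + cnorm A (x \<ominus> x') * cnorm A y'"
    using assms by (intro add_mono norm_mult) auto
  also have "cnorm A y' \<le> cnorm A y + cnorm A (y \<ominus> y')"
    using norm_le_norm_minus_add[of y' y] norm_minus_commute[of y y'] assms by simp
  finally show ?thesis
    using assms by (simp add: mult_left_mono norm_nonneg)
qed

text \<open>Density statements rest on this: a generated C*-subalgebra lies in the closure of every
  *-algebra that contains the generators.\<close>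

lemma cstar_subalgebra_norm_closure:
  assumes L: "L \<subseteq> carrier A" "\<zero> \<in> L"
    and add: "\<And>x y. \<lbrakk>x \<in> L; y \<in> L\<rbrakk> \<Longrightarrow> x \<oplus> y \<in> L"
    and mult: "\<And>x y. \<lbrakk>x \<in> L; y \<in> L\<rbrakk> \<Longrightarrow> x \<otimes> y \<in> L"
    and smult: "\<And>x c. x \<in> L \<Longrightarrow> c \<odot> x \<in> L"
    and adj: "\<And>x. x \<in> L \<Longrightarrow> x\<^sup>\<star> \<in> L"
  shows "cstar_subalgebra A (norm_closure L)"
  unfolding cstar_subalgebra_def
proof (intro conjI ballI allI)
  let ?cl = "norm_closure L"
  show "?cl \<subseteq> carrier A"
    by (auto simp: norm_closure_def)
  have clI: "x \<in> ?cl" if "x \<in> carrier A" "\<And>\<epsilon>. 0 < \<epsilon> \<Longrightarrow> \<exists>y\<in>L. cnorm A (x \<ominus> y) < \<epsilon>" for x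
    using that by (auto simp: norm_closure_def)
  have clD: "x \<in> carrier A" "0 < \<epsilon> \<Longrightarrow> \<exists>y. y \<in> L \<and> y \<in> carrier A \<and> cnorm A (x \<ominus> y) < \<epsilon>"
    if "x \<in> ?cl" for x \<epsilon>
    using that L unfolding norm_closure_def by blast+
  show "\<zero> \<in> ?cl"
    using L by (intro clI bexI[of _ \<zero>]) (auto simp: minus_eq)
  show "x\<^sup>\<star> \<in> ?cl" if x: "x \<in> ?cl" for x
  proof (rule clI)
    fix \<epsilon> :: real assume "0 < \<epsilon>"
    then obtain y where y: "y \<in> L" "y \<in> carrier A" "cnorm A (x \<ominus> y) < \<epsilon>"
      using clD(2)[OF x] by blast
    then have "cnorm A (x\<^sup>\<star> \<ominus> y\<^sup>\<star>) < \<epsilon>"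
      using norm_adj[of "x \<ominus> y"] clD(1)[OF x] by (simp add: adj_minus)
    then show "\<exists>y\<in>L. cnorm A (x\<^sup>\<star> \<ominus> y) < \<epsilon>"
      using adj[OF y(1)] by blast
  qed (simp add: adj_closed clD(1)[OF x])
  show "c \<odot> x \<in> ?cl" if x: "x \<in> ?cl" for x c
  proof (rule clI)
    fix \<epsilon> :: real assume "0 < \<epsilon>"
    then have "0 < \<epsilon> / (cmod c + 1)"
      by (simp add: add_nonneg_pos)
    then obtain y where y: "y \<in> L" "y \<in> carrier A" "cnorm A (x \<ominus> y) < \<epsilon> / (cmod c + 1)"
      using clD(2)[OF x] by blast
    have "cmod c * cnorm A (x \<ominus> y) \<le> (cmod c + 1) * cnorm A (x \<ominus> y)"
      using y clD(1)[OF x] by (intro mult_right_mono) (auto simp: norm_nonneg)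
    also have "\<dots> < \<epsilon>"
      using y(3) by (simp add: add_nonneg_pos pos_less_divide_eq mult.commute)
    finally have "cnorm A (c \<odot> x \<ominus> c \<odot> y) < \<epsilon>"
      using norm_smult[of "x \<ominus> y" c] y clD(1)[OF x] by (simp add: smult_minus_right)
    then show "\<exists>y\<in>L. cnorm A (c \<odot> x \<ominus> y) < \<epsilon>"
      using smult[OF y(1)] by blast
  qed (simp add: clD(1)[OF x])
  show "x \<oplus> y \<in> ?cl" if x: "x \<in> ?cl" and y: "y \<in> ?cl" for x y
  proof (rule clI)
    fix \<epsilon> :: real assume "0 < \<epsilon>"
    then have "0 < \<epsilon> / 2"
      by simp
    then obtain x' y' where
      x': "x' \<in> L" "x' \<in> carrier A" "cnorm A (x \<ominus> x') < \<epsilon> / 2" and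
      y': "y' \<in> L" "y' \<in> carrier A" "cnorm A (y \<ominus> y') < \<epsilon> / 2"
      using clD(2)[OF x] clD(2)[OF y] by metis
    have "(x \<oplus> y) \<ominus> (x' \<oplus> y') = (x \<ominus> x') \<oplus> (y \<ominus> y')"
      using clD(1)[OF x] clD(1)[OF y] x' y' by algebra
    then have "cnorm A ((x \<oplus> y) \<ominus> (x' \<oplus> y')) < \<epsilon>"
      using norm_add[of "x \<ominus> x'" "y \<ominus> y'"] clD(1)[OF x] clD(1)[OF y] x' y' by simp
    then show "\<exists>z\<in>L. cnorm A ((x \<oplus> y) \<ominus> z) < \<epsilon>"
      using add[OF x'(1) y'(1)] by blast
  qed (simp add: clD(1)[OF x] clD(1)[OF y])
  show "x \<otimes> y \<in> ?cl" if x: "x \<in> ?cl" and y: "y \<in> ?cl" for x y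
  proof (rule clI)
    fix \<epsilon> :: real assume "0 < \<epsilon>"
    define K where "K = cnorm A x + cnorm A y + 1"
    have K: "0 < K"
      using norm_nonneg clD(1)[OF x] clD(1)[OF y] by (simp add: K_def add_nonneg_pos)
    \<comment> \<open>The bound 1 on \<open>\<delta>\<close> keeps the norm of \<open>y'\<close>
      below \<open>cnorm A y + 1\<close>, which is where the summand 1 of \<open>K\<close> comes
      from.\<close>
    define \<delta> where "\<delta> = min 1 (\<epsilon> / (2 * K))"
    have \<delta>: "0 < \<delta>" "\<delta> \<le> 1" "\<delta> * K \<le> \<epsilon> / 2"
      using \<open>0 < \<epsilon>\<close> K by (auto simp: \<delta>_def min_def field_simps)
    obtain x' y' where
      x': "x' \<in> L" "x' \<in> carrier A" "cnorm A (x \<ominus> x') < \<delta>" and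
      y': "y' \<in> L" "y' \<in> carrier A" "cnorm A (y \<ominus> y') < \<delta>"
      using clD(2)[OF x] clD(2)[OF y] \<delta>(1) by metis
    have "cnorm A (x \<otimes> y \<ominus> x' \<otimes> y') \<le> cnorm A x * \<delta> + \<delta> * (cnorm A y + 1)"
      using clD(1)[OF x] clD(1)[OF y] x' y' \<delta>
      by (intro order_trans[OF norm_mult_diff] add_mono mult_mono) (auto simp: norm_nonneg)
    also have "\<dots> < \<epsilon>"
      using \<delta>(3) \<open>0 < \<epsilon>\<close> by (simp add: K_def algebra_simps)
    finally show "\<exists>z\<in>L. cnorm A (x \<otimes> y \<ominus> z) < \<epsilon>"
      using mult[OF x'(1) y'(1)] by blast
  qed (simp add: clD(1)[OF x] clD(1)[OF y])
  show "cstar_closed A ?cl"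
    unfolding cstar_closed_def
  proof (intro allI impI)
    fix z l
    assume z: "\<forall>n. z n \<in> ?cl" and l: "l \<in> carrier A" and lim: "cstar_tendsto A z l"
    show "l \<in> ?cl"
    proof (rule clI[OF l])
      fix \<epsilon> :: real assume "0 < \<epsilon>"
      then have "\<forall>\<^sub>F n in sequentially. cnorm A (z n \<ominus> l) < \<epsilon> / 2"
        using lim by (intro order_tendstoD(2)) (auto simp: cstar_tendsto_def)
      then obtain n where n: "cnorm A (z n \<ominus> l) < \<epsilon> / 2"
        using eventually_sequentially by auto
      obtain y where y: "y \<in> L" "y \<in> carrier A" "cnorm A (z n \<ominus> y) < \<epsilon> / 2"
        using clD(2)[of "z n" "\<epsilon> / 2"] z \<open>0 < \<epsilon>\<close> by auto
      have "cnorm A (l \<ominus> y) < \<epsilon>"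
        using norm_minus_triangle[of l "z n" y] norm_minus_commute[of l "z n"] n y l clD(1)[of "z n"] z
        by simp
      then show "\<exists>y\<in>L. cnorm A (l \<ominus> y) < \<epsilon>"
        using y by blast
    qed
  qed
qed

lemma subset_norm_closure: "L \<subseteq> carrier A \<Longrightarrow> L \<subseteq> norm_closure L"
  unfolding norm_closure_def by (auto simp: minus_eq r_neg intro!: bexI)

text \<open>A coarse substitute for bounding a self-adjoint element by its norm. The constant
  \<open>k\<close> is at least twice the norm so that \<open>w / k\<close> falls into the ball where
  square roots exist; the summand 1 keeps \<open>k\<close> positive when
  \<open>w = 0\<close>.\<close>

lemma exists_add_self_adj_square:
  assumes "w \<in> carrier A" "w\<^sup>\<star> = w"
  obtains k g where "g \<in> carrier A" "g\<^sup>\<star> \<otimes> g = of_real k \<odot> \<one> \<ominus> w"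
proof -
  define k where "k = 2 * cnorm A w + 1"
  have k: "0 < k"
    using norm_nonneg[OF assms(1)] by (simp add: k_def)
  define u where "u = of_real (1 / k) \<odot> w"
  have "cnorm A u = cnorm A w / k"
    using norm_smult[OF assms(1), of "complex_of_real (1 / k)"] k by (simp add: u_def norm_divide)
  also have "\<dots> \<le> 1/2"
    unfolding pos_divide_le_eq[OF k] by (simp add: k_def)
  finally have "cnorm A u \<le> 1/2" .
  then obtain s where s: "s \<in> carrier A" "s\<^sup>\<star> = s" "s \<otimes> s = \<one> \<ominus> u"
    using sqrt_one_minus[of u] assms by (auto simp: u_def adj_smult)
  define g where "g = of_real (sqrt k) \<odot> s"
  have "complex_of_real (sqrt k) * complex_of_real (sqrt k) = complex_of_real k"
    using k by (simp flip: of_real_mult)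
  then have "g\<^sup>\<star> \<otimes> g = of_real k \<odot> (s \<otimes> s)"
    using s(1,2) by (simp add: g_def adj_smult smult_mult_left smult_mult_right smult_smult)
  also have "\<dots> = of_real k \<odot> \<one> \<ominus> of_real k \<odot> u"
    using k assms(1) s by (simp add: smult_minus_right u_def)
  also have "of_real k \<odot> u = w"
    using k assms(1) by (simp add: u_def smult_smult)
  finally show thesis
    using that[of g k] s by (simp add: g_def)
qed

text \<open>This is how heredity gets applied: a hereditary subalgebra containing \<open>x\<close>
  contains the right-hand side. With \<open>g\<^sup>\<star> g = k - w\<close>, the difference of the
  two sides is \<open>h\<^sup>\<star> h\<close> for \<open>h = g x\<^sup>\<star>\<close>.\<close>

lemma cstar_le_conjugate:
  assumes "x \<in> carrier A" "w \<in> carrier A" "w\<^sup>\<star> = w"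
  obtains k where "cstar_le A (x \<otimes> w \<otimes> x\<^sup>\<star>) (of_real k \<odot> (x \<otimes> x\<^sup>\<star>))"
proof -
  obtain k g where g: "g \<in> carrier A" "g\<^sup>\<star> \<otimes> g = of_real k \<odot> \<one> \<ominus> w"
    using exists_add_self_adj_square[OF assms(2,3)] by blast
  have "(g \<otimes> x\<^sup>\<star>)\<^sup>\<star> \<otimes> (g \<otimes> x\<^sup>\<star>) = x \<otimes> (g\<^sup>\<star> \<otimes> g) \<otimes> x\<^sup>\<star>"
    using assms(1) g(1) by (simp add: adj_mult adj_adj adj_closed m_assoc)
  also have "\<dots> = x \<otimes> (of_real k \<odot> \<one>) \<otimes> x\<^sup>\<star> \<ominus> x \<otimes> w \<otimes> x\<^sup>\<star>"
    unfolding g(2) using assms(1,2) adj_closed[of x] smult_closed[OF one_closed, of "complex_of_real k"]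
    by algebra
  also have "x \<otimes> (of_real k \<odot> \<one>) \<otimes> x\<^sup>\<star> = of_real k \<odot> (x \<otimes> x\<^sup>\<star>)"
    using assms(1) by (simp add: smult_mult_left smult_mult_right adj_closed)
  finally show thesis
    using that[of k] g(1) assms(1) unfolding cstar_le_def cstar_positive_def
    by (metis adj_closed m_closed)
qed

text \<open>The isometry \<open>w\<close> shows that the unit is infinite; conjugation by
  \<open>z\<close> carries the unit to \<open>z z\<^sup>\<star>\<close> and \<open>w\<close> to the
  partial isometry \<open>z w z\<^sup>\<star>\<close>.\<close>

lemma infinite_projection_conjugate_isometry:
  assumes z: "isometry A z" and w: "isometry A w" "w \<otimes> w\<^sup>\<star> \<noteq> \<one>"
  shows "infinite_projection A (z \<otimes> z\<^sup>\<star>)"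
proof -
  have carr: "z \<in> carrier A" "w \<in> carrier A" "z\<^sup>\<star> \<in> carrier A" "w\<^sup>\<star> \<in> carrier A"
    using z w by (auto simp: isometry_def adj_closed)
  have zz: "z\<^sup>\<star> \<otimes> z = \<one>" and ww: "w\<^sup>\<star> \<otimes> w = \<one>"
    using z w by (auto simp: isometry_def)
  have zz': "z\<^sup>\<star> \<otimes> (z \<otimes> x) = x" and ww': "w\<^sup>\<star> \<otimes> (w \<otimes> x) = x" if "x \<in> carrier A" for x
    using that carr zz ww by (simp_all flip: m_assoc)
  define p q u where "p = z \<otimes> z\<^sup>\<star>" and "q = z \<otimes> (w \<otimes> (w\<^sup>\<star> \<otimes> z\<^sup>\<star>))" and "u = z \<otimes> (w \<otimes> z\<^sup>\<star>)"
  have "projection A p" "projection A q"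
    using carr by (simp_all add: projection_def p_def q_def adj_mult adj_adj m_assoc zz' ww')
  moreover have "u \<in> carrier A" "u\<^sup>\<star> \<otimes> u = p" "u \<otimes> u\<^sup>\<star> = q"
    using carr by (simp_all add: u_def p_def q_def adj_mult adj_adj m_assoc zz' ww')
  moreover have "cstar_le A q p"
  proof -
    define r where "r = (\<one> \<ominus> w \<otimes> w\<^sup>\<star>) \<otimes> z\<^sup>\<star>"
    have "(\<one> \<ominus> w \<otimes> w\<^sup>\<star>) \<otimes> (\<one> \<ominus> w \<otimes> w\<^sup>\<star>) = \<one> \<ominus> w \<otimes> w\<^sup>\<star> \<ominus> w \<otimes> w\<^sup>\<star> \<oplus> w \<otimes> (w\<^sup>\<star> \<otimes> w) \<otimes> w\<^sup>\<star>"
      using carr by algebra simp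
    also have "\<dots> = \<one> \<ominus> w \<otimes> w\<^sup>\<star>"
      unfolding ww using carr by algebra
    finally have "(\<one> \<ominus> w \<otimes> w\<^sup>\<star>) \<otimes> (\<one> \<ominus> w \<otimes> w\<^sup>\<star>) = \<one> \<ominus> w \<otimes> w\<^sup>\<star>" .
    moreover have "r\<^sup>\<star> \<otimes> r = z \<otimes> ((\<one> \<ominus> w \<otimes> w\<^sup>\<star>) \<otimes> (\<one> \<ominus> w \<otimes> w\<^sup>\<star>)) \<otimes> z\<^sup>\<star>"
      using carr by (simp add: r_def adj_mult adj_adj adj_minus m_assoc)
    moreover have "z \<otimes> (\<one> \<ominus> w \<otimes> w\<^sup>\<star>) \<otimes> z\<^sup>\<star> = p \<ominus> q"
      unfolding p_def q_def using carr by algebra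
    ultimately have "p \<ominus> q = r\<^sup>\<star> \<otimes> r"
      by simp
    moreover have "r \<in> carrier A"
      using carr by (simp add: r_def)
    ultimately show ?thesis
      by (auto simp: cstar_le_def cstar_positive_def)
  qed
  moreover have "q \<noteq> p"
  proof
    assume "q = p"
    then have "z\<^sup>\<star> \<otimes> (q \<otimes> z) = z\<^sup>\<star> \<otimes> (p \<otimes> z)"
      by simp
    then show False
      using carr w(2) by (simp add: p_def q_def m_assoc zz zz')
  qed
  ultimately show ?thesis
    unfolding infinite_projection_def p_def[symmetric] by blast
qed

text \<open>Cuntz: if every nonzero \<open>x\<close> compresses to the unit, then the hereditary subalgebra
  containing \<open>x\<close> contains the projection \<open>(x y) (x y)\<^sup>\<star>\<close>, which is equivalent to the unit.\<close>

lemma purely_infinite_simpleI: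
  assumes compress: "\<And>x. \<lbrakk>x \<in> carrier A; x \<noteq> \<zero>\<rbrakk> \<Longrightarrow> \<exists>y\<in>carrier A. isometry A (x \<otimes> y)"
    and "\<one> \<noteq> \<zero>"
    and w: "isometry A w" "w \<otimes> w\<^sup>\<star> \<noteq> \<one>"
  shows "purely_infinite A \<and> simple_cstar A"
proof
  show "purely_infinite A"
    unfolding purely_infinite_def
  proof (intro allI impI)
    fix H assume "hereditary_subalgebra A H \<and> H \<noteq> {\<zero>}"
    then have sub: "cstar_subalgebra A H" and "H \<noteq> {\<zero>}"
      and her: "\<And>a b. \<lbrakk>a \<in> H; b \<in> carrier A; cstar_positive A b; cstar_le A b a\<rbrakk> \<Longrightarrow> b \<in> H"
      by (auto simp: hereditary_subalgebra_def)
    then obtain x where x: "x \<in> H" "x \<noteq> \<zero>" "x \<in> carrier A"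
      by (auto simp: cstar_subalgebra_def)
    obtain y where y: "y \<in> carrier A" "isometry A (x \<otimes> y)"
      using compress[OF x(3,2)] by blast
    obtain k where k: "cstar_le A (x \<otimes> (y \<otimes> y\<^sup>\<star>) \<otimes> x\<^sup>\<star>) (of_real k \<odot> (x \<otimes> x\<^sup>\<star>))"
      using cstar_le_conjugate[of x "y \<otimes> y\<^sup>\<star>"] x y by (auto simp: adj_closed adj_mult adj_adj)
    let ?p = "(x \<otimes> y) \<otimes> (x \<otimes> y)\<^sup>\<star>"
    have eq: "x \<otimes> (y \<otimes> y\<^sup>\<star>) \<otimes> x\<^sup>\<star> = ?p"
      using x y by (simp add: adj_mult adj_closed m_assoc)
    have "x\<^sup>\<star> \<in> H"
      using sub x(1) by (simp add: cstar_subalgebra_def)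
    then have "of_real k \<odot> (x \<otimes> x\<^sup>\<star>) \<in> H"
      using sub x(1) by (simp add: cstar_subalgebra_def)
    moreover have "cstar_positive A ?p"
      unfolding cstar_positive_def using x y
      by (intro bexI[of _ "(x \<otimes> y)\<^sup>\<star>"]) (simp_all add: adj_adj adj_closed)
    ultimately have "?p \<in> H"
      using her k x y by (simp add: eq adj_closed)
    then show "\<exists>p\<in>H. infinite_projection A p"
      using infinite_projection_conjugate_isometry[OF y(2) w] by blast
  qed
  show "simple_cstar A"
    unfolding simple_cstar_def
  proof (intro conjI allI impI)
    show "carrier A \<noteq> {\<zero>}"
      using assms(2) one_closed by blast
    fix I assume "ideal I A \<and> cstar_closed A I"
    then interpret I: ideal I A
      by simp
    show "I = {\<zero>} \<or> I = carrier A"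
    proof (rule disjCI)
      assume "I \<noteq> carrier A"
      show "I = {\<zero>}"
      proof (rule ccontr)
        assume "I \<noteq> {\<zero>}"
        then obtain x where x: "x \<in> I" "x \<noteq> \<zero>"
          using I.zero_closed by blast
        then obtain y where y: "y \<in> carrier A" "isometry A (x \<otimes> y)"
          using compress I.Icarr by blast
        have "(x \<otimes> y)\<^sup>\<star> \<otimes> (x \<otimes> y) \<in> I"
          using x y I.Icarr by (intro I.I_l_closed I.I_r_closed adj_closed) auto
        then have "\<one> \<in> I"
          using y(2) by (simp add: isometry_def)
        then show False
          using \<open>I \<noteq> carrier A\<close> I.one_imp_carrier by blast
      qed
    qed
  qed
qed

end

section \<open>Semigroups with right least common multiples\<close>

definition left_cancellative :: "('s, 'k) monoid_scheme \<Rightarrow> bool" where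
  "left_cancellative S \<longleftrightarrow> (\<forall>p\<in>carrier S. \<forall>x\<in>carrier S. \<forall>y\<in>carrier S.
    p \<otimes>\<^bsub>S\<^esub> x = p \<otimes>\<^bsub>S\<^esub> y \<longrightarrow> x = y)"

definition pideal :: "('s, 'k) monoid_scheme \<Rightarrow> 's \<Rightarrow> 's set" where
  "pideal S s = s <#\<^bsub>S\<^esub> carrier S"

definition right_lcm :: "('s, 'k) monoid_scheme \<Rightarrow> bool" where
  "right_lcm S \<longleftrightarrow> (\<forall>s\<in>carrier S. \<forall>t\<in>carrier S. pideal S s \<inter> pideal S t = {} \<or>
    (\<exists>r\<in>carrier S. pideal S s \<inter> pideal S t = pideal S r))"

lemma mem_pideal: "x \<in> pideal S s \<longleftrightarrow> (\<exists>a\<in>carrier S. x = s \<otimes>\<^bsub>S\<^esub> a)"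
  by (auto simp: pideal_def l_coset_def)

context monoid
begin

lemma self_mem_pideal: "s \<in> carrier G \<Longrightarrow> s \<in> pideal G s"
  by (auto simp: mem_pideal intro: bexI[of _ \<one>])

lemma principal_subset: "s \<in> carrier G \<Longrightarrow> pideal G s \<subseteq> carrier G"
  by (auto simp: mem_pideal)

lemma principal_mono: "\<lbrakk>s \<in> carrier G; t \<in> pideal G s\<rbrakk> \<Longrightarrow> pideal G t \<subseteq> pideal G s"
  by (auto simp: mem_pideal m_assoc) (metis m_closed)

lemma principal_mult_subset:
  "\<lbrakk>s \<in> carrier G; a \<in> carrier G\<rbrakk> \<Longrightarrow> pideal G (s \<otimes> a) \<subseteq> pideal G s"
  by (rule principal_mono) (auto simp: mem_pideal)

lemma principal_one: "pideal G \<one> = carrier G"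
  by (auto simp: mem_pideal)

lemma constructible_ideals_principal: "s \<in> carrier G \<Longrightarrow> pideal G s \<in> constructible_ideals G"
  unfolding pideal_def by (intro constructible_ideals.image constructible_ideals.whole)

text \<open>Only preimages call for the two hypotheses. The preimage of \<open>X\<close> under
  \<open>p\<close> depends on \<open>pS \<inter> X\<close> alone; if this is \<open>tS\<close> with
  \<open>t = p a\<close>, cancelling \<open>p\<close> identifies the preimage as
  \<open>aS\<close>.\<close>

lemma constructible_ideals_right_lcm:
  assumes "left_cancellative G" "right_lcm G" "X \<in> constructible_ideals G"
  shows "X = {} \<or> (\<exists>r\<in>carrier G. X = pideal G r)"
  using assms(3)
proof induction
  case whole
  then show ?case
    using principal_one by auto
next
  case (image p X)
  have "p <# pideal G r = pideal G (p \<otimes> r)" if "r \<in> carrier G" for r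
    using image.hyps(1) that by (auto simp: pideal_def l_coset_def m_assoc)
  then have "p <# pideal G r = {} \<or> (\<exists>r'\<in>carrier G. p <# pideal G r = pideal G r')"
    if "r \<in> carrier G" for r
    using image.hyps(1) that m_closed by blast
  moreover have "p <# {} = {}"
    by (simp add: l_coset_def)
  ultimately show ?case
    using image.IH by metis
next
  case (preimage p X)
  show ?case
  proof (cases "X = {}")
    case False
    then obtain r where r: "r \<in> carrier G" "X = pideal G r"
      using preimage.IH by blast
    have eq: "{y \<in> carrier G. p \<otimes> y \<in> X} = {y \<in> carrier G. p \<otimes> y \<in> pideal G p \<inter> X}"
      by (auto simp: mem_pideal)
    have "pideal G p \<inter> X = {} \<or> (\<exists>t\<in>carrier G. pideal G p \<inter> X = pideal G t)"
      using assms(2) preimage.hyps(1) r by (simp add: right_lcm_def)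
    then consider "pideal G p \<inter> X = {}" | t where "t \<in> carrier G" "pideal G p \<inter> X = pideal G t"
      by blast
    then show ?thesis
    proof cases
      case 1
      then show ?thesis
        using eq by auto
    next
      case 2
      then have "t \<in> pideal G p"
        using self_mem_pideal by blast
      then obtain a where a: "a \<in> carrier G" "t = p \<otimes> a"
        by (auto simp: mem_pideal)
      have "{y \<in> carrier G. p \<otimes> y \<in> pideal G t} = pideal G a"
      proof (intro equalityI subsetI)
        fix y assume "y \<in> {y \<in> carrier G. p \<otimes> y \<in> pideal G t}"
        then obtain b where b: "y \<in> carrier G" "b \<in> carrier G" "p \<otimes> y = p \<otimes> (a \<otimes> b)"
          using a preimage.hyps(1) by (auto simp: mem_pideal m_assoc)
        then have "y = a \<otimes> b"
          using assms(1) a(1) preimage.hyps(1) unfolding left_cancellative_def by blast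
        then show "y \<in> pideal G a"
          using b(2) by (auto simp: mem_pideal)
      next
        fix y assume "y \<in> pideal G a"
        then obtain b where "b \<in> carrier G" "y = a \<otimes> b"
          by (auto simp: mem_pideal)
        then show "y \<in> {y \<in> carrier G. p \<otimes> y \<in> pideal G t}"
          using a preimage.hyps(1) by (auto simp: mem_pideal m_assoc intro!: bexI[of _ b])
      qed
      then show ?thesis
        using eq 2 a by auto
    qed
  qed auto
qed auto

end

section \<open>Families satisfying the relations: products and span of the monomials\<close>

locale right_lcm_cstar = unital_cstar_algebra A + S: monoid S
  for A :: "('a, 'm) cstar_algebra_scheme" (structure) and S :: "('s, 'k) monoid_scheme" +
  fixes v :: "'s \<Rightarrow> 'a" and e :: "'s set \<Rightarrow> 'a"
  assumes relations: "semigroup_cstar_relations S A v e"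
    and left_cancellative: "left_cancellative S"
    and right_lcm: "right_lcm S"
begin

abbreviation ideals :: "'s set set" where "ideals \<equiv> constructible_ideals S"
abbreviation pr :: "'s \<Rightarrow> 's set" where "pr \<equiv> pideal S"
abbreviation S_mult (infixl \<open>\<cdot>\<close> 70) where "s \<cdot> t \<equiv> s \<otimes>\<^bsub>S\<^esub> t"

lemma v_isometry: "p \<in> carrier S \<Longrightarrow> isometry A (v p)"
  and e_projection: "X \<in> ideals \<Longrightarrow> projection A (e X)"
  and v_mult: "\<lbrakk>p \<in> carrier S; q \<in> carrier S\<rbrakk> \<Longrightarrow> v p \<otimes> v q = v (p \<cdot> q)"
  and v_e_adj: "\<lbrakk>p \<in> carrier S; X \<in> ideals\<rbrakk> \<Longrightarrow> v p \<otimes> e X \<otimes> (v p)\<^sup>\<star> = e (p <#\<^bsub>S\<^esub> X)"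
  and e_empty: "e {} = \<zero>"
  and e_whole: "e (carrier S) = \<one>"
  and e_mult: "\<lbrakk>X \<in> ideals; Y \<in> ideals\<rbrakk> \<Longrightarrow> e X \<otimes> e Y = e (X \<inter> Y)"
  using relations by (auto simp: semigroup_cstar_relations_def)

lemma v_closed [simp]: "p \<in> carrier S \<Longrightarrow> v p \<in> carrier A" "p \<in> carrier S \<Longrightarrow> (v p)\<^sup>\<star> \<in> carrier A"
  using v_isometry by (auto simp: isometry_def adj_closed)

lemma v_adj_v: "p \<in> carrier S \<Longrightarrow> (v p)\<^sup>\<star> \<otimes> v p = \<one>"
  using v_isometry by (auto simp: isometry_def)

lemma v_adj_v_cancel: "\<lbrakk>p \<in> carrier S; x \<in> carrier A\<rbrakk> \<Longrightarrow> (v p)\<^sup>\<star> \<otimes> (v p \<otimes> x) = x"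
  using v_adj_v[of p] by (simp flip: m_assoc)

lemma e_closed [simp]: "X \<in> ideals \<Longrightarrow> e X \<in> carrier A"
  and e_adj [simp]: "X \<in> ideals \<Longrightarrow> (e X)\<^sup>\<star> = e X"
  using e_projection by (auto simp: projection_def)

lemma v_one: "v \<one>\<^bsub>S\<^esub> = \<one>"
  using v_adj_v_cancel[of "\<one>\<^bsub>S\<^esub>" "v \<one>\<^bsub>S\<^esub>"] v_mult[of "\<one>\<^bsub>S\<^esub>" "\<one>\<^bsub>S\<^esub>"] v_adj_v[of "\<one>\<^bsub>S\<^esub>"] by simp

lemma pr_ideal [simp]: "s \<in> carrier S \<Longrightarrow> pr s \<in> ideals"
  by (rule S.constructible_ideals_principal)

lemma ideal_cases:
  assumes "X \<in> ideals"
  obtains "X = {}" | r where "r \<in> carrier S" "X = pr r"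
  using S.constructible_ideals_right_lcm[OF left_cancellative right_lcm assms] by blast

lemma ideals_Int [simp]: "\<lbrakk>X \<in> ideals; Y \<in> ideals\<rbrakk> \<Longrightarrow> X \<inter> Y \<in> ideals"
proof -
  assume "X \<in> ideals" "Y \<in> ideals"
  then consider "X \<inter> Y = {}" | r t where "r \<in> carrier S" "t \<in> carrier S" "X \<inter> Y = pr r \<inter> pr t"
    by (elim ideal_cases) auto
  then show ?thesis
  proof cases
    case 2
    then show ?thesis
      using right_lcm by (metis right_lcm_def constructible_ideals.empty pr_ideal)
  qed (simp add: constructible_ideals.empty)
qed

lemma e_pr: "s \<in> carrier S \<Longrightarrow> e (pr s) = v s \<otimes> (v s)\<^sup>\<star>"
  using v_e_adj[of s "carrier S"] by (simp add: pideal_def e_whole constructible_ideals.whole)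

text \<open>Inserting the range projections \<open>e (pr s)\<close> and \<open>e (pr t)\<close>
  between the two factors changes nothing, and their product is \<open>e {} = 0\<close>.\<close>

lemma v_adj_mult_disjoint:
  assumes "s \<in> carrier S" "t \<in> carrier S" "pr s \<inter> pr t = {}"
  shows "(v s)\<^sup>\<star> \<otimes> v t = \<zero>"
proof -
  have "(v s)\<^sup>\<star> \<otimes> v t = (v s)\<^sup>\<star> \<otimes> (e (pr s) \<otimes> e (pr t)) \<otimes> v t"
    using assms(1,2) by (simp add: e_pr m_assoc v_adj_v v_adj_v_cancel)
  also have "\<dots> = \<zero>"
    using assms by (simp add: e_mult e_empty)
  finally show ?thesis .
qed

lemma v_adj_mult_mem:
  assumes "s \<in> carrier S" "a \<in> carrier S"
  shows "(v s)\<^sup>\<star> \<otimes> v (s \<cdot> a) = v a"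
  using assms by (simp add: v_adj_v_cancel flip: v_mult)

text \<open>For a right least common multiple \<open>r = s a = t b\<close> the same insertion yields
  \<open>v r (v r)\<^sup>\<star>\<close>, and cancelling \<open>v s\<close> and \<open>v t\<close>
  leaves \<open>v a (v b)\<^sup>\<star>\<close>. Hence a product of monomials is a monomial or
  zero.\<close>

lemma v_adj_mult_cases:
  assumes "s \<in> carrier S" "t \<in> carrier S"
  obtains "(v s)\<^sup>\<star> \<otimes> v t = \<zero>" | a b where "a \<in> carrier S" "b \<in> carrier S" "(v s)\<^sup>\<star> \<otimes> v t = v a \<otimes> (v b)\<^sup>\<star>"
proof (cases "pr s \<inter> pr t = {}")
  case True
  then show thesis
    using v_adj_mult_disjoint[OF assms] that(1) by blast
next
  case False
  then obtain r where r: "r \<in> carrier S" "pr s \<inter> pr t = pr r"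
    using right_lcm assms unfolding right_lcm_def by blast
  then have "r \<in> pr s" "r \<in> pr t"
    using S.self_mem_pideal by blast+
  then obtain a b where ab: "a \<in> carrier S" "b \<in> carrier S" "r = s \<cdot> a" "r = t \<cdot> b"
    by (auto simp: mem_pideal)
  have "(v s)\<^sup>\<star> \<otimes> v t = (v s)\<^sup>\<star> \<otimes> (e (pr s) \<otimes> e (pr t)) \<otimes> v t"
    using assms(1,2) by (simp add: e_pr m_assoc v_adj_v v_adj_v_cancel)
  also have "e (pr s) \<otimes> e (pr t) = v r \<otimes> (v r)\<^sup>\<star>"
    using assms r e_mult[of "pr s" "pr t"] e_pr[of r] by simp
  also have "(v s)\<^sup>\<star> \<otimes> (v r \<otimes> (v r)\<^sup>\<star>) \<otimes> v t = ((v s)\<^sup>\<star> \<otimes> v r) \<otimes> ((v r)\<^sup>\<star> \<otimes> v t)"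
    using assms r by (simp add: m_assoc)
  also have "(v s)\<^sup>\<star> \<otimes> v r = v a"
    using v_adj_mult_mem[OF assms(1) ab(1)] ab by simp
  also have "(v r)\<^sup>\<star> \<otimes> v t = ((v t)\<^sup>\<star> \<otimes> v r)\<^sup>\<star>"
    using assms r by (simp add: adj_mult adj_adj)
  also have "(v t)\<^sup>\<star> \<otimes> v r = v b"
    using v_adj_mult_mem[OF assms(2) ab(2)] ab by simp
  finally show thesis
    using that(2) ab by blast
qed

text \<open>Built by prepending single monomials rather than by adding arbitrary elements, so that
  each element can be read off as a list of terms.\<close>

inductive_set vspan :: "'a set" where
  zero: "\<zero> \<in> vspan"
| step: "\<lbrakk>x \<in> vspan; s \<in> carrier S; t \<in> carrier S\<rbrakk> \<Longrightarrow> c \<odot> (v s \<otimes> (v t)\<^sup>\<star>) \<oplus> x \<in> vspan"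

lemma vspan_closed: "x \<in> vspan \<Longrightarrow> x \<in> carrier A"
  by (induction rule: vspan.induct) auto

lemma vspan_add: "\<lbrakk>x \<in> vspan; y \<in> vspan\<rbrakk> \<Longrightarrow> x \<oplus> y \<in> vspan"
proof (induction rule: vspan.induct)
  case (step x s t c)
  then have "c \<odot> (v s \<otimes> (v t)\<^sup>\<star>) \<oplus> (x \<oplus> y) \<in> vspan"
    by (intro vspan.step) auto
  then show ?case
    using step vspan_closed by (simp add: a_assoc)
qed (simp add: vspan_closed)

lemma vspan_monomial: "\<lbrakk>s \<in> carrier S; t \<in> carrier S\<rbrakk> \<Longrightarrow> v s \<otimes> (v t)\<^sup>\<star> \<in> vspan"
  using vspan.step[OF vspan.zero, of s t 1] by simp

lemma vspan_smult: "x \<in> vspan \<Longrightarrow> c \<odot> x \<in> vspan"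
proof (induction rule: vspan.induct)
  case (step x s t d)
  then have "(c * d) \<odot> (v s \<otimes> (v t)\<^sup>\<star>) \<oplus> c \<odot> x \<in> vspan"
    by (intro vspan.step) auto
  then show ?case
    using step vspan_closed by (simp add: smult_add_right smult_smult)
qed (simp add: vspan.zero)

lemma vspan_adj: "x \<in> vspan \<Longrightarrow> x\<^sup>\<star> \<in> vspan"
proof (induction rule: vspan.induct)
  case (step x s t d)
  then have "cnj d \<odot> (v t \<otimes> (v s)\<^sup>\<star>) \<oplus> x\<^sup>\<star> \<in> vspan"
    by (intro vspan.step) auto
  then show ?case
    using step vspan_closed by (simp add: adj_add adj_smult adj_mult adj_adj)
qed (simp add: vspan.zero)

lemma vspan_mult_monomials:
  assumes "s \<in> carrier S" "t \<in> carrier S" "p \<in> carrier S" "q \<in> carrier S"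
  shows "(v s \<otimes> (v t)\<^sup>\<star>) \<otimes> (v p \<otimes> (v q)\<^sup>\<star>) \<in> vspan"
proof -
  have eq: "(v s \<otimes> (v t)\<^sup>\<star>) \<otimes> (v p \<otimes> (v q)\<^sup>\<star>) = v s \<otimes> ((v t)\<^sup>\<star> \<otimes> v p) \<otimes> (v q)\<^sup>\<star>"
    using assms by (simp add: m_assoc)
  show ?thesis
  proof (rule v_adj_mult_cases[OF assms(2,3)])
    assume "(v t)\<^sup>\<star> \<otimes> v p = \<zero>"
    then show ?thesis
      using assms by (simp add: eq vspan.zero)
  next
    fix a b assume ab: "a \<in> carrier S" "b \<in> carrier S" "(v t)\<^sup>\<star> \<otimes> v p = v a \<otimes> (v b)\<^sup>\<star>"
    have "v s \<otimes> (v a \<otimes> (v b)\<^sup>\<star>) \<otimes> (v q)\<^sup>\<star> = (v s \<otimes> v a) \<otimes> (v q \<otimes> v b)\<^sup>\<star>"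
      using assms ab by (simp add: adj_mult m_assoc)
    then show ?thesis
      using assms ab vspan_monomial by (simp add: eq v_mult)
  qed
qed

lemma vspan_mult:
  assumes "x \<in> vspan" "y \<in> vspan"
  shows "x \<otimes> y \<in> vspan"
proof -
  have mono: "(v s \<otimes> (v t)\<^sup>\<star>) \<otimes> y \<in> vspan" if "s \<in> carrier S" "t \<in> carrier S" for s t
    using assms(2)
  proof (induction rule: vspan.induct)
    case (step y p q d)
    have "d \<odot> ((v s \<otimes> (v t)\<^sup>\<star>) \<otimes> (v p \<otimes> (v q)\<^sup>\<star>)) \<oplus> (v s \<otimes> (v t)\<^sup>\<star>) \<otimes> y \<in> vspan"
      using step that by (intro vspan_add vspan_smult vspan_mult_monomials) auto
    then show ?case
      using step that vspan_closed by (simp add: r_distr smult_mult_right)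
  qed (use that in \<open>simp add: vspan.zero\<close>)
  show ?thesis
    using assms(1)
  proof (induction rule: vspan.induct)
    case (step x s t c)
    have "c \<odot> ((v s \<otimes> (v t)\<^sup>\<star>) \<otimes> y) \<oplus> x \<otimes> y \<in> vspan"
      using step by (intro vspan_add vspan_smult mono) auto
    then show ?case
      using step vspan_closed assms(2) by (simp add: l_distr smult_mult_left)
  qed (use assms(2) vspan_closed in \<open>simp add: vspan.zero\<close>)
qed

lemma vspan_dense:
  assumes "cstar_generated A (v ` carrier S \<union> e ` ideals) = carrier A"
    and "x \<in> carrier A" "0 < \<epsilon>"
  obtains y where "y \<in> vspan" "cnorm A (x \<ominus> y) < \<epsilon>"
proof -
  have "vspan \<subseteq> carrier A"
    using vspan_closed by blast
  have "v s \<in> vspan" if "s \<in> carrier S" for s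
    using vspan_monomial[OF that S.one_closed] that by (simp add: v_one)
  moreover have "e X \<in> vspan" if "X \<in> ideals" for X
    using that by (rule ideal_cases) (auto simp: e_empty vspan.zero e_pr vspan_monomial)
  ultimately have "v ` carrier S \<union> e ` ideals \<subseteq> norm_closure vspan"
    using subset_norm_closure[OF \<open>vspan \<subseteq> carrier A\<close>] by blast
  moreover have "cstar_subalgebra A (norm_closure vspan)"
    by (rule cstar_subalgebra_norm_closure)
      (auto intro: vspan.zero vspan_add vspan_mult vspan_smult vspan_adj vspan_closed)
  ultimately have "carrier A \<subseteq> norm_closure vspan"
    unfolding assms(1)[symmetric] cstar_generated_def by blast
  then show thesis
    using that assms(2,3) unfolding norm_closure_def by blast
qed

subsection \<open>Norms in the diagonal\<close>

text \<open>The algebraic part of the diagonal, without norm closure: the norm computation below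
  involves only finite combinations, and uses that they commute.\<close>

inductive_set diag :: "'a set" where
  proj: "X \<in> ideals \<Longrightarrow> e X \<in> diag"
| add: "\<lbrakk>x \<in> diag; y \<in> diag\<rbrakk> \<Longrightarrow> x \<oplus> y \<in> diag"
| mult: "\<lbrakk>x \<in> diag; y \<in> diag\<rbrakk> \<Longrightarrow> x \<otimes> y \<in> diag"
| smult: "x \<in> diag \<Longrightarrow> c \<odot> x \<in> diag"

lemma diag_closed [simp]: "x \<in> diag \<Longrightarrow> x \<in> carrier A"
  by (induction rule: diag.induct) auto

lemma diag_one: "\<one> \<in> diag"
  using diag.proj[OF constructible_ideals.whole] by (simp add: e_whole)

lemma diag_zero: "\<zero> \<in> diag"
  using diag.proj[OF constructible_ideals.empty] by (simp add: e_empty)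

lemma diag_minus: "\<lbrakk>x \<in> diag; y \<in> diag\<rbrakk> \<Longrightarrow> x \<ominus> y \<in> diag"
  using diag.add[OF _ diag.smult[of y "- 1"], of x] by (simp add: minus_eq smult_uminus_left)

lemma diag_commute:
  assumes "x \<in> diag" "y \<in> diag"
  shows "x \<otimes> y = y \<otimes> x"
proof -
  have e: "e X \<otimes> y = y \<otimes> e X" if "X \<in> ideals" for X
    using assms(2)
  proof (induction rule: diag.induct)
    case (proj Y)
    then show ?case
      using that by (simp add: e_mult Int_commute)
  next
    case (mult y z)
    then show ?case
      using that by (metis diag_closed e_closed m_assoc)
  qed (use that in \<open>simp_all add: l_distr r_distr smult_mult_left smult_mult_right\<close>)
  show ?thesis
    using assms(1)
  proof (induction rule: diag.induct)
    case (proj X)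
    then show ?case
      by (rule e)
  next
    case (mult x z)
    then show ?case
      using assms(2) by (metis diag_closed m_assoc)
  qed (use assms(2) in \<open>simp_all add: l_distr r_distr smult_mult_left smult_mult_right\<close>)
qed

lemma diag_adj: "x \<in> diag \<Longrightarrow> x\<^sup>\<star> \<in> diag"
  by (induction rule: diag.induct)
    (auto simp: adj_add adj_mult adj_smult intro: diag.intros)

fun comb :: "(complex \<times> 's \<times> 's) list \<Rightarrow> 'a" where
  "comb [] = \<zero>"
| "comb ((c, s, t) # xs) = c \<odot> (v s \<otimes> (v t)\<^sup>\<star>) \<oplus> comb xs"

text \<open>In the left regular representation the diagonal terms act by multiplication, and this is
  the multiplier at the basis vector \<open>r\<close>. It supplies the scalar
  \<open>\<kappa>\<close> of the overview.\<close>

fun diag_value :: "(complex \<times> 's \<times> 's) list \<Rightarrow> 's \<Rightarrow> complex" where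
  "diag_value [] r = 0"
| "diag_value ((c, s, t) # xs) r = (if s = t \<and> r \<in> pr s then c else 0) + diag_value xs r"

abbreviation terms :: "(complex \<times> 's \<times> 's) list set" where
  "terms \<equiv> lists (UNIV \<times> carrier S \<times> carrier S)"

lemma comb_closed [simp]: "xs \<in> terms \<Longrightarrow> comb xs \<in> carrier A"
  by (induction xs rule: comb.induct) auto

lemma vspan_comb: "x \<in> vspan \<Longrightarrow> \<exists>xs\<in>terms. x = comb xs"
proof (induction rule: vspan.induct)
  case (step x s t c)
  then obtain xs where "xs \<in> terms" "x = comb xs"
    by blast
  then show ?case
    using step by (intro bexI[of _ "(c, s, t) # xs"]) auto
qed (auto intro: bexI[of _ "[]"])

abbreviation diag_part :: "(complex \<times> 's \<times> 's) list \<Rightarrow> (complex \<times> 's \<times> 's) list" where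
  "diag_part \<equiv> filter (\<lambda>(c, s, t). s = t)"

lemma comb_diag_part: "xs \<in> terms \<Longrightarrow> comb (diag_part xs) \<in> diag"
  by (induction xs rule: comb.induct)
    (auto simp: diag_zero intro!: diag.add diag.smult simp flip: e_pr intro: diag.proj)

text \<open>Splitting off the complementary corners \<open>e\<^bsub>sS\<^esub>\<close> and \<open>1 - e\<^bsub>sS\<^esub>\<close> one after the other
  leads to the projection \<open>corner X ys\<close> onto \<open>X\<close> minus the ideals generated by \<open>ys\<close>. This
  projection vanishes unless a generator of \<open>X\<close> survives, which then serves as the point \<open>r\<close>.\<close>

primrec corner :: "'s set \<Rightarrow> 's list \<Rightarrow> 'a" where
  "corner X [] = e X"
| "corner X (s # ys) = (\<one> \<ominus> e (pr s)) \<otimes> corner X ys"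

lemma corner_diag: "\<lbrakk>X \<in> ideals; set ys \<subseteq> carrier S\<rbrakk> \<Longrightarrow> corner X ys \<in> diag"
  by (induction ys) (auto intro!: diag.intros diag_minus diag_one)

lemma projection_corner:
  assumes "X \<in> ideals" "set ys \<subseteq> carrier S"
  shows "projection A (corner X ys)"
  using assms(2)
proof (induction ys)
  case (Cons s ys)
  let ?p = "\<one> \<ominus> e (pr s)" and ?q = "corner X ys"
  have p: "?p \<in> diag" "?q \<in> diag"
    using Cons corner_diag[OF assms(1)] by (auto intro!: diag_minus diag_one diag.proj)
  have es: "e (pr s) \<in> carrier A"
    using Cons.prems by simp
  have "e (pr s) \<otimes> e (pr s) = e (pr s)"
    using Cons e_projection by (simp add: projection_def)
  moreover have "?p \<otimes> ?p = \<one> \<ominus> e (pr s) \<ominus> e (pr s) \<oplus> e (pr s) \<otimes> e (pr s)"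
    using es by algebra simp
  moreover have "\<one> \<ominus> e (pr s) \<ominus> e (pr s) \<oplus> e (pr s) = ?p"
    using es by algebra
  ultimately have pp: "?p \<otimes> ?p = ?p"
    by simp
  have "(?p \<otimes> ?q) \<otimes> (?p \<otimes> ?q) = (?p \<otimes> ?p) \<otimes> (?q \<otimes> ?q)"
    using p diag_commute[OF p] by (metis diag_closed m_assoc m_closed)
  then have "(?p \<otimes> ?q) \<otimes> (?p \<otimes> ?q) = ?p \<otimes> ?q"
    using Cons pp by (simp add: projection_def)
  moreover have "(?p \<otimes> ?q)\<^sup>\<star> = ?p \<otimes> ?q"
    using Cons p diag_commute[OF p] by (simp add: adj_mult adj_minus projection_def)
  ultimately show ?case
    using p by (simp add: projection_def)
qed (simp add: assms(1) e_projection)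

lemma corner_Int:
  assumes "X \<in> ideals" "set ys \<subseteq> carrier S" "s \<in> carrier S"
  shows "corner X ys \<otimes> e (pr s) = corner (X \<inter> pr s) ys"
  using assms(2)
proof (induction ys)
  case (Cons t ys)
  then show ?case
    using corner_diag[OF assms(1)] assms(3) by (simp add: m_assoc)
qed (simp add: e_mult assms)

text \<open>From \<open>r \<in> pr t\<close> follows \<open>pr r \<subseteq> pr t\<close>, so the
  factor belonging to \<open>t\<close> annihilates \<open>e (pr r)\<close>; commutativity brings the
  two together.\<close>

lemma corner_eq_zero:
  assumes "r \<in> carrier S" "set ys \<subseteq> carrier S" "t \<in> set ys" "r \<in> pr t"
  shows "corner (pr r) ys = \<zero>"
  using assms(2,3)
proof (induction ys)
  case (Cons s ys)
  have carr: "corner (pr r) ys \<in> diag"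
    using Cons assms(1) by (intro corner_diag) auto
  show ?case
  proof (cases "t \<in> set ys")
    case True
    then show ?thesis
      using Cons by simp
  next
    case False
    then have "s = t"
      using Cons.prems by simp
    have "pr r \<inter> pr t = pr r"
      using S.principal_mono[of t r] assms(4) Cons.prems by auto
    then have "corner (pr r) ys \<otimes> e (pr s) = corner (pr r) ys"
      using corner_Int[of "pr r" ys s] Cons assms(1) \<open>s = t\<close> by simp
    moreover have "e (pr s) \<otimes> corner (pr r) ys = corner (pr r) ys \<otimes> e (pr s)"
      using carr Cons.prems by (intro diag_commute diag.proj) auto
    ultimately show ?thesis
      using carr Cons.prems by (simp add: minus_eq l_distr l_minus r_neg)
  qed
qed simp

lemma corner_nonzero:
  assumes "X \<in> ideals" "set ys \<subseteq> carrier S" "corner X ys \<noteq> \<zero>"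
  obtains r where "r \<in> X" "r \<in> carrier S" "\<forall>s\<in>set ys. r \<notin> pr s"
  using assms(1)
proof (rule ideal_cases)
  assume "X = {}"
  have "corner {} ys = \<zero>"
    using assms(2) by (induction ys) (auto simp: e_empty)
  then show thesis
    using assms(3) \<open>X = {}\<close> by simp
next
  fix r assume "r \<in> carrier S" "X = pr r"
  then show thesis
    using that[of r] corner_eq_zero[of r ys] assms(2,3) S.self_mem_pideal by blast
qed

text \<open>The scalar \<open>\<mu>\<close> accumulates the coefficients of the terms already
  decided. Each further term splits the corner into two orthogonal ones, and since the norm of an
  orthogonal sum is at most the larger norm, the strict bound survives in one of them. Once the list
  is exhausted only a scalar on a nonzero corner remains, and a point of that corner realises all
  decisions.\<close>

lemma corner_norm_less:
  assumes "xs \<in> terms" "\<forall>(c, s, t)\<in>set xs. s = t"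
    and "X \<in> ideals" "set ys \<subseteq> carrier S" "0 \<le> M"
    and "M < cnorm A ((\<mu> \<odot> \<one> \<oplus> comb xs) \<otimes> corner X ys)"
  shows "\<exists>r\<in>carrier S. r \<in> X \<and> (\<forall>s\<in>set ys. r \<notin> pr s) \<and> M < cmod (\<mu> + diag_value xs r)"
  using assms
proof (induction xs arbitrary: X ys \<mu> rule: comb.induct)
  case 1
  let ?Q = "corner X ys"
  have Q: "?Q \<in> carrier A" "cnorm A ?Q \<le> 1"
    using projection_corner[OF 1(3,4)] norm_projection_le_1 by (auto simp: projection_def)
  have lt: "M < cmod \<mu> * cnorm A ?Q"
    using 1(6) Q norm_smult[of ?Q \<mu>] by (simp add: smult_mult_left)
  then have "?Q \<noteq> \<zero>"
    using \<open>0 \<le> M\<close> by auto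
  then obtain r where r: "r \<in> X" "r \<in> carrier S" "\<forall>s\<in>set ys. r \<notin> pr s"
    using corner_nonzero 1(3,4) by blast
  have "cmod \<mu> * cnorm A ?Q \<le> cmod \<mu>"
    using Q(2) by (simp add: mult_left_le)
  then show ?case
    using r lt by auto
next
  case (2 c s t xs)
  have st: "t = s" and s: "s \<in> carrier S" and xs: "xs \<in> terms" "\<forall>(c, s, t)\<in>set xs. s = t"
    using 2(2,3) by auto
  let ?Q = "corner X ys" and ?p = "e (pr s)" and ?q = "\<one> \<ominus> e (pr s)"
  \<comment> \<open>Under \<open>e (pr s)\<close> the head term acts as the scalar \<open>c\<close>,
    under the complement as 0; \<open>a\<close> and \<open>b\<close> are what the whole element
    becomes there.\<close>
  define a b where "a = (\<mu> + c) \<odot> \<one> \<oplus> comb xs" and "b = \<mu> \<odot> \<one> \<oplus> comb xs"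
  have "diag_part xs = xs"
    using xs(2) by (intro filter_True) auto
  then have dxs: "comb xs \<in> diag"
    using comb_diag_part[OF xs(1)] by simp
  have diags: "?Q \<in> diag" "?p \<in> diag" "?q \<in> diag" "a \<in> diag" "b \<in> diag"
    using s dxs corner_diag[OF 2(4,5)]
    by (auto simp: a_def b_def intro!: diag.intros diag_minus diag_one)
  note carr = diags[THEN diag_closed]
  have pp: "?p \<otimes> ?p = ?p"
    using s by (simp add: e_mult)
  have pq: "?p \<otimes> ?q = \<zero>"
    using carr(2) pp by (simp add: minus_eq r_distr r_minus r_neg)
  have x: "a \<otimes> corner (X \<inter> pr s) ys = a \<otimes> ?Q \<otimes> ?p"
    using corner_Int[OF 2(4,5) s] carr by (simp add: m_assoc)
  have "?q \<otimes> ?Q = ?Q \<otimes> ?q"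
    by (rule diag_commute) (fact diags)+
  then have y: "b \<otimes> corner X (s # ys) = b \<otimes> ?Q \<otimes> ?q"
    using carr by (simp add: m_assoc)
  have split: "(\<mu> \<odot> \<one> \<oplus> comb ((c, s, t) # xs)) \<otimes> ?Q = a \<otimes> ?Q \<otimes> ?p \<oplus> b \<otimes> ?Q \<otimes> ?q"
  proof -
    have "a = b \<oplus> c \<odot> \<one>"
      using diag_closed[OF dxs] by (simp add: a_def b_def smult_add_left a_ac)
    then have "a \<otimes> ?Q \<otimes> ?p \<oplus> b \<otimes> ?Q \<otimes> ?q = b \<otimes> ?Q \<oplus> c \<odot> (?Q \<otimes> ?p)"
    proof -
      assume a: "a = b \<oplus> c \<odot> \<one>"
      have "a \<otimes> ?Q \<otimes> ?p = b \<otimes> ?Q \<otimes> ?p \<oplus> c \<odot> (?Q \<otimes> ?p)"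
        unfolding a using carr by (simp add: l_distr smult_mult_left)
      moreover have "b \<otimes> ?Q \<otimes> ?p \<oplus> c \<odot> (?Q \<otimes> ?p) \<oplus> b \<otimes> ?Q \<otimes> ?q
          = b \<otimes> ?Q \<otimes> \<one> \<oplus> c \<odot> (?Q \<otimes> ?p)"
        using carr(1,2,5) smult_closed[of "?Q \<otimes> ?p" c] by algebra
      ultimately show ?thesis
        using carr by simp
    qed
    moreover have "?Q \<otimes> ?p = ?p \<otimes> ?Q"
      by (rule diag_commute) (fact diags)+
    moreover have "(\<mu> \<odot> \<one> \<oplus> comb ((c, s, t) # xs)) = b \<oplus> c \<odot> ?p"
      using s st diag_closed[OF dxs] by (simp add: b_def e_pr a_ac)
    ultimately show ?thesis
      using carr by (simp add: l_distr smult_mult_left)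
  qed
  have "(a \<otimes> ?Q \<otimes> ?p)\<^sup>\<star> \<otimes> (b \<otimes> ?Q \<otimes> ?q) = (a \<otimes> ?Q)\<^sup>\<star> \<otimes> (b \<otimes> ?Q) \<otimes> (?p \<otimes> ?q)"
  proof -
    have D: "(a \<otimes> ?Q)\<^sup>\<star> \<in> diag" "b \<otimes> ?Q \<in> diag"
      using diags by (auto intro: diag_adj diag.mult)
    have "(a \<otimes> ?Q \<otimes> ?p)\<^sup>\<star> = (a \<otimes> ?Q)\<^sup>\<star> \<otimes> ?p"
      using s carr D(1) diag_commute[OF D(1) diags(2)] by (simp add: adj_mult[of _ ?p])
    moreover have "?p \<otimes> (b \<otimes> ?Q) = (b \<otimes> ?Q) \<otimes> ?p"
      using diag_commute[OF diags(2) D(2)] .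
    ultimately show ?thesis
      using D[THEN diag_closed] carr by (metis m_assoc m_closed)
  qed
  also have "\<dots> = \<zero>"
    using pq carr by (simp add: adj_closed)
  finally have orth1: "(a \<otimes> ?Q \<otimes> ?p)\<^sup>\<star> \<otimes> (b \<otimes> ?Q \<otimes> ?q) = \<zero>" .
  have "(b \<otimes> ?Q \<otimes> ?q)\<^sup>\<star> = ?q \<otimes> (b \<otimes> ?Q)\<^sup>\<star>"
    using s carr by (simp add: adj_mult[of _ ?q] adj_minus)
  then have "(a \<otimes> ?Q \<otimes> ?p) \<otimes> (b \<otimes> ?Q \<otimes> ?q)\<^sup>\<star> = a \<otimes> ?Q \<otimes> (?p \<otimes> ?q) \<otimes> (b \<otimes> ?Q)\<^sup>\<star>"
    using carr adj_closed[of "b \<otimes> ?Q"] by (simp only: m_assoc m_closed)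
  also have "\<dots> = \<zero>"
    using pq carr by (simp add: adj_closed)
  finally have orth2: "(a \<otimes> ?Q \<otimes> ?p) \<otimes> (b \<otimes> ?Q \<otimes> ?q)\<^sup>\<star> = \<zero>" .
  have "M < max (cnorm A (a \<otimes> ?Q \<otimes> ?p)) (cnorm A (b \<otimes> ?Q \<otimes> ?q))"
    using norm_add_orthogonal[OF _ _ orth1 orth2] 2(7) carr unfolding split by simp
  then consider "M < cnorm A (a \<otimes> corner (X \<inter> pr s) ys)" | "M < cnorm A (b \<otimes> corner X (s # ys))"
    unfolding x y by linarith
  then show ?case
  proof cases
    case 1
    then obtain r where r: "r \<in> carrier S" "r \<in> X \<inter> pr s" "\<forall>s\<in>set ys. r \<notin> pr s"
      "M < cmod (\<mu> + c + diag_value xs r)"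
      using "2.IH"[OF xs, of "X \<inter> pr s" ys "\<mu> + c"] 2(4,5,6) s unfolding a_def by auto
    then show ?thesis
      using st by (intro bexI[of _ r]) (auto simp: add.assoc)
  next
    case 2
    then obtain r where "r \<in> carrier S" "r \<in> X" "\<forall>s'\<in>set (s # ys). r \<notin> pr s'"
      "M < cmod (\<mu> + diag_value xs r)"
      using "2.IH"[OF xs, of X "s # ys" \<mu>] \<open>X \<in> ideals\<close> \<open>set ys \<subseteq> carrier S\<close> \<open>0 \<le> M\<close> s
      unfolding b_def by auto
    then show ?thesis
      using st by (intro bexI[of _ r]) auto
  qed
qed

lemma diag_value_filter: "diag_value (diag_part xs) r = diag_value xs r"
  by (induction xs rule: comb.induct) auto

text \<open>The splitting starts from the full corner with the scalar 0. A strict bound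
  \<open>M\<close> stands in for the norm itself, so no maximum over corners has to be
  named.\<close>

lemma norm_diag_less:
  assumes "xs \<in> terms" "0 \<le> M" "M < cnorm A (comb (diag_part xs))"
  obtains r where "r \<in> carrier S" "M < cmod (diag_value xs r)"
proof -
  have xs: "diag_part xs \<in> terms"
    using assms(1) by auto
  then have "(0 \<odot> \<one> \<oplus> comb (diag_part xs)) \<otimes> corner (carrier S) [] = comb (diag_part xs)"
    by (simp add: e_whole)
  then have "\<exists>r\<in>carrier S. M < cmod (0 + diag_value (diag_part xs) r)"
    using corner_norm_less[OF xs, of "carrier S" "[]" M 0] assms(2,3)
    by (auto simp: constructible_ideals.whole)
  then show thesis
    using that by (auto simp: diag_value_filter)
qed

end

section \<open>Compression by generating isometries\<close>

text \<open>The last two assumptions isolate the combinatorics of \<open>S\<close>: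
  \<open>avoid\<close> handles the diagonal terms, \<open>separate\<close> the others. The
  assumption \<open>no_negative\<close> settles the sign of the scalar and also excludes the zero
  algebra, in which the unit equals every multiple of itself.\<close>

locale right_lcm_cstar_expectation = right_lcm_cstar A S v e
  for A :: "('a, 'm) cstar_algebra_scheme" (structure) and S :: "('s, 'k) monoid_scheme" and v e +
  fixes \<Phi> :: "'a \<Rightarrow> 'a"
  assumes generated: "cstar_generated A (v ` carrier S \<union> e ` ideals) = carrier A"
    and no_negative: "\<And>x \<mu>. \<lbrakk>x \<in> carrier A; 0 < \<mu>\<rbrakk> \<Longrightarrow> x\<^sup>\<star> \<otimes> x \<noteq> (- complex_of_real \<mu>) \<odot> \<one>"
    and expectation: "conditional_expectation A (diagonal_subalgebra S A e) \<Phi>"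
    and expectation_monomial: "\<And>s t. \<lbrakk>s \<in> carrier S; t \<in> carrier S\<rbrakk>
      \<Longrightarrow> \<Phi> (v s \<otimes> (v t)\<^sup>\<star>) = (if s = t then v s \<otimes> (v s)\<^sup>\<star> else \<zero>)"
    and faithful: "faithful_on_positive A \<Phi>"
    and avoid: "\<And>t F. \<lbrakk>t \<in> carrier S; finite F; F \<subseteq> carrier S; \<forall>s\<in>F. t \<notin> pr s\<rbrakk>
      \<Longrightarrow> \<exists>x\<in>carrier S. \<forall>s\<in>F. pr (t \<cdot> x) \<inter> pr s = {}"
    and separate: "\<And>s s' t. \<lbrakk>s \<in> carrier S; s' \<in> carrier S; s \<noteq> s'; t \<in> carrier S\<rbrakk>
      \<Longrightarrow> \<exists>x\<in>carrier S. pr (t \<cdot> x) \<inter> pr s = {} \<or> pr (t \<cdot> x) \<inter> pr s' = {} \<or>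
        (\<exists>a\<in>carrier S. \<exists>a'\<in>carrier S. t \<cdot> x = s \<cdot> a \<and> t \<cdot> x = s' \<cdot> a' \<and> pr a \<inter> pr a' = {})"
begin

definition compress :: "'s \<Rightarrow> 'a \<Rightarrow> 'a" where
  "compress t x = (v t)\<^sup>\<star> \<otimes> x \<otimes> v t"

lemma compress_closed [simp]: "\<lbrakk>t \<in> carrier S; x \<in> carrier A\<rbrakk> \<Longrightarrow> compress t x \<in> carrier A"
  by (simp add: compress_def)

text \<open>Allows \<open>t\<close> to be refined in stages: a compression that has become zero or a
  scalar multiple of the unit stays so under further compression.\<close>

lemma compress_mult:
  "\<lbrakk>t \<in> carrier S; a \<in> carrier S; x \<in> carrier A\<rbrakk> \<Longrightarrow> compress (t \<cdot> a) x = compress a (compress t x)"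
  by (simp add: compress_def adj_mult m_assoc flip: v_mult)

lemma compress_zero: "t \<in> carrier S \<Longrightarrow> compress t \<zero> = \<zero>"
  by (simp add: compress_def)

lemma compress_add: "\<lbrakk>t \<in> carrier S; x \<in> carrier A; y \<in> carrier A\<rbrakk>
  \<Longrightarrow> compress t (x \<oplus> y) = compress t x \<oplus> compress t y"
  by (simp add: compress_def l_distr r_distr)

lemma compress_smult: "\<lbrakk>t \<in> carrier S; x \<in> carrier A\<rbrakk> \<Longrightarrow> compress t (c \<odot> x) = c \<odot> compress t x"
  by (simp add: compress_def smult_mult_left smult_mult_right)

lemma compress_minus: "\<lbrakk>t \<in> carrier S; x \<in> carrier A; y \<in> carrier A\<rbrakk>
  \<Longrightarrow> compress t (x \<ominus> y) = compress t x \<ominus> compress t y"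
  using compress_add[of t x "(- 1) \<odot> y"] compress_smult[of t y "- 1"]
  by (simp add: minus_eq smult_uminus_left)

lemma norm_compress_le:
  assumes "t \<in> carrier S" "x \<in> carrier A"
  shows "cnorm A (compress t x) \<le> cnorm A x"
proof -
  have "cnorm A (v t) \<le> 1"
    by (rule norm_isometry_le_1[OF v_isometry[OF assms(1)]])
  then have "cnorm A ((v t)\<^sup>\<star>) * cnorm A x * cnorm A (v t) \<le> 1 * cnorm A x * 1"
    using assms by (intro mult_mono) (auto simp: norm_nonneg)
  moreover have "cnorm A (compress t x) \<le> cnorm A ((v t)\<^sup>\<star>) * cnorm A x * cnorm A (v t)"
    unfolding compress_def using assms norm_mult[of "(v t)\<^sup>\<star> \<otimes> x" "v t"] norm_mult[of "(v t)\<^sup>\<star>" x]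
      mult_right_mono[OF norm_mult[of "(v t)\<^sup>\<star>" x] norm_nonneg[of "v t"]] by simp
  ultimately show ?thesis
    by simp
qed

lemma compress_diag_mem:
  assumes "s \<in> carrier S" "t \<in> carrier S" "t \<in> pr s"
  shows "compress t (v s \<otimes> (v s)\<^sup>\<star>) = \<one>"
proof -
  obtain a where a: "a \<in> carrier S" "t = s \<cdot> a"
    using assms(3) by (auto simp: mem_pideal)
  have "compress s (v s \<otimes> (v s)\<^sup>\<star>) = \<one>"
    using assms(1) by (simp add: compress_def m_assoc v_adj_v v_adj_v_cancel)
  then have "compress t (v s \<otimes> (v s)\<^sup>\<star>) = compress a \<one>"
    using assms(1) a by (simp add: compress_mult)
  then show ?thesis
    using a(1) by (simp add: compress_def v_adj_v)
qed

lemma compress_left_disjoint: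
  assumes "s \<in> carrier S" "s' \<in> carrier S" "t \<in> carrier S" "pr t \<inter> pr s = {}"
  shows "compress t (v s \<otimes> (v s')\<^sup>\<star>) = \<zero>"
  using assms v_adj_mult_disjoint[OF assms(3,1,4)] by (simp add: compress_def flip: m_assoc)

lemma compress_right_disjoint:
  assumes "s \<in> carrier S" "s' \<in> carrier S" "t \<in> carrier S" "pr t \<inter> pr s' = {}"
  shows "compress t (v s \<otimes> (v s')\<^sup>\<star>) = \<zero>"
  using assms v_adj_mult_disjoint[OF assms(2,3)] by (simp add: compress_def m_assoc Int_commute)

text \<open>In the first two alternatives of \<open>separate\<close> one of the outer factors
  vanishes. In the third both outer factors simplify and leave
  \<open>(v a)\<^sup>\<star> v a'\<close>, which is zero for disjoint ideals.\<close>

lemma compress_off_diag: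
  assumes "s \<in> carrier S" "s' \<in> carrier S" "s \<noteq> s'" "t \<in> carrier S"
  obtains x where "x \<in> carrier S" "compress (t \<cdot> x) (v s \<otimes> (v s')\<^sup>\<star>) = \<zero>"
proof -
  obtain x where x: "x \<in> carrier S" and
    "pr (t \<cdot> x) \<inter> pr s = {} \<or> pr (t \<cdot> x) \<inter> pr s' = {} \<or>
      (\<exists>a\<in>carrier S. \<exists>a'\<in>carrier S. t \<cdot> x = s \<cdot> a \<and> t \<cdot> x = s' \<cdot> a' \<and> pr a \<inter> pr a' = {})"
    using separate[OF assms] by blast
  then consider "pr (t \<cdot> x) \<inter> pr s = {}" | "pr (t \<cdot> x) \<inter> pr s' = {}" |
    a a' where "a \<in> carrier S" "a' \<in> carrier S" "t \<cdot> x = s \<cdot> a" "t \<cdot> x = s' \<cdot> a'" "pr a \<inter> pr a' = {}"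
    by blast
  then show thesis
  proof cases
    case 1
    then show thesis
      using that[OF x] compress_left_disjoint[of s s'] assms x by simp
  next
    case 2
    then show thesis
      using that[OF x] compress_right_disjoint[of s s'] assms x by simp
  next
    case 3
    let ?t = "t \<cdot> x"
    have t: "?t \<in> carrier S"
      using assms x by simp
    have "compress ?t (v s \<otimes> (v s')\<^sup>\<star>) = ((v s)\<^sup>\<star> \<otimes> v ?t)\<^sup>\<star> \<otimes> ((v s')\<^sup>\<star> \<otimes> v ?t)"
      using assms t by (simp add: compress_def adj_mult adj_adj m_assoc)
    also have "(v s)\<^sup>\<star> \<otimes> v ?t = v a"
      unfolding 3(3) by (rule v_adj_mult_mem[OF assms(1) 3(1)])
    also have "(v s')\<^sup>\<star> \<otimes> v ?t = v a'"
      unfolding 3(4) by (rule v_adj_mult_mem[OF assms(2) 3(2)])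
    also have "(v a)\<^sup>\<star> \<otimes> v a' = \<zero>"
      by (rule v_adj_mult_disjoint[OF 3(1,2,5)])
    finally show thesis
      using that[OF x] by simp
  qed
qed

lemma compress_all_off_diag:
  assumes "xs \<in> terms" "t \<in> carrier S"
  obtains x where "x \<in> carrier S"
    "\<forall>(c, s, s')\<in>set xs. s \<noteq> s' \<longrightarrow> compress (t \<cdot> x) (v s \<otimes> (v s')\<^sup>\<star>) = \<zero>"
  using assms
proof (induction xs arbitrary: thesis rule: comb.induct)
  case 1
  then show ?case
    using S.one_closed by auto
next
  case (2 c s s' xs)
  then have s: "s \<in> carrier S" "s' \<in> carrier S" and "xs \<in> terms"
    by auto
  then obtain x where x: "x \<in> carrier S"
    "\<forall>(c, s, s')\<in>set xs. s \<noteq> s' \<longrightarrow> compress (t \<cdot> x) (v s \<otimes> (v s')\<^sup>\<star>) = \<zero>"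
    using 2(1,4) by blast
  have "\<exists>y\<in>carrier S. s \<noteq> s' \<longrightarrow> compress (t \<cdot> x \<cdot> y) (v s \<otimes> (v s')\<^sup>\<star>) = \<zero>"
    using compress_off_diag[OF s, of "t \<cdot> x"] 2(4) x(1) by (metis S.m_closed)
  then obtain y where y: "y \<in> carrier S"
    "s \<noteq> s' \<longrightarrow> compress (t \<cdot> x \<cdot> y) (v s \<otimes> (v s')\<^sup>\<star>) = \<zero>"
    by blast
  have "compress (t \<cdot> x \<cdot> y) (v p \<otimes> (v p')\<^sup>\<star>) = \<zero>"
    if "(d, p, p') \<in> set xs" "p \<noteq> p'" for d p p'
  proof -
    have "p \<in> carrier S" "p' \<in> carrier S"
      using \<open>xs \<in> terms\<close> that by auto
    then show ?thesis
      using x y 2(4) that by (force simp: compress_mult compress_zero)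
  qed
  then show ?case
    using 2(2)[of "x \<cdot> y"] x(1) y 2(4) by (auto simp: S.m_assoc)
qed

text \<open>Right multiples of \<open>r\<close> stay in every ideal that contains \<open>r\<close>,
  so the corresponding diagonal terms compress to their coefficients. A first multiplier
  \<open>x\<close> makes the other diagonal terms vanish, a second one \<open>y\<close> the
  off-diagonal terms, without disturbing the effect of \<open>x\<close>.\<close>

lemma compress_comb:
  assumes "xs \<in> terms" "r \<in> carrier S"
  obtains t where "t \<in> carrier S" "compress t (comb xs) = diag_value xs r \<odot> \<one>"
proof -
  \<comment> \<open>These are the generators of the diagonal terms that must disappear because
    \<open>r\<close> lies outside their ideals.\<close>
  define F where "F = {s. \<exists>c. (c, s, s) \<in> set xs \<and> r \<notin> pr s}"
  have F_eq: "F = (\<lambda>(c, s, t). s) ` {(c, s, t) \<in> set xs. s = t \<and> r \<notin> pr s}"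
    unfolding F_def by force
  have "finite F"
    unfolding F_eq by (intro finite_imageI finite_subset[OF _ finite_set[of xs]]) auto
  moreover have "F \<subseteq> carrier S" "\<forall>s\<in>F. r \<notin> pr s"
    using assms(1) by (auto simp: F_def)
  ultimately obtain x where x: "x \<in> carrier S" "\<forall>s\<in>F. pr (r \<cdot> x) \<inter> pr s = {}"
    using avoid[OF assms(2)] by blast
  obtain y where y: "y \<in> carrier S"
    "\<forall>(c, s, s')\<in>set xs. s \<noteq> s' \<longrightarrow> compress (r \<cdot> x \<cdot> y) (v s \<otimes> (v s')\<^sup>\<star>) = \<zero>"
    using compress_all_off_diag[OF assms(1), of "r \<cdot> x"] assms(2) x(1) by blast
  define t where "t = r \<cdot> x \<cdot> y"
  have t: "t \<in> carrier S"
    using assms(2) x(1) y(1) by (simp add: t_def)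
  have sub: "pr t \<subseteq> pr (r \<cdot> x)" "pr t \<subseteq> pr r"
    using S.principal_mult_subset assms(2) x(1) y(1) unfolding t_def
    by (meson S.m_closed subset_trans)+
  have monomial: "compress t (v s \<otimes> (v s')\<^sup>\<star>) = (if s = s' \<and> r \<in> pr s then \<one> else \<zero>)"
    if "(c, s, s') \<in> set xs" for c s s'
  proof -
    have s: "s \<in> carrier S" "s' \<in> carrier S"
      using assms(1) that by auto
    consider "s \<noteq> s'" | "s = s'" "r \<in> pr s" | "s = s'" "r \<notin> pr s"
      by blast
    then show ?thesis
    proof cases
      case 1
      then show ?thesis
        using y(2) that by (auto simp: t_def)
    next
      case 2
      then have "t \<in> pr s"
        using S.principal_mono[OF s(1), of r] sub(2) S.self_mem_pideal[OF t] by blast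
      then show ?thesis
        using 2 compress_diag_mem[OF s(1) t] by simp
    next
      case 3
      then have "pr t \<inter> pr s = {}"
        using that x(2) sub(1) unfolding F_def by blast
      then show ?thesis
        using 3 compress_left_disjoint[OF s(1) s(2) t] by simp
    qed
  qed
  \<comment> \<open>The element \<open>t\<close> was chosen for all of \<open>xs\<close>, so the
    induction has to run over lists \<open>ys\<close> with terms from \<open>xs\<close> while
    \<open>t\<close> stays fixed.\<close>
  have "compress t (comb ys) = diag_value ys r \<odot> \<one>" if "set ys \<subseteq> set xs" for ys
    using that
  proof (induction ys rule: comb.induct)
    case (2 c s s' ys)
    then have "s \<in> carrier S" "s' \<in> carrier S" "ys \<in> terms"
      using assms(1) by auto
    then show ?case
      using 2 t monomial[of c s s'] by (auto simp: compress_add compress_smult smult_add_left)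
  qed (simp add: compress_zero t)
  then show thesis
    using that[OF t] by blast
qed

lemma expectation_zero: "\<Phi> \<zero> = \<zero>"
  and expectation_closed: "x \<in> carrier A \<Longrightarrow> \<Phi> x \<in> carrier A"
  and expectation_add: "\<lbrakk>x \<in> carrier A; y \<in> carrier A\<rbrakk> \<Longrightarrow> \<Phi> (x \<oplus> y) = \<Phi> x \<oplus> \<Phi> y"
  and expectation_smult: "x \<in> carrier A \<Longrightarrow> \<Phi> (c \<odot> x) = c \<odot> \<Phi> x"
  and norm_expectation_le: "x \<in> carrier A \<Longrightarrow> cnorm A (\<Phi> x) \<le> cnorm A x"
proof -
  show closed: "\<Phi> x \<in> carrier A" if "x \<in> carrier A" for x
    using expectation that unfolding conditional_expectation_def cstar_subalgebra_def by blast
  show smult: "\<Phi> (c \<odot> x) = c \<odot> \<Phi> x" if "x \<in> carrier A" for x c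
    using expectation that unfolding conditional_expectation_def by blast
  show "\<Phi> (x \<oplus> y) = \<Phi> x \<oplus> \<Phi> y" if "x \<in> carrier A" "y \<in> carrier A" for x y
    using expectation that unfolding conditional_expectation_def by blast
  show "cnorm A (\<Phi> x) \<le> cnorm A x" if "x \<in> carrier A" for x
    using expectation that unfolding conditional_expectation_def by blast
  show "\<Phi> \<zero> = \<zero>"
    using smult[of \<zero> 0] closed[of \<zero>] by simp
qed

lemma expectation_minus: "\<lbrakk>x \<in> carrier A; y \<in> carrier A\<rbrakk> \<Longrightarrow> \<Phi> (x \<ominus> y) = \<Phi> x \<ominus> \<Phi> y"
  using expectation_add[of x "(- 1) \<odot> y"] expectation_smult[of y "- 1"] expectation_closed[of y]
  by (simp add: minus_eq smult_uminus_left)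

lemma expectation_comb: "xs \<in> terms \<Longrightarrow> \<Phi> (comb xs) = comb (diag_part xs)"
proof (induction xs rule: comb.induct)
  case (2 c s t xs)
  then have "s \<in> carrier S" "t \<in> carrier S" "xs \<in> terms" "diag_part xs \<in> terms"
    by auto
  then show ?case
    using 2 by (simp add: expectation_add expectation_smult expectation_monomial)
qed (simp add: expectation_zero)

lemma one_neq_zero: "\<one> \<noteq> \<zero>"
  using no_negative[of \<zero> 1] by auto

lemma norm_one: "cnorm A \<one> = 1"
proof -
  have "cnorm A \<one> = (cnorm A \<one>)\<^sup>2"
    using cstar_identity[of \<one>] by simp
  then show ?thesis
    using one_neq_zero norm_eq_0[of \<one>] by (simp add: power2_eq_square)
qed

text \<open>Since \<open>d\<close> is self-adjoint, \<open>d - Re \<kappa>\<close> is the mean of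
  \<open>d - \<kappa>\<close> and its adjoint, which have equal norm. Comparing
  \<open>\<kappa>\<close> and \<open>Re \<kappa>\<close> through \<open>d\<close> bounds the
  imaginary part by twice the error.\<close>

lemma near_scalar_real_part:
  assumes "d \<in> carrier A" "d\<^sup>\<star> = d" "cnorm A (d \<ominus> \<kappa> \<odot> \<one>) < \<epsilon>"
  shows "cnorm A (d \<ominus> of_real (Re \<kappa>) \<odot> \<one>) < \<epsilon>" "cmod \<kappa> < \<bar>Re \<kappa>\<bar> + 2 * \<epsilon>"
proof -
  let ?x = "d \<ominus> \<kappa> \<odot> \<one>"
  have x: "?x \<in> carrier A" "?x\<^sup>\<star> = d \<ominus> cnj \<kappa> \<odot> \<one>"
    using assms(1,2) by (simp_all add: adj_minus adj_smult)
  have "complex_of_real (Re \<kappa>) = (1/2) * \<kappa> + (1/2) * cnj \<kappa>"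
    by (simp add: complex_eq_iff)
  then have "of_real (Re \<kappa>) \<odot> \<one> = (1/2) \<odot> (\<kappa> \<odot> \<one>) \<oplus> (1/2) \<odot> (cnj \<kappa> \<odot> \<one>)"
    by (simp add: smult_add_left smult_smult)
  moreover have "d = (1/2) \<odot> d \<oplus> (1/2) \<odot> d"
    using assms(1) by (simp add: smult_half_double)
  moreover have "((1/2) \<odot> d \<oplus> (1/2) \<odot> d) \<ominus> ((1/2) \<odot> (\<kappa> \<odot> \<one>) \<oplus> (1/2) \<odot> (cnj \<kappa> \<odot> \<one>))
      = ((1/2) \<odot> d \<ominus> (1/2) \<odot> (\<kappa> \<odot> \<one>)) \<oplus> ((1/2) \<odot> d \<ominus> (1/2) \<odot> (cnj \<kappa> \<odot> \<one>))"
    using smult_closed[OF assms(1)] smult_closed[OF smult_closed[OF one_closed]] by algebra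
  ultimately have eq: "d \<ominus> of_real (Re \<kappa>) \<odot> \<one> = (1/2) \<odot> ?x \<oplus> (1/2) \<odot> ?x\<^sup>\<star>"
    using assms(1) unfolding x(2) by (simp add: smult_minus_right)
  have "cnorm A (d \<ominus> of_real (Re \<kappa>) \<odot> \<one>) \<le> cnorm A ?x"
    unfolding eq using norm_add[of "(1/2) \<odot> ?x" "(1/2) \<odot> ?x\<^sup>\<star>"] norm_smult[of ?x "1/2"]
      norm_smult[of "?x\<^sup>\<star>" "1/2"] norm_adj[OF x(1)] x(1) adj_closed[OF x(1)] by simp
  then show re: "cnorm A (d \<ominus> of_real (Re \<kappa>) \<odot> \<one>) < \<epsilon>"
    using assms(3) by simp
  have "cmod (\<kappa> - complex_of_real (Re \<kappa>)) = cnorm A (\<kappa> \<odot> \<one> \<ominus> of_real (Re \<kappa>) \<odot> \<one>)"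
    using norm_smult[OF one_closed, of "\<kappa> - complex_of_real (Re \<kappa>)"]
    by (simp add: norm_one smult_minus_left)
  also have "\<dots> \<le> cnorm A ?x + cnorm A (d \<ominus> of_real (Re \<kappa>) \<odot> \<one>)"
    using norm_minus_triangle[of "\<kappa> \<odot> \<one>" d "of_real (Re \<kappa>) \<odot> \<one>"]
      norm_minus_commute[of d "\<kappa> \<odot> \<one>"] assms(1) by simp
  finally have "cmod (\<kappa> - complex_of_real (Re \<kappa>)) < 2 * \<epsilon>"
    using re assms(3) by simp
  then show "cmod \<kappa> < \<bar>Re \<kappa>\<bar> + 2 * \<epsilon>"
    using norm_triangle_sub[of \<kappa> "complex_of_real (Re \<kappa>)"] by simp
qed

lemma exists_compression_isometry:
  assumes x: "x \<in> carrier A" "x \<noteq> \<zero>"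
  obtains y where "y \<in> carrier A" "isometry A (x \<otimes> y)"
proof -
  define a where "a = x\<^sup>\<star> \<otimes> x"
  have a: "a \<in> carrier A" "a\<^sup>\<star> = a" "a \<noteq> \<zero>"
    using x adj_mult_self_eq_0[of x] by (auto simp: a_def adj_closed adj_mult adj_adj)
  have "cstar_positive A a"
    using x(1) by (auto simp: cstar_positive_def a_def)
  then have "\<Phi> a \<noteq> \<zero>"
    using faithful a(3) by (auto simp: faithful_on_positive_def)
  define N where "N = cnorm A (\<Phi> a)"
  have N: "0 < N"
    using \<open>\<Phi> a \<noteq> \<zero>\<close> a(1) norm_nonneg norm_eq_0 expectation_closed unfolding N_def
    by (metis less_eq_real_def)
  \<comment> \<open>The error \<open>N / 8\<close> leaves norm above \<open>7 * N / 8\<close> for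
    the diagonal part of \<open>b\<close>, and then more than \<open>5 * N / 8\<close> for the real
    part of the scalar after losing twice the error. The relative error 1/5 is within the 1/2 that
    the square root tolerates.\<close>
  obtain b where b: "b \<in> vspan" "cnorm A (a \<ominus> b) < N / 8"
    using vspan_dense[OF generated a(1), of "N / 8"] N by auto
  then obtain xs where xs: "xs \<in> terms" "b = comb xs"
    using vspan_comb by blast
  have bc: "b \<in> carrier A"
    using xs by simp
  have "N \<le> cnorm A (\<Phi> a \<ominus> \<Phi> b) + cnorm A (\<Phi> b)"
    unfolding N_def using a(1) bc by (intro norm_le_norm_minus_add expectation_closed)
  moreover have "cnorm A (\<Phi> a \<ominus> \<Phi> b) \<le> cnorm A (a \<ominus> b)"
    using norm_expectation_le[of "a \<ominus> b"] a(1) bc by (simp add: expectation_minus)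
  ultimately have "7 * N / 8 < cnorm A (comb (diag_part xs))"
    using b(2) xs expectation_comb by simp
  then obtain r where r: "r \<in> carrier S" "7 * N / 8 < cmod (diag_value xs r)"
    using norm_diag_less[OF xs(1), of "7 * N / 8"] N by auto
  define \<kappa> where "\<kappa> = diag_value xs r"
  obtain t where t: "t \<in> carrier S" "compress t b = \<kappa> \<odot> \<one>"
    using compress_comb[OF xs(1) r(1)] unfolding xs(2) \<kappa>_def by blast
  define d where "d = compress t a"
  have d: "d \<in> carrier A" "d\<^sup>\<star> = d"
    using t(1) a by (simp_all add: d_def compress_def adj_mult adj_adj m_assoc)
  have "cnorm A (d \<ominus> \<kappa> \<odot> \<one>) \<le> cnorm A (a \<ominus> b)"
    using norm_compress_le[of t "a \<ominus> b"] t a(1) bc by (simp add: d_def compress_minus)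
  then have "cnorm A (d \<ominus> \<kappa> \<odot> \<one>) < N / 8"
    using b(2) by simp
  note near = near_scalar_real_part[OF d this]
  define \<rho> where "\<rho> = Re \<kappa>"
  have \<rho>: "cnorm A (d \<ominus> of_real \<rho> \<odot> \<one>) < N / 8" "5 * N / 8 < \<bar>\<rho>\<bar>"
    using near r(2) by (simp_all add: \<rho>_def \<kappa>_def)
  have "\<rho> \<noteq> 0"
    using \<rho>(2) N by auto
  \<comment> \<open>Written this way \<open>d = \<rho> (1 - u)\<close> with \<open>u\<close> small,
    whatever the sign of \<open>\<rho>\<close>, so \<open>d / \<rho>\<close> has an invertible
    self-adjoint square root.\<close>
  define u where "u = \<one> \<ominus> of_real (1 / \<rho>) \<odot> d"
  have u: "u \<in> carrier A" "u\<^sup>\<star> = u"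
    using d by (simp_all add: u_def adj_minus adj_smult)
  have u_eq: "u = of_real (- 1 / \<rho>) \<odot> (d \<ominus> of_real \<rho> \<odot> \<one>)"
  proof -
    have "of_real (- 1 / \<rho>) \<odot> (d \<ominus> of_real \<rho> \<odot> \<one>)
        = \<ominus> (of_real (1 / \<rho>) \<odot> d) \<ominus> \<ominus> \<one>"
      using d(1) \<open>\<rho> \<noteq> 0\<close> by (simp add: smult_minus_right smult_smult smult_uminus_left)
    then show ?thesis
      using d(1) by (simp add: u_def minus_eq a_comm)
  qed
  have "cnorm A u = cnorm A (d \<ominus> of_real \<rho> \<odot> \<one>) / \<bar>\<rho>\<bar>"
    unfolding u_eq using norm_smult[of "d \<ominus> of_real \<rho> \<odot> \<one>" "complex_of_real (- 1 / \<rho>)"] d(1)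
    by (simp add: norm_divide)
  also have "\<dots> \<le> 1/2"
    using \<rho> \<open>\<rho> \<noteq> 0\<close> by (simp add: pos_divide_le_eq)
  finally obtain s c where s: "s \<in> carrier A" "s\<^sup>\<star> = s" "s \<otimes> s = \<one> \<ominus> u"
    and c: "c \<in> carrier A" "c\<^sup>\<star> = c" "s \<otimes> c = \<one>" "c \<otimes> s = \<one>"
    using sqrt_one_minus[OF u] by blast
  have "\<one> \<ominus> u = of_real (1 / \<rho>) \<odot> d"
    unfolding u_def using smult_closed[OF d(1)] by algebra
  then have d_eq: "d = of_real \<rho> \<odot> (s \<otimes> s)"
    using s(3) d(1) \<open>\<rho> \<noteq> 0\<close> by (simp add: smult_smult)
  \<comment> \<open>Dividing by the square root from both sides turns \<open>d\<close> into
    \<open>\<rho>\<close> exactly. This makes \<open>w\<^sup>\<star> w\<close> a scalar, to which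
    \<open>no_negative\<close> applies.\<close>
  define w where "w = x \<otimes> (v t \<otimes> c)"
  have w: "w \<in> carrier A"
    using x(1) t(1) c(1) by (simp add: w_def)
  have "w\<^sup>\<star> \<otimes> w = c \<otimes> d \<otimes> c"
    using x(1) t(1) c(1,2) by (simp add: w_def d_def compress_def a_def adj_mult adj_adj adj_closed m_assoc)
  also have "\<dots> = of_real \<rho> \<odot> ((c \<otimes> s) \<otimes> (s \<otimes> c))"
    using s(1) c(1) by (simp add: d_eq smult_mult_left smult_mult_right m_assoc)
  finally have ww: "w\<^sup>\<star> \<otimes> w = of_real \<rho> \<odot> \<one>"
    by (simp add: c(3,4))
  have "0 < \<rho>"
    using no_negative[OF w, of "- \<rho>"] ww \<open>\<rho> \<noteq> 0\<close> by fastforce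
  define y where "y = of_real (1 / sqrt \<rho>) \<odot> (v t \<otimes> c)"
  have y: "y \<in> carrier A" "x \<otimes> y = of_real (1 / sqrt \<rho>) \<odot> w"
    using x(1) t(1) c(1) by (simp_all add: y_def w_def smult_mult_right)
  have "complex_of_real (1 / sqrt \<rho>) * complex_of_real (1 / sqrt \<rho>) * complex_of_real \<rho> = 1"
    using \<open>0 < \<rho>\<close> by (simp flip: of_real_mult)
  then have "isometry A (x \<otimes> y)"
    using w ww unfolding isometry_def y(2)
    by (simp add: adj_smult adj_closed smult_mult_left smult_mult_right smult_smult)
  then show thesis
    using that y(1) by blast
qed

text \<open>The generator \<open>v s\<close> is a non-unitary isometry: by \<open>avoid\<close> some
  ideal \<open>tS\<close> is disjoint from \<open>sS\<close>, and if \<open>v s\<close> were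
  unitary, \<open>v t\<close> would vanish.\<close>

lemma purely_infinite_simple:
  assumes "s \<in> carrier S" "\<one>\<^bsub>S\<^esub> \<notin> pr s"
  shows "purely_infinite A \<and> simple_cstar A"
proof (rule purely_infinite_simpleI)
  show "\<exists>y\<in>carrier A. isometry A (x \<otimes> y)" if "x \<in> carrier A" "x \<noteq> \<zero>" for x
    using exists_compression_isometry[OF that] by blast
  obtain t where t: "t \<in> carrier S" "pr t \<inter> pr s = {}"
    using avoid[OF S.one_closed, of "{s}"] assms by auto
  show "isometry A (v s)"
    by (rule v_isometry[OF assms(1)])
  show "v s \<otimes> (v s)\<^sup>\<star> \<noteq> \<one>"
  proof
    assume "v s \<otimes> (v s)\<^sup>\<star> = \<one>"
    then have "v t = v s \<otimes> ((v s)\<^sup>\<star> \<otimes> v t)"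
      using assms(1) t(1) by (simp flip: m_assoc)
    also have "\<dots> = \<zero>"
      using v_adj_mult_disjoint[of s t] assms(1) t by (simp add: Int_commute)
    finally show False
      using v_adj_v[OF t(1)] one_neq_zero t(1) by simp
  qed
qed (rule one_neq_zero)

end

section \<open>Square-summable functions\<close>

typedef 's ell2 = "{f :: 's \<Rightarrow> complex. (\<lambda>i. (cmod (f i))\<^sup>2) summable_on UNIV}"
  morphisms ell2_fun Abs_ell2
  by (rule exI[of _ "\<lambda>_. 0"]) simp

lemma ell2_summable: "(\<lambda>i. (cmod (ell2_fun f i))\<^sup>2) summable_on UNIV"
  using ell2_fun by simp

lemma ell2_fun_Abs:
  "(\<lambda>i. (cmod (f i))\<^sup>2) summable_on UNIV \<Longrightarrow> ell2_fun (Abs_ell2 f) = f"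
  by (rule Abs_ell2_inverse) simp

lemma ell2_eqI: "(\<And>i. ell2_fun f i = ell2_fun g i) \<Longrightarrow> f = g"
  by (simp add: ell2_fun_inject[symmetric] fun_eq_iff)

lemma ell2_summable_add:
  fixes f g :: "'s \<Rightarrow> complex"
  assumes "(\<lambda>i. (cmod (f i))\<^sup>2) summable_on UNIV" "(\<lambda>i. (cmod (g i))\<^sup>2) summable_on UNIV"
  shows "(\<lambda>i. (cmod (f i + g i))\<^sup>2) summable_on UNIV"
proof (rule summable_on_comparison_test)
  show "(\<lambda>i. 2 * (cmod (f i))\<^sup>2 + 2 * (cmod (g i))\<^sup>2) summable_on UNIV"
    by (intro summable_on_add summable_on_cmult_right assms)
  fix i
  have "(cmod (f i + g i))\<^sup>2 \<le> (cmod (f i) + cmod (g i))\<^sup>2"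
    by (simp add: norm_triangle_ineq power_mono)
  also have "\<dots> \<le> 2 * (cmod (f i))\<^sup>2 + 2 * (cmod (g i))\<^sup>2"
    using sum_squares_bound[of "cmod (f i)" "cmod (g i)"] by (simp add: power2_sum)
  finally show "(cmod (f i + g i))\<^sup>2 \<le> 2 * (cmod (f i))\<^sup>2 + 2 * (cmod (g i))\<^sup>2" .
qed simp

lemma ell2_summable_mult:
  fixes f :: "'s \<Rightarrow> complex"
  assumes "(\<lambda>i. (cmod (f i))\<^sup>2) summable_on UNIV"
  shows "(\<lambda>i. (cmod (c * f i))\<^sup>2) summable_on UNIV"
  using summable_on_cmult_right[OF assms, of "(cmod c)\<^sup>2"]
  by (simp add: norm_mult power_mult_distrib)

lemma ell2_summable_inner:
  fixes f g :: "'s \<Rightarrow> complex"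
  assumes "(\<lambda>i. (cmod (f i))\<^sup>2) summable_on UNIV" "(\<lambda>i. (cmod (g i))\<^sup>2) summable_on UNIV"
  shows "(\<lambda>i. f i \<bullet> g i) summable_on UNIV"
proof (rule abs_summable_summable, rule summable_on_comparison_test)
  show "(\<lambda>i. (cmod (f i))\<^sup>2 + (cmod (g i))\<^sup>2) summable_on UNIV"
    by (intro summable_on_add assms)
  fix i
  have "\<bar>f i \<bullet> g i\<bar> \<le> cmod (f i) * cmod (g i)"
    by (rule Cauchy_Schwarz_ineq2)
  also have "\<dots> \<le> (cmod (f i))\<^sup>2 + (cmod (g i))\<^sup>2"
    using sum_squares_bound[of "cmod (f i)" "cmod (g i)"]
      mult_nonneg_nonneg[OF norm_ge_zero[of "f i"] norm_ge_zero[of "g i"]] by linarith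
  finally show "norm (f i \<bullet> g i) \<le> (cmod (f i))\<^sup>2 + (cmod (g i))\<^sup>2"
    by simp
qed simp

text \<open>The inner product is the real part of the Hermitian one, so this is the underlying real
  Hilbert space; complex scalars return through \<open>mult_i\<close>.\<close>

instantiation ell2 :: (type) real_inner
begin

definition "0 = Abs_ell2 (\<lambda>_. 0)"
definition "f + g = Abs_ell2 (\<lambda>i. ell2_fun f i + ell2_fun g i)"
definition "- f = Abs_ell2 (\<lambda>i. - ell2_fun f i)"
definition "f - g = Abs_ell2 (\<lambda>i. ell2_fun f i - ell2_fun g i)"
definition "r *\<^sub>R f = Abs_ell2 (\<lambda>i. r *\<^sub>R ell2_fun f i)"
definition "f \<bullet> g = infsum (\<lambda>i. ell2_fun f i \<bullet> ell2_fun g i) UNIV"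
definition "norm (f :: 'a ell2) = sqrt (f \<bullet> f)"
definition "dist f g = norm (f - g :: 'a ell2)"
definition "sgn f = inverse (norm f) *\<^sub>R (f :: 'a ell2)"
definition [code del]:
  "uniformity = (INF e\<in>{0 <..}. principal {(x :: 'a ell2, y). dist x y < e})"
definition [code del]:
  "open U \<longleftrightarrow> (\<forall>x\<in>U. eventually (\<lambda>(x', y :: 'a ell2). x' = x \<longrightarrow> y \<in> U) uniformity)"

lemma ell2_fun_zero: "ell2_fun 0 i = 0"
  by (simp add: zero_ell2_def ell2_fun_Abs)

lemma ell2_fun_add: "ell2_fun (f + g) i = ell2_fun f i + ell2_fun g i"
  by (simp add: plus_ell2_def ell2_fun_Abs ell2_summable_add ell2_summable)

lemma ell2_fun_uminus: "ell2_fun (- f) i = - ell2_fun f i"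
  by (simp add: uminus_ell2_def ell2_fun_Abs ell2_summable)

lemma ell2_fun_minus: "ell2_fun (f - g) i = ell2_fun f i - ell2_fun g i"
  using ell2_summable_add[OF ell2_summable[of f] ell2_summable[of "- g"]]
  by (simp add: minus_ell2_def ell2_fun_Abs ell2_fun_uminus)

lemma ell2_fun_scaleR: "ell2_fun (r *\<^sub>R f) i = r *\<^sub>R ell2_fun f i"
  using ell2_summable_mult[OF ell2_summable[of f], of "complex_of_real r"]
  by (simp add: scaleR_ell2_def ell2_fun_Abs scaleR_conv_of_real)

lemmas ell2_fun_simps =
  ell2_fun_zero ell2_fun_add ell2_fun_uminus ell2_fun_minus ell2_fun_scaleR

instance
proof
  fix x y z :: "'a ell2" and a b r :: real
  show "a *\<^sub>R (x + y) = a *\<^sub>R x + a *\<^sub>R y" "(a + b) *\<^sub>R x = a *\<^sub>R x + b *\<^sub>R x"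
    "a *\<^sub>R b *\<^sub>R x = (a * b) *\<^sub>R x" "1 *\<^sub>R x = x"
    "x + y + z = x + (y + z)" "x + y = y + x" "0 + x = x" "- x + x = 0" "x - y = x + - y"
    by (auto intro!: ell2_eqI simp: ell2_fun_simps scaleR_add_left scaleR_add_right)
  have sum: "(\<lambda>i. ell2_fun f i \<bullet> ell2_fun g i) summable_on UNIV" for f g :: "'a ell2"
    by (intro ell2_summable_inner ell2_summable)
  show "x \<bullet> y = y \<bullet> x"
    by (simp add: inner_ell2_def inner_commute)
  show "(x + y) \<bullet> z = x \<bullet> z + y \<bullet> z"
    by (simp add: inner_ell2_def ell2_fun_simps inner_add_left infsum_add sum)
  show "(r *\<^sub>R x) \<bullet> y = r * (x \<bullet> y)"
    by (simp add: inner_ell2_def ell2_fun_simps infsum_cmult_right sum)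
  show "0 \<le> x \<bullet> x"
    by (simp add: inner_ell2_def infsum_nonneg)
  show "x \<bullet> x = 0 \<longleftrightarrow> x = 0"
  proof
    assume "x \<bullet> x = 0"
    then have "ell2_fun x i \<bullet> ell2_fun x i = 0" for i
      using nonneg_infsum_le_0D[of "\<lambda>i. ell2_fun x i \<bullet> ell2_fun x i" UNIV i] sum[of x x]
      by (simp add: inner_ell2_def)
    then show "x = 0"
      by (intro ell2_eqI) (simp add: ell2_fun_simps)
  qed (simp add: inner_ell2_def ell2_fun_simps)
qed (simp_all add: norm_ell2_def dist_ell2_def sgn_ell2_def uniformity_ell2_def open_ell2_def)

end

lemma norm_ell2_power2: "(norm f)\<^sup>2 = infsum (\<lambda>i. (cmod (ell2_fun f i))\<^sup>2) UNIV"
  by (simp only: power2_norm_eq_inner inner_ell2_def)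

lemma ell2_sum_le: "finite F \<Longrightarrow> (\<Sum>i\<in>F. (cmod (ell2_fun f i))\<^sup>2) \<le> (norm f)\<^sup>2"
  unfolding norm_ell2_power2 by (rule finite_sum_le_infsum) (auto simp: ell2_summable)

text \<open>A bound on finite partial sums gives membership and norm at once, so operators and
  limits may be defined pointwise.\<close>

lemma ell2_bounded:
  fixes h :: "'s \<Rightarrow> complex"
  assumes "\<And>F. finite F \<Longrightarrow> (\<Sum>i\<in>F. (cmod (h i))\<^sup>2) \<le> r\<^sup>2" "0 \<le> r"
  shows "ell2_fun (Abs_ell2 h) = h" "norm (Abs_ell2 h) \<le> r"
proof -
  have sum: "(\<lambda>i. (cmod (h i))\<^sup>2) summable_on UNIV"
    by (rule nonneg_bdd_above_summable_on) (auto intro!: bdd_aboveI2 assms)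
  show *: "ell2_fun (Abs_ell2 h) = h"
    by (rule ell2_fun_Abs[OF sum])
  have "(norm (Abs_ell2 h))\<^sup>2 \<le> r\<^sup>2"
    unfolding norm_ell2_power2 * using sum assms(1) by (rule infsum_le_finite_sums) auto
  then show "norm (Abs_ell2 h) \<le> r"
    using assms(2) by (rule power2_le_imp_le)
qed

lemma cmod_ell2_fun_le: "cmod (ell2_fun f i) \<le> norm f"
  using ell2_sum_le[of "{i}" f] by (simp add: power2_le_iff_abs_le)

instance ell2 :: (type) banach
proof
  fix X :: "nat \<Rightarrow> 'a ell2"
  assume X: "Cauchy X"
  have "Cauchy (\<lambda>n. ell2_fun (X n) i)" for i
    using X unfolding Cauchy_def
    by (metis cmod_ell2_fun_le dist_norm ell2_fun_minus order_le_less_trans)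
  then have "\<forall>i. \<exists>l. (\<lambda>n. ell2_fun (X n) i) \<longlonglongrightarrow> l"
    by (simp add: Cauchy_convergent_iff convergent_def)
  then obtain l where l: "\<And>i. (\<lambda>n. ell2_fun (X n) i) \<longlonglongrightarrow> l i"
    by metis
  \<comment> \<open>The pointwise limit \<open>l\<close> is not yet known to be square-summable.
    Only the differences from \<open>X n\<close> are controlled, for large \<open>n\<close>, and the
    limit is recovered from one of them as \<open>X N - D N\<close>.\<close>
  define D where "D n = Abs_ell2 (\<lambda>i. ell2_fun (X n) i - l i)" for n
  have ev: "\<exists>N. \<forall>n\<ge>N. ell2_fun (D n) = (\<lambda>i. ell2_fun (X n) i - l i) \<and> norm (D n) \<le> e"
    if "0 < e" for e
  proof -
    obtain N where N: "\<And>m n. \<lbrakk>m \<ge> N; n \<ge> N\<rbrakk> \<Longrightarrow> norm (X m - X n) < e"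
      using X \<open>0 < e\<close> unfolding Cauchy_def dist_norm by meson
    have "(\<Sum>i\<in>F. (cmod (ell2_fun (X n) i - l i))\<^sup>2) \<le> e\<^sup>2" if "n \<ge> N" "finite F" for n F
    proof (rule LIMSEQ_le_const2)
      show "(\<lambda>m. \<Sum>i\<in>F. (cmod (ell2_fun (X n) i - ell2_fun (X m) i))\<^sup>2)
          \<longlonglongrightarrow> (\<Sum>i\<in>F. (cmod (ell2_fun (X n) i - l i))\<^sup>2)"
        by (intro tendsto_intros l)
      have "(\<Sum>i\<in>F. (cmod (ell2_fun (X n) i - ell2_fun (X m) i))\<^sup>2) \<le> e\<^sup>2" if "m \<ge> N" for m
      proof -
        have "(\<Sum>i\<in>F. (cmod (ell2_fun (X n) i - ell2_fun (X m) i))\<^sup>2) \<le> (norm (X n - X m))\<^sup>2"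
          using ell2_sum_le[OF \<open>finite F\<close>, of "X n - X m"] by (simp add: ell2_fun_simps)
        also have "\<dots> \<le> e\<^sup>2"
          using N[OF \<open>n \<ge> N\<close> that] by (intro power_mono) auto
        finally show ?thesis .
      qed
      then show "\<exists>N. \<forall>m\<ge>N. (\<Sum>i\<in>F. (cmod (ell2_fun (X n) i - ell2_fun (X m) i))\<^sup>2) \<le> e\<^sup>2"
        by blast
    qed
    then show ?thesis
      unfolding D_def using ell2_bounded[of "\<lambda>i. ell2_fun (X _) i - l i" e] \<open>0 < e\<close>
      by (meson less_imp_le)
  qed
  obtain N where N: "ell2_fun (D N) = (\<lambda>i. ell2_fun (X N) i - l i)"
    using ev[of 1] by auto
  have "X n - (X N - D N) = D n" if "ell2_fun (D n) = (\<lambda>i. ell2_fun (X n) i - l i)" for n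
    by (rule ell2_eqI) (simp add: ell2_fun_simps that N)
  then have "\<exists>N'. \<forall>n\<ge>N'. norm (X n - (X N - D N)) < e" if "0 < e" for e
    using ev[of "e / 2"] that by force
  then have "X \<longlonglongrightarrow> X N - D N"
    by (simp add: LIMSEQ_iff)
  then show "convergent X"
    by (auto simp: convergent_def)
qed

text \<open>Partial injections are encoded by mutually inverse partial functions, and act by pullback.\<close>

definition partial_inverse :: "('s \<Rightarrow> 's option) \<Rightarrow> ('s \<Rightarrow> 's option) \<Rightarrow> bool" where
  "partial_inverse \<pi> \<sigma> \<longleftrightarrow> (\<forall>x y. \<pi> y = Some x \<longleftrightarrow> \<sigma> x = Some y)"

definition pullback_fun :: "('s \<Rightarrow> 's option) \<Rightarrow> ('s \<Rightarrow> complex) \<Rightarrow> 's \<Rightarrow> complex" where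
  "pullback_fun \<pi> f y = (case \<pi> y of None \<Rightarrow> 0 | Some x \<Rightarrow> f x)"

text \<open>Boundedness is established only for \<open>\<pi>\<close> with a partial inverse, which
  is why the lemmas about this operator ask for one.\<close>

definition pullback :: "('s \<Rightarrow> 's option) \<Rightarrow> 's ell2 \<Rightarrow>\<^sub>L 's ell2" where
  "pullback \<pi> = Blinfun (\<lambda>f. Abs_ell2 (pullback_fun \<pi> (ell2_fun f)))"

lemma partial_inverse_sym: "partial_inverse \<pi> \<sigma> \<Longrightarrow> partial_inverse \<sigma> \<pi>"
  by (simp add: partial_inverse_def)

lemma partial_inverseD: "partial_inverse \<pi> \<sigma> \<Longrightarrow> \<pi> y = Some x \<Longrightarrow> \<sigma> x = Some y"
  by (simp add: partial_inverse_def)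

lemma pullback_fun_bound:
  assumes "partial_inverse \<pi> \<sigma>" "finite F"
  shows "(\<Sum>y\<in>F. (cmod (pullback_fun \<pi> (ell2_fun f) y))\<^sup>2) \<le> (norm f)\<^sup>2"
proof -
  let ?F = "{y \<in> F. \<pi> y \<noteq> None}"
  have "(\<Sum>y\<in>F. (cmod (pullback_fun \<pi> (ell2_fun f) y))\<^sup>2)
      = (\<Sum>y\<in>?F. (cmod (ell2_fun f (the (\<pi> y))))\<^sup>2)"
    using assms(2) by (intro sum.mono_neutral_cong_right) (auto simp: pullback_fun_def)
  also have "\<dots> = (\<Sum>x\<in>(\<lambda>y. the (\<pi> y)) ` ?F. (cmod (ell2_fun f x))\<^sup>2)"
  proof (subst sum.reindex)
    show "inj_on (\<lambda>y. the (\<pi> y)) ?F"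
    proof (rule inj_onI)
      fix y z assume "y \<in> ?F" "z \<in> ?F" "the (\<pi> y) = the (\<pi> z)"
      then obtain x where "\<pi> y = Some x" "\<pi> z = Some x"
        by force
      then show "y = z"
        using partial_inverseD[OF assms(1)] by (metis option.inject)
    qed
  qed simp
  also have "\<dots> \<le> (norm f)\<^sup>2"
    using assms(2) by (intro ell2_sum_le) auto
  finally show ?thesis .
qed

lemma pullback_apply:
  assumes "partial_inverse \<pi> \<sigma>"
  shows "ell2_fun (pullback \<pi> f) = pullback_fun \<pi> (ell2_fun f)"
proof -
  have *: "ell2_fun (Abs_ell2 (pullback_fun \<pi> (ell2_fun f))) = pullback_fun \<pi> (ell2_fun f)"
    "norm (Abs_ell2 (pullback_fun \<pi> (ell2_fun f))) \<le> norm f" for f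
    using ell2_bounded[OF pullback_fun_bound[OF assms, of _ f]] by auto
  have "bounded_linear (\<lambda>f. Abs_ell2 (pullback_fun \<pi> (ell2_fun f)))"
    by (rule bounded_linear_intro[where K=1])
      (auto intro!: ell2_eqI simp: * ell2_fun_simps pullback_fun_def split: option.split)
  then show ?thesis
    by (simp add: pullback_def bounded_linear_Blinfun_apply *)
qed

lemma pullback_adjoint:
  assumes "partial_inverse \<pi> \<sigma>"
  shows "pullback \<pi> f \<bullet> g = f \<bullet> pullback \<sigma> g"
proof -
  have bij: "bij_betw (\<lambda>y. the (\<pi> y)) {y. \<pi> y \<noteq> None} {x. \<sigma> x \<noteq> None}"
  proof (rule bij_betwI[of _ _ _ "\<lambda>x. the (\<sigma> x)"])
    note to = partial_inverseD[OF assms] and fro = partial_inverseD[OF partial_inverse_sym[OF assms]]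
    show "(\<lambda>y. the (\<pi> y)) \<in> {y. \<pi> y \<noteq> None} \<rightarrow> {x. \<sigma> x \<noteq> None}"
      using to by fastforce
    show "(\<lambda>x. the (\<sigma> x)) \<in> {x. \<sigma> x \<noteq> None} \<rightarrow> {y. \<pi> y \<noteq> None}"
      using fro by fastforce
    show "the (\<sigma> (the (\<pi> y))) = y" if "y \<in> {y. \<pi> y \<noteq> None}" for y
      using to that by force
    show "the (\<pi> (the (\<sigma> x))) = x" if "x \<in> {x. \<sigma> x \<noteq> None}" for x
      using fro that by force
  qed
  have "pullback \<pi> f \<bullet> g
      = infsum (\<lambda>y. ell2_fun f (the (\<pi> y)) \<bullet> ell2_fun g y) {y. \<pi> y \<noteq> None}"
    unfolding inner_ell2_def pullback_apply[OF assms]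
    by (rule infsum_cong_neutral) (auto simp: pullback_fun_def)
  also have "\<dots> = infsum (\<lambda>y. ell2_fun f (the (\<pi> y)) \<bullet> ell2_fun g (the (\<sigma> (the (\<pi> y))))) {y. \<pi> y \<noteq> None}"
    by (rule infsum_cong) (use partial_inverseD[OF assms] in force)
  also have "\<dots> = infsum (\<lambda>x. ell2_fun f x \<bullet> ell2_fun g (the (\<sigma> x))) {x. \<sigma> x \<noteq> None}"
    by (rule infsum_reindex_bij_betw[OF bij])
  also have "\<dots> = f \<bullet> pullback \<sigma> g"
    unfolding inner_ell2_def pullback_apply[OF partial_inverse_sym[OF assms]]
    by (rule infsum_cong_neutral) (auto simp: pullback_fun_def)
  finally show ?thesis .
qed

lemma pullback_compose:
  assumes "partial_inverse \<pi> \<pi>'" "partial_inverse \<sigma> \<sigma>'" "partial_inverse \<rho> \<rho>'"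
    and "\<And>y. Option.bind (\<pi> y) \<sigma> = \<rho> y"
  shows "pullback \<pi> o\<^sub>L pullback \<sigma> = pullback \<rho>"
proof (rule blinfun_eqI, rule ell2_eqI)
  fix f i
  show "ell2_fun ((pullback \<pi> o\<^sub>L pullback \<sigma>) f) i = ell2_fun (pullback \<rho> f) i"
    unfolding blinfun_apply_blinfun_compose pullback_apply[OF assms(1)] pullback_apply[OF assms(2)]
      pullback_apply[OF assms(3)]
    by (auto simp: pullback_fun_def assms(4)[symmetric] split: option.split)
qed

text \<open>The complex structure: among the real-linear operators, the complex-linear ones are
  those that commute with it.\<close>

definition mult_i :: "'s ell2 \<Rightarrow>\<^sub>L 's ell2" where
  "mult_i = Blinfun (\<lambda>f. Abs_ell2 (\<lambda>i. \<i> * ell2_fun f i))"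

lemma mult_i_apply: "ell2_fun (mult_i f) = (\<lambda>i. \<i> * ell2_fun f i)"
proof -
  have *: "ell2_fun (Abs_ell2 (\<lambda>i. \<i> * ell2_fun f i)) = (\<lambda>i. \<i> * ell2_fun f i)"
    "norm (Abs_ell2 (\<lambda>i. \<i> * ell2_fun f i)) \<le> norm f" for f :: "'a ell2"
    using ell2_bounded[of "\<lambda>i. \<i> * ell2_fun f i" "norm f"] ell2_sum_le[of _ f]
    by (auto simp: norm_mult)
  have "bounded_linear (\<lambda>f :: 'a ell2. Abs_ell2 (\<lambda>i. \<i> * ell2_fun f i))"
  proof (rule bounded_linear_intro[where K=1])
    fix f g :: "'a ell2" and r :: real
    show "Abs_ell2 (\<lambda>i. \<i> * ell2_fun (f + g) i)
        = Abs_ell2 (\<lambda>i. \<i> * ell2_fun f i) + Abs_ell2 (\<lambda>i. \<i> * ell2_fun g i)"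
      by (rule ell2_eqI) (simp only: *, simp only: * ell2_fun_simps distrib_left)
    show "Abs_ell2 (\<lambda>i. \<i> * ell2_fun (r *\<^sub>R f) i) = r *\<^sub>R Abs_ell2 (\<lambda>i. \<i> * ell2_fun f i)"
      by (rule ell2_eqI) (simp only: *, simp only: * ell2_fun_simps mult_scaleR_right)
  qed (simp add: *)
  then show ?thesis
    by (simp add: mult_i_def bounded_linear_Blinfun_apply *)
qed

section \<open>Adjointable operators\<close>

text \<open>Adjoints are exhibited as explicit partners, so having one becomes a property of an
  operator and duality of Hilbert spaces is not invoked.\<close>

definition adjoint_pair :: "('h::real_inner \<Rightarrow>\<^sub>L 'h) \<Rightarrow> ('h \<Rightarrow>\<^sub>L 'h) \<Rightarrow> bool" where
  "adjoint_pair T T' \<longleftrightarrow> (\<forall>x y. T x \<bullet> y = x \<bullet> T' y)"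

lemma adjoint_pair_sym: "adjoint_pair T T' \<Longrightarrow> adjoint_pair T' T"
  by (simp add: adjoint_pair_def) (metis inner_commute)

lemma adjoint_pair_unique:
  assumes "adjoint_pair T T1" "adjoint_pair T T2"
  shows "T1 = T2"
proof (rule blinfun_eqI)
  fix y
  have "x \<bullet> (T1 y - T2 y) = 0" for x
    using assms unfolding adjoint_pair_def by (metis inner_diff_right right_minus_eq)
  then show "T1 y = T2 y"
    by (metis inner_eq_zero_iff right_minus_eq)
qed

lemma adjoint_pair_zero: "adjoint_pair 0 0"
  by (simp add: adjoint_pair_def)

lemma adjoint_pair_add:
  "\<lbrakk>adjoint_pair T T'; adjoint_pair U U'\<rbrakk> \<Longrightarrow> adjoint_pair (T + U) (T' + U')"
  by (simp add: adjoint_pair_def blinfun.add_left inner_add_left inner_add_right)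

lemma adjoint_pair_uminus: "adjoint_pair T T' \<Longrightarrow> adjoint_pair (- T) (- T')"
  by (simp add: adjoint_pair_def blinfun.minus_left)

lemma adjoint_pair_scaleR: "adjoint_pair T T' \<Longrightarrow> adjoint_pair (r *\<^sub>R T) (r *\<^sub>R T')"
  by (simp add: adjoint_pair_def blinfun.scaleR_left)

lemma adjoint_pair_compose:
  "\<lbrakk>adjoint_pair T T'; adjoint_pair U U'\<rbrakk> \<Longrightarrow> adjoint_pair (T o\<^sub>L U) (U' o\<^sub>L T')"
  by (simp add: adjoint_pair_def)

lemma adjoint_pair_norm_le:
  assumes "adjoint_pair T T'"
  shows "norm T' \<le> norm T"
proof (rule norm_blinfun_bound)
  fix y
  have "norm (T' y) * norm (T' y) = T (T' y) \<bullet> y"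
    using assms by (simp add: adjoint_pair_def power2_norm_eq_inner flip: power2_eq_square)
  also have "\<dots> \<le> norm (T (T' y)) * norm y"
    by (rule norm_cauchy_schwarz)
  also have "\<dots> \<le> norm T * norm (T' y) * norm y"
    by (intro mult_right_mono norm_blinfun) simp
  finally have "norm (T' y) * norm (T' y) \<le> norm (T' y) * (norm T * norm y)"
    by (simp add: mult_ac)
  then show "norm (T' y) \<le> norm T * norm y"
    by (cases "T' y = 0") (auto simp: mult_le_cancel_left)
qed simp

lemma adjoint_pair_norm_compose:
  assumes "adjoint_pair T T'"
  shows "norm (T' o\<^sub>L T) = (norm T)\<^sup>2"
proof (rule antisym)
  have "norm (T' o\<^sub>L T) \<le> norm T' * norm T"
    by (rule norm_blinfun_compose)
  also have "\<dots> \<le> norm T * norm T"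
    by (intro mult_right_mono adjoint_pair_norm_le assms) simp
  finally show "norm (T' o\<^sub>L T) \<le> (norm T)\<^sup>2"
    by (simp add: power2_eq_square)
  have "norm T \<le> sqrt (norm (T' o\<^sub>L T))"
  proof (rule norm_blinfun_bound)
    fix x
    have "(norm (T x))\<^sup>2 = x \<bullet> (T' o\<^sub>L T) x"
      using assms by (simp add: adjoint_pair_def power2_norm_eq_inner)
    also have "\<dots> \<le> norm x * norm ((T' o\<^sub>L T) x)"
      by (rule norm_cauchy_schwarz)
    also have "\<dots> \<le> norm x * (norm (T' o\<^sub>L T) * norm x)"
      by (intro mult_left_mono norm_blinfun) simp
    finally have "(norm (T x))\<^sup>2 \<le> (sqrt (norm (T' o\<^sub>L T)) * norm x)\<^sup>2"
      by (simp add: power_mult_distrib power2_eq_square mult_ac)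
    then show "norm (T x) \<le> sqrt (norm (T' o\<^sub>L T)) * norm x"
      by (rule power2_le_imp_le) simp
  qed simp
  then show "(norm T)\<^sup>2 \<le> norm (T' o\<^sub>L T)"
    by (metis norm_ge_zero real_sqrt_le_iff real_sqrt_unique sqrt_le_D)
qed

text \<open>A complex Hilbert space is given as a real one with a complex structure \<open>J\<close>; the algebra
  consists of the adjointable operators of the corner cut out by the projection \<open>P\<close>, which is its
  unit. The injection \<open>enc\<close> only serves to move the carrier to another type.\<close>

locale hilbert_corner =
  fixes J P :: "'h::{real_inner, banach} \<Rightarrow>\<^sub>L 'h" and enc :: "('h \<Rightarrow>\<^sub>L 'h) \<Rightarrow> 'b"
  assumes inj_enc: "inj enc"
    and J_square: "J o\<^sub>L J = - id_blinfun"
    and J_adjoint: "adjoint_pair J (- J)"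
    and P_square: "P o\<^sub>L P = P"
    and P_adjoint: "adjoint_pair P P"
    and P_J: "P o\<^sub>L J = J o\<^sub>L P"
begin

definition ops :: "('h \<Rightarrow>\<^sub>L 'h) set" where
  "ops = {T. (\<exists>T'. adjoint_pair T T') \<and> T o\<^sub>L J = J o\<^sub>L T \<and> P o\<^sub>L T = T \<and> T o\<^sub>L P = T}"

definition adjoint :: "('h \<Rightarrow>\<^sub>L 'h) \<Rightarrow> ('h \<Rightarrow>\<^sub>L 'h)" where
  "adjoint T = (THE T'. adjoint_pair T T')"

definition scale :: "complex \<Rightarrow> ('h \<Rightarrow>\<^sub>L 'h) \<Rightarrow> ('h \<Rightarrow>\<^sub>L 'h)" where
  "scale c T = Re c *\<^sub>R T + Im c *\<^sub>R (J o\<^sub>L T)"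

definition dec :: "'b \<Rightarrow> ('h \<Rightarrow>\<^sub>L 'h)" where
  "dec = the_inv enc"

definition alg :: "'b cstar_algebra" where
  "alg = \<lparr>carrier = enc ` ops, monoid.mult = (\<lambda>x y. enc (dec x o\<^sub>L dec y)), one = enc P, zero = enc 0,
    add = (\<lambda>x y. enc (dec x + dec y)), module.smult = (\<lambda>c x. enc (scale c (dec x))),
    adj = (\<lambda>x. enc (adjoint (dec x))), cnorm = (\<lambda>x. norm (dec x))\<rparr>"

lemma dec_enc [simp]: "dec (enc T) = T"
  by (simp add: dec_def the_inv_f_f inj_enc)

lemma enc_eq_iff [simp]: "enc T = enc U \<longleftrightarrow> T = U"
  using inj_enc by (auto dest: injD)

lemma adjoint_eqI: "adjoint_pair T T' \<Longrightarrow> adjoint T = T'"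
  unfolding adjoint_def by (rule the_equality) (auto intro: adjoint_pair_unique)

lemma adjoint_pair_adjoint: "T \<in> ops \<Longrightarrow> adjoint_pair T (adjoint T)"
  by (auto simp: ops_def adjoint_eqI)

lemma compose_add_left: "(T + U) o\<^sub>L V = (T o\<^sub>L V) + (U o\<^sub>L V)"
  by (rule bounded_bilinear.add_left[OF bounded_bilinear_blinfun_compose])

lemma compose_add_right: "T o\<^sub>L (U + V) = (T o\<^sub>L U) + (T o\<^sub>L V)"
  by (rule bounded_bilinear.add_right[OF bounded_bilinear_blinfun_compose])

lemma compose_scaleR_left: "(r *\<^sub>R T) o\<^sub>L V = r *\<^sub>R (T o\<^sub>L V)"
  by (rule bounded_bilinear.scaleR_left[OF bounded_bilinear_blinfun_compose])

lemma compose_scaleR_right: "T o\<^sub>L (r *\<^sub>R V) = r *\<^sub>R (T o\<^sub>L V)"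
  by (rule bounded_bilinear.scaleR_right[OF bounded_bilinear_blinfun_compose])

lemma compose_uminus_left: "(- T) o\<^sub>L V = - (T o\<^sub>L V)"
  by (rule bounded_bilinear.minus_left[OF bounded_bilinear_blinfun_compose])

lemma compose_uminus_right: "T o\<^sub>L (- V) = - (T o\<^sub>L V)"
  by (rule bounded_bilinear.minus_right[OF bounded_bilinear_blinfun_compose])

lemma compose_assoc: "(T o\<^sub>L U) o\<^sub>L V = T o\<^sub>L (U o\<^sub>L V)"
  by (rule blinfun_eqI) simp

lemma compose_zero: "T o\<^sub>L (0 :: 'h \<Rightarrow>\<^sub>L 'h) = 0" "(0 :: 'h \<Rightarrow>\<^sub>L 'h) o\<^sub>L T = 0"
  by (auto intro!: blinfun_eqI simp: blinfun.zero_right)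

lemma compose_id: "T o\<^sub>L id_blinfun = T" "id_blinfun o\<^sub>L T = T"
  by (auto intro!: blinfun_eqI)

lemmas compose_simps = compose_add_left compose_add_right compose_scaleR_left compose_scaleR_right
  compose_uminus_left compose_uminus_right compose_zero compose_id

lemma ops_zero: "0 \<in> ops"
  using adjoint_pair_zero by (auto simp: ops_def compose_simps)

lemma ops_P: "P \<in> ops"
  using P_adjoint by (auto simp: ops_def P_square P_J)

lemma ops_add: "T \<in> ops \<Longrightarrow> U \<in> ops \<Longrightarrow> T + U \<in> ops"
  using adjoint_pair_add by (fastforce simp: ops_def compose_simps)

lemma ops_uminus: "T \<in> ops \<Longrightarrow> - T \<in> ops"
  using adjoint_pair_uminus by (fastforce simp: ops_def compose_simps)

lemma ops_scaleR: "T \<in> ops \<Longrightarrow> r *\<^sub>R T \<in> ops"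
  using adjoint_pair_scaleR by (fastforce simp: ops_def compose_simps)

lemma ops_compose:
  assumes "T \<in> ops" "U \<in> ops"
  shows "T o\<^sub>L U \<in> ops"
proof -
  have eqs: "T o\<^sub>L J = J o\<^sub>L T" "U o\<^sub>L J = J o\<^sub>L U" "P o\<^sub>L T = T" "U o\<^sub>L P = U"
    using assms by (auto simp: ops_def)
  have "(T o\<^sub>L U) o\<^sub>L J = J o\<^sub>L (T o\<^sub>L U)"
    by (metis eqs(1,2) compose_assoc)
  moreover have "P o\<^sub>L (T o\<^sub>L U) = T o\<^sub>L U" "(T o\<^sub>L U) o\<^sub>L P = T o\<^sub>L U"
    by (metis eqs(3) compose_assoc, metis eqs(4) compose_assoc)
  ultimately show ?thesis
    using assms adjoint_pair_compose by (fastforce simp: ops_def)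
qed

lemma ops_J:
  assumes "T \<in> ops"
  shows "J o\<^sub>L T \<in> ops" "adjoint (J o\<^sub>L T) = - (J o\<^sub>L adjoint T)"
proof -
  have eqs: "T o\<^sub>L J = J o\<^sub>L T" "P o\<^sub>L T = T" "T o\<^sub>L P = T"
    using assms by (auto simp: ops_def)
  have "(J o\<^sub>L T) o\<^sub>L J = J o\<^sub>L (J o\<^sub>L T)"
    by (metis eqs(1) compose_assoc)
  moreover have "P o\<^sub>L (J o\<^sub>L T) = J o\<^sub>L T" "(J o\<^sub>L T) o\<^sub>L P = J o\<^sub>L T"
    by (metis eqs(2) P_J compose_assoc, metis eqs(3) compose_assoc)
  moreover have 1: "adjoint_pair (J o\<^sub>L T) (- (adjoint T o\<^sub>L J))"
    using adjoint_pair_compose[OF J_adjoint adjoint_pair_adjoint[OF assms]]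
    by (simp add: compose_simps)
  ultimately show "J o\<^sub>L T \<in> ops"
    by (auto simp: ops_def)
  have "adjoint_pair (T o\<^sub>L J) (- (J o\<^sub>L adjoint T))"
    using adjoint_pair_compose[OF adjoint_pair_adjoint[OF assms] J_adjoint]
    by (simp add: compose_simps)
  then show "adjoint (J o\<^sub>L T) = - (J o\<^sub>L adjoint T)"
    by (simp add: eqs(1) adjoint_eqI)
qed

lemma ops_scale: "T \<in> ops \<Longrightarrow> scale c T \<in> ops"
  by (simp add: scale_def ops_add ops_scaleR ops_J)

lemma ops_adjoint:
  assumes "T \<in> ops"
  shows "adjoint T \<in> ops"
proof -
  have eqs: "T o\<^sub>L J = J o\<^sub>L T" "P o\<^sub>L T = T" "T o\<^sub>L P = T"
    using assms by (auto simp: ops_def)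
  note pair = adjoint_pair_adjoint[OF assms]
  have "- (adjoint T o\<^sub>L J) = - (J o\<^sub>L adjoint T)"
    using adjoint_pair_compose[OF J_adjoint pair] adjoint_pair_compose[OF pair J_adjoint]
    by (intro adjoint_pair_unique[of "J o\<^sub>L T"]) (simp_all add: eqs(1) compose_simps)
  moreover have "adjoint T o\<^sub>L P = adjoint T" "P o\<^sub>L adjoint T = adjoint T"
    using adjoint_pair_compose[OF P_adjoint pair] adjoint_pair_compose[OF pair P_adjoint] pair
    by (simp_all add: eqs(2,3) adjoint_pair_unique)
  ultimately show ?thesis
    using adjoint_pair_sym[OF pair] by (auto simp: ops_def)
qed

lemma scale_scale: "scale a (scale b T) = scale (a * b) T"
proof -
  have JJ: "J o\<^sub>L (J o\<^sub>L T) = - T"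
    unfolding compose_assoc[symmetric] J_square by (simp add: compose_simps)
  show ?thesis
    by (simp add: scale_def compose_simps JJ algebra_simps)
qed

text \<open>The structure \<open>J\<close> is isometric and \<open>J y\<close> is orthogonal to
  \<open>y\<close>, so Pythagoras computes the norm of \<open>(Re c + Im c J) y\<close>. The reverse
  inequality follows by applying the first one to \<open>inverse c\<close>.\<close>

lemma norm_scale:
  assumes "T \<in> ops"
  shows "norm (scale c T) = cmod c * norm T"
proof -
  have le: "norm (scale c U) \<le> cmod c * norm U" for c U
  proof (rule norm_blinfun_bound)
    fix x
    have orth: "y \<bullet> J y = 0" for y
      using J_adjoint unfolding adjoint_pair_def
      by (metis add.inverse_neutral equal_neg_zero inner_commute inner_minus_right blinfun.minus_left)
    then have orth': "J y \<bullet> y = 0" for y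
      by (simp add: inner_commute)
    have isom: "J y \<bullet> J y = y \<bullet> y" for y
    proof -
      have "J y \<bullet> J y = y \<bullet> - J (J y)"
        using J_adjoint by (simp add: adjoint_pair_def blinfun.minus_left)
      also have "J (J y) = - y"
        using J_square by (metis blinfun.minus_left blinfun_apply_blinfun_compose blinfun_apply_id_blinfun)
      finally show ?thesis
        by simp
    qed
    have "(norm (scale c U x))\<^sup>2 = ((Re c)\<^sup>2 + (Im c)\<^sup>2) * (norm (U x))\<^sup>2"
      unfolding power2_norm_eq_inner
      by (simp add: scale_def blinfun.add_left blinfun.scaleR_left
          inner_add_left inner_add_right orth orth' isom power2_eq_square algebra_simps)
    then have "norm (scale c U x) = cmod c * norm (U x)"
      by (metis cmod_power2 norm_ge_zero norm_mult power2_eq_iff_nonneg power_mult_distrib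
          zero_le_mult_iff)
    also have "\<dots> \<le> cmod c * (norm U * norm x)"
      by (intro mult_left_mono norm_blinfun) simp
    finally show "norm (scale c U x) \<le> cmod c * norm U * norm x"
      by (simp add: mult_ac)
  qed simp
  show ?thesis
  proof (cases "c = 0")
    case False
    have "scale (inverse c) (scale c T) = scale (inverse c * c) T"
      by (rule scale_scale)
    then have "norm T \<le> cmod (inverse c) * norm (scale c T)"
      using le[of "inverse c" "scale c T"] False by (simp add: scale_def)
    then show ?thesis
      using le[of c T] False by (simp add: norm_divide field_simps)
  qed (simp add: scale_def)
qed

lemma ops_unit: "T \<in> ops \<Longrightarrow> P o\<^sub>L T = T" "T \<in> ops \<Longrightarrow> T o\<^sub>L P = T"
  by (auto simp: ops_def)

lemma alg_simps [simp]:
  "carrier alg = enc ` ops" "x \<otimes>\<^bsub>alg\<^esub> y = enc (dec x o\<^sub>L dec y)" "\<one>\<^bsub>alg\<^esub> = enc P"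
  "\<zero>\<^bsub>alg\<^esub> = enc 0" "x \<oplus>\<^bsub>alg\<^esub> y = enc (dec x + dec y)"
  "c \<odot>\<^bsub>alg\<^esub> x = enc (scale c (dec x))" "x\<^sup>\<star>\<^bsub>alg\<^esub> = enc (adjoint (dec x))"
  "cnorm alg x = norm (dec x)"
  by (simp_all add: alg_def)

lemma ring_alg: "ring alg"
proof (rule ringI)
  show "abelian_group alg"
    by (rule abelian_groupI)
      (auto simp: ops_add ops_zero add_ac intro!: bexI[of _ "- _"] ops_uminus)
  show "monoid alg"
    by (rule monoidI) (auto simp: ops_compose ops_P ops_unit compose_assoc)
qed (auto simp: compose_simps)

lemma alg_minus:
  assumes "x \<in> carrier alg" "y \<in> carrier alg"
  shows "x \<ominus>\<^bsub>alg\<^esub> y = enc (dec x - dec y)"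
proof -
  interpret ring alg
    by (rule ring_alg)
  have "\<ominus>\<^bsub>alg\<^esub> y = enc (- dec y)"
    using assms by (intro minus_equality) (auto simp: ops_uminus)
  then show ?thesis
    by (simp add: a_minus_def)
qed

text \<open>Taking adjoints does not increase the norm, so the adjoints of a convergent sequence are
  Cauchy, and their limit is the partner of the limit.\<close>

lemma ops_closed:
  assumes "\<And>n. T n \<in> ops" "T \<longlonglongrightarrow> L"
  shows "L \<in> ops"
proof -
  have diff: "adjoint_pair (T m - T n) (adjoint (T m) - adjoint (T n))" for m n
    using adjoint_pair_add[OF adjoint_pair_adjoint[OF assms(1)[of m]]
        adjoint_pair_uminus[OF adjoint_pair_adjoint[OF assms(1)[of n]]]]
    by simp
  have "Cauchy (\<lambda>n. adjoint (T n))"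
    using LIMSEQ_imp_Cauchy[OF assms(2)] adjoint_pair_norm_le[OF diff]
    unfolding Cauchy_def dist_norm by (meson order_le_less_trans)
  then obtain L' where L': "(\<lambda>n. adjoint (T n)) \<longlonglongrightarrow> L'"
    using Cauchy_convergent_iff convergent_def by blast
  have "L x \<bullet> y = x \<bullet> L' y" for x y
  proof (rule LIMSEQ_unique)
    show "(\<lambda>n. T n x \<bullet> y) \<longlonglongrightarrow> L x \<bullet> y"
      by (intro tendsto_intros assms)
    have "T n x \<bullet> y = x \<bullet> adjoint (T n) y" for n
      using adjoint_pair_adjoint[OF assms(1)[of n]] by (simp add: adjoint_pair_def)
    then show "(\<lambda>n. T n x \<bullet> y) \<longlonglongrightarrow> x \<bullet> L' y"
      by (simp only:) (intro tendsto_intros L')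
  qed
  then have "adjoint_pair L L'"
    by (simp add: adjoint_pair_def)
  moreover have left: "(\<lambda>n. U o\<^sub>L T n) \<longlonglongrightarrow> (U o\<^sub>L L)"
    and right: "(\<lambda>n. T n o\<^sub>L U) \<longlonglongrightarrow> (L o\<^sub>L U)" for U
    using assms(2) by (auto intro: bounded_bilinear.tendsto[OF bounded_bilinear_blinfun_compose])
  have "L o\<^sub>L J = J o\<^sub>L L"
    using assms(1) by (intro LIMSEQ_unique[OF right[of J]]) (use left[of J] in \<open>simp add: ops_def\<close>)
  moreover have "P o\<^sub>L L = L"
    by (rule LIMSEQ_unique[OF left[of P]]) (use assms in \<open>simp add: ops_unit\<close>)
  moreover have "L o\<^sub>L P = L"
    by (rule LIMSEQ_unique[OF right[of P]]) (use assms in \<open>simp add: ops_unit\<close>)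
  ultimately show ?thesis
    by (auto simp: ops_def)
qed

lemma module_alg: "module complex_ring alg"
proof (rule moduleI)
  show "cring complex_ring"
  proof (rule cringI)
    show "abelian_group complex_ring"
    proof (rule abelian_groupI)
      show "\<exists>y\<in>carrier complex_ring. y \<oplus>\<^bsub>complex_ring\<^esub> x = \<zero>\<^bsub>complex_ring\<^esub>" for x
        by (rule bexI[of _ "- x"]) (simp_all add: complex_ring_def)
    qed (simp_all add: complex_ring_def)
    show "Group.comm_monoid complex_ring"
      by (rule comm_monoidI) (simp_all add: complex_ring_def)
  qed (simp add: complex_ring_def distrib_right)
  show "abelian_group alg"
    using ring_alg by (rule ring.is_abelian_group)
  show "(a \<otimes>\<^bsub>complex_ring\<^esub> b) \<odot>\<^bsub>alg\<^esub> x = a \<odot>\<^bsub>alg\<^esub> (b \<odot>\<^bsub>alg\<^esub> x)"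
    if "x \<in> carrier alg" for a b x
    by (simp add: complex_ring_def scale_scale)
  show "a \<odot>\<^bsub>alg\<^esub> x \<in> carrier alg" if "x \<in> carrier alg" for a x
    using that by (auto simp: ops_scale)
qed (auto simp: complex_ring_def scale_def compose_simps scaleR_add_left scaleR_add_right)

lemma cstar_algebra_alg: "unital_cstar_algebra alg"
proof (rule unital_cstar_algebra.intro[OF ring_alg unital_cstar_algebra_axioms.intro])
  show "module complex_ring alg"
    by (rule module_alg)
  fix x y and c
  assume x: "x \<in> carrier alg" and y: "y \<in> carrier alg"
  from x y obtain T U where T: "x = enc T" "T \<in> ops" and U: "y = enc U" "U \<in> ops"
    by auto
  have TJ: "T o\<^sub>L J = J o\<^sub>L T"
    using T by (simp add: ops_def)
  show "(c \<odot>\<^bsub>alg\<^esub> x) \<otimes>\<^bsub>alg\<^esub> y = c \<odot>\<^bsub>alg\<^esub> (x \<otimes>\<^bsub>alg\<^esub> y)"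
    by (simp add: scale_def compose_simps compose_assoc)
  have "T o\<^sub>L (J o\<^sub>L U) = J o\<^sub>L (T o\<^sub>L U)"
    by (metis TJ compose_assoc)
  then show "x \<otimes>\<^bsub>alg\<^esub> (c \<odot>\<^bsub>alg\<^esub> y) = c \<odot>\<^bsub>alg\<^esub> (x \<otimes>\<^bsub>alg\<^esub> y)"
    by (simp add: scale_def compose_simps T U)
  note pT = adjoint_pair_adjoint[OF T(2)] and pU = adjoint_pair_adjoint[OF U(2)]
  show "(x \<oplus>\<^bsub>alg\<^esub> y)\<^sup>\<star>\<^bsub>alg\<^esub> = x\<^sup>\<star>\<^bsub>alg\<^esub> \<oplus>\<^bsub>alg\<^esub> y\<^sup>\<star>\<^bsub>alg\<^esub>"
    using T U adjoint_eqI[OF adjoint_pair_add[OF pT pU]] by simp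
  show "(x \<otimes>\<^bsub>alg\<^esub> y)\<^sup>\<star>\<^bsub>alg\<^esub> = y\<^sup>\<star>\<^bsub>alg\<^esub> \<otimes>\<^bsub>alg\<^esub> x\<^sup>\<star>\<^bsub>alg\<^esub>"
    using T U adjoint_eqI[OF adjoint_pair_compose[OF pT pU]] by simp
  show "cnorm alg (x \<oplus>\<^bsub>alg\<^esub> y) \<le> cnorm alg x + cnorm alg y"
    by (simp add: norm_triangle_ineq)
  show "cnorm alg (x \<otimes>\<^bsub>alg\<^esub> y) \<le> cnorm alg x * cnorm alg y"
    by (simp add: norm_blinfun_compose)
next
  fix x and c
  assume x: "x \<in> carrier alg"
  from x obtain T where T: "x = enc T" "T \<in> ops"
    by auto
  note pT = adjoint_pair_adjoint[OF T(2)]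
  show "x\<^sup>\<star>\<^bsub>alg\<^esub> \<in> carrier alg"
    using T by (simp add: ops_adjoint)
  show "x\<^sup>\<star>\<^bsub>alg\<^esub>\<^sup>\<star>\<^bsub>alg\<^esub> = x"
    using T adjoint_eqI[OF adjoint_pair_sym[OF pT]] by simp
  have "adjoint_pair (J o\<^sub>L T) (- (J o\<^sub>L adjoint T))"
    using adjoint_pair_adjoint[OF ops_J(1)[OF T(2)]] by (simp add: ops_J(2)[OF T(2)])
  then have "adjoint_pair (scale c T) (scale (cnj c) (adjoint T))"
    using adjoint_pair_add[OF adjoint_pair_scaleR[OF pT, of "Re c"] adjoint_pair_scaleR[of "J o\<^sub>L T" _ "Im c"]]
    by (fastforce simp: scale_def)
  then show "(c \<odot>\<^bsub>alg\<^esub> x)\<^sup>\<star>\<^bsub>alg\<^esub> = cnj c \<odot>\<^bsub>alg\<^esub> x\<^sup>\<star>\<^bsub>alg\<^esub>"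
    using T by (simp add: adjoint_eqI)
  show "0 \<le> cnorm alg x"
    by simp
  show "cnorm alg x = 0 \<longleftrightarrow> x = \<zero>\<^bsub>alg\<^esub>"
    using T by simp
  show "cnorm alg (c \<odot>\<^bsub>alg\<^esub> x) = cmod c * cnorm alg x"
    using T by (simp add: norm_scale)
  show "cnorm alg (x\<^sup>\<star>\<^bsub>alg\<^esub> \<otimes>\<^bsub>alg\<^esub> x) = (cnorm alg x)\<^sup>2"
    using T adjoint_pair_norm_compose[OF pT] by simp
next
  fix z :: "nat \<Rightarrow> 'b"
  assume z: "\<forall>n. z n \<in> carrier alg"
    and cauchy: "\<forall>\<epsilon>>0. \<exists>N. \<forall>m\<ge>N. \<forall>n\<ge>N. cnorm alg (z m \<ominus>\<^bsub>alg\<^esub> z n) < \<epsilon>"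
  have ops: "dec (z n) \<in> ops" for n
    using z by (metis alg_simps(1) dec_enc imageE)
  have "cnorm alg (z m \<ominus>\<^bsub>alg\<^esub> z n) = norm (dec (z m) - dec (z n))" for m n
    using z by (simp only: alg_minus alg_simps(8) dec_enc)
  then have "Cauchy (\<lambda>n. dec (z n))"
    using cauchy by (simp add: Cauchy_def dist_norm)
  then obtain L where L: "(\<lambda>n. dec (z n)) \<longlonglongrightarrow> L"
    using Cauchy_convergent_iff convergent_def by blast
  then have "L \<in> ops"
    by (rule ops_closed[OF ops])
  then have carr: "enc L \<in> carrier alg"
    by simp
  have "cnorm alg (z n \<ominus>\<^bsub>alg\<^esub> enc L) = norm (dec (z n) - L)" for n
    using z carr by (simp only: alg_minus alg_simps(8) dec_enc)
  then have "cstar_tendsto alg z (enc L)"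
    using L by (simp add: cstar_tendsto_def LIM_zero_iff tendsto_norm_zero_iff)
  then show "\<exists>l\<in>carrier alg. cstar_tendsto alg z l"
    using carr by blast
qed

text \<open>Pairing such an equation with a vector \<open>\<xi>\<close> gives \<open>(norm (T
  \<xi>))\<^sup>2 + \<mu> * (norm (P \<xi>))\<^sup>2 = 0\<close>, a sum of nonnegative terms; so
  \<open>P\<close> would be zero.\<close>

lemma alg_adj_mult_self_neq_negative:
  assumes "x \<in> carrier alg" "0 < \<mu>" "P \<noteq> 0"
  shows "x\<^sup>\<star>\<^bsub>alg\<^esub> \<otimes>\<^bsub>alg\<^esub> x \<noteq> (- complex_of_real \<mu>) \<odot>\<^bsub>alg\<^esub> \<one>\<^bsub>alg\<^esub>"
proof
  assume eq: "x\<^sup>\<star>\<^bsub>alg\<^esub> \<otimes>\<^bsub>alg\<^esub> x = (- complex_of_real \<mu>) \<odot>\<^bsub>alg\<^esub> \<one>\<^bsub>alg\<^esub>"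
  obtain T where T: "x = enc T" "T \<in> ops"
    using assms(1) by auto
  have "adjoint T o\<^sub>L T = (- \<mu>) *\<^sub>R P"
    using eq T by (simp add: scale_def)
  then have "P \<xi> = 0" for \<xi>
  proof -
    assume *: "adjoint T o\<^sub>L T = (- \<mu>) *\<^sub>R P"
    have "(norm (T \<xi>))\<^sup>2 = \<xi> \<bullet> (adjoint T o\<^sub>L T) \<xi>"
      using adjoint_pair_adjoint[OF T(2)] by (simp add: adjoint_pair_def power2_norm_eq_inner)
    also have "\<dots> = - \<mu> * (\<xi> \<bullet> P (P \<xi>))"
      unfolding * using P_square by (metis blinfun.scaleR_left blinfun_apply_blinfun_compose inner_scaleR_right)
    also have "\<xi> \<bullet> P (P \<xi>) = (norm (P \<xi>))\<^sup>2"
      using P_adjoint by (simp add: adjoint_pair_def power2_norm_eq_inner)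
    finally have "(norm (T \<xi>))\<^sup>2 + \<mu> * (norm (P \<xi>))\<^sup>2 = 0"
      by simp
    moreover have "0 \<le> \<mu> * (norm (P \<xi>))\<^sup>2"
      using assms(2) by simp
    ultimately show "P \<xi> = 0"
      using assms(2) by (simp add: add_nonneg_eq_0_iff)
  qed
  then have "P = 0"
    by (intro blinfun_eqI) simp
  then show False
    using assms(3) by simp
qed

end

section \<open>The left regular representation\<close>

lemma partial_inverse_compose:
  assumes "partial_inverse \<pi> \<pi>'" "partial_inverse \<sigma> \<sigma>'"
  shows "partial_inverse (\<lambda>y. Option.bind (\<pi> y) \<sigma>) (\<lambda>x. Option.bind (\<sigma>' x) \<pi>')"
  using assms by (auto simp: partial_inverse_def bind_eq_Some_conv)

lemma option_eqI: "(\<And>x. a = Some x \<longleftrightarrow> b = Some x) \<Longrightarrow> a = b"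
  by (cases a; cases b) auto

definition partial_id :: "'s set \<Rightarrow> 's \<Rightarrow> 's option" where
  "partial_id X y = (if y \<in> X then Some y else None)"

definition left_mult :: "('s, 'k) monoid_scheme \<Rightarrow> 's \<Rightarrow> 's \<Rightarrow> 's option" where
  "left_mult S p x = (if x \<in> carrier S then Some (p \<otimes>\<^bsub>S\<^esub> x) else None)"

text \<open>Pullback along this map sends the basis vector at \<open>x\<close> to the one at
  \<open>p x\<close>, so it is the isometry that represents \<open>p\<close>; pullback along
  \<open>left_mult\<close> is its adjoint. Left cancellation makes the quotient unique.\<close>

definition left_division :: "('s, 'k) monoid_scheme \<Rightarrow> 's \<Rightarrow> 's \<Rightarrow> 's option" where
  "left_division S p y =
    (if \<exists>x\<in>carrier S. y = p \<otimes>\<^bsub>S\<^esub> x then Some (THE x. x \<in> carrier S \<and> y = p \<otimes>\<^bsub>S\<^esub> x) else None)"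

lemma partial_id_eq_Some [simp]: "partial_id X y = Some x \<longleftrightarrow> x = y \<and> y \<in> X"
  by (auto simp: partial_id_def)

lemma partial_inverse_id: "partial_inverse (partial_id X) (partial_id X)"
  by (auto simp: partial_inverse_def)

lemma constructible_ideals_subset:
  assumes "monoid S" "X \<in> constructible_ideals S"
  shows "X \<subseteq> carrier S"
  using assms(2)
proof induction
  case (image p X)
  then show ?case
    using monoid.m_closed[OF assms(1)] by (auto simp: l_coset_def)
qed auto

lemma pullback_mult_i:
  assumes "partial_inverse \<pi> \<sigma>"
  shows "pullback \<pi> o\<^sub>L mult_i = mult_i o\<^sub>L pullback \<pi>"
  by (rule blinfun_eqI, rule ell2_eqI)
    (auto simp: pullback_apply[OF assms] mult_i_apply pullback_fun_def split: option.split)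

lemma adjoint_pair_pullback: "partial_inverse \<pi> \<sigma> \<Longrightarrow> adjoint_pair (pullback \<pi>) (pullback \<sigma>)"
  by (simp add: adjoint_pair_def pullback_adjoint)

text \<open>The clause wanted later is the last one; the first two make \<open>B\<close> an
  admissible target of the universal property.\<close>

lemma left_regular_representation:
  fixes S :: "('s, 'k) monoid_scheme"
  assumes "monoid S" and cancel: "left_cancellative S"
  obtains B :: "(('s \<Rightarrow> complex) \<Rightarrow> 's \<Rightarrow> complex) cstar_algebra" and w f
  where "unital_cstar_algebra B" "semigroup_cstar_relations S B w f"
    "\<And>x \<mu>. \<lbrakk>x \<in> carrier B; 0 < \<mu>\<rbrakk>
      \<Longrightarrow> x\<^sup>\<star>\<^bsub>B\<^esub> \<otimes>\<^bsub>B\<^esub> x \<noteq> (- complex_of_real \<mu>) \<odot>\<^bsub>B\<^esub> \<one>\<^bsub>B\<^esub>"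
proof -
  interpret S: monoid S
    by fact
  define J :: "'s ell2 \<Rightarrow>\<^sub>L 's ell2" where "J = mult_i"
  \<comment> \<open>The functions in \<open>ell2\<close> are indexed by the whole type, so the unit
    has to be the projection onto those supported in the carrier.\<close>
  define P :: "'s ell2 \<Rightarrow>\<^sub>L 's ell2" where "P = pullback (partial_id (carrier S))"
  \<comment> \<open>The universal property tests only against algebras on one fixed type, into which
    operators are coded as maps on raw functions. Arguments outside the square-summable functions
    give unspecified values; injectivity needs only the others.\<close>
  define enc :: "('s ell2 \<Rightarrow>\<^sub>L 's ell2) \<Rightarrow> ('s \<Rightarrow> complex) \<Rightarrow> 's \<Rightarrow> complex"
    where "enc T = (\<lambda>x. ell2_fun (T (Abs_ell2 x)))" for T
  have comp: "pullback \<pi> o\<^sub>L pullback \<sigma> = pullback (\<lambda>y. Option.bind (\<pi> y) \<sigma>)"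
    if "partial_inverse \<pi> \<pi>'" "partial_inverse \<sigma> \<sigma>'"
    for \<pi> \<sigma> \<pi>' \<sigma>' :: "'s \<Rightarrow> 's option"
    using pullback_compose[OF that partial_inverse_compose[OF that]] by simp
  interpret hilbert_corner J P enc
  proof
    show "inj enc"
    proof (rule injI, rule blinfun_eqI)
      fix T U f assume "enc T = enc U"
      then show "T f = U f"
        unfolding enc_def by (metis ell2_fun_inject ell2_fun_inverse)
    qed
    show "J o\<^sub>L J = - id_blinfun"
      by (rule blinfun_eqI, rule ell2_eqI)
        (simp add: J_def mult_i_apply blinfun.minus_left ell2_fun_simps)
    have "(\<i> * z) \<bullet> z' = z \<bullet> (- (\<i> * z'))" for z z'
      by (simp add: inner_complex_def)
    then show "adjoint_pair J (- J)"
      by (simp add: adjoint_pair_def J_def inner_ell2_def mult_i_apply blinfun.minus_left ell2_fun_simps)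
    show "P o\<^sub>L P = P"
      unfolding P_def using partial_inverse_id
      by (intro pullback_compose) (auto simp: partial_id_def)
    show "adjoint_pair P P"
      unfolding P_def by (rule adjoint_pair_pullback[OF partial_inverse_id])
    show "P o\<^sub>L J = J o\<^sub>L P"
      unfolding P_def J_def by (rule pullback_mult_i[OF partial_inverse_id])
  qed
  have division: "left_division S p y = Some x \<longleftrightarrow> x \<in> carrier S \<and> y = p \<otimes>\<^bsub>S\<^esub> x"
    if "p \<in> carrier S" for p x y
  proof -
    have "(THE z. z \<in> carrier S \<and> p \<otimes>\<^bsub>S\<^esub> x = p \<otimes>\<^bsub>S\<^esub> z) = x" if "x \<in> carrier S" for x
      using \<open>p \<in> carrier S\<close> that cancel by (intro the_equality) (auto simp: left_cancellative_def)
    then show ?thesis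
      by (auto simp: left_division_def)
  qed
  have inverse: "partial_inverse (left_division S p) (left_mult S p)" if "p \<in> carrier S" for p
    by (auto simp: partial_inverse_def division[OF that] left_mult_def)
  have in_ops: "pullback \<pi> \<in> ops" "adjoint (pullback \<pi>) = pullback \<sigma>"
    if \<pi>: "partial_inverse \<pi> \<sigma>" and "\<And>x y. \<pi> y = Some x \<Longrightarrow> x \<in> carrier S \<and> y \<in> carrier S"
    for \<pi> \<sigma>
  proof -
    have "P o\<^sub>L pullback \<pi> = pullback \<pi>" "pullback \<pi> o\<^sub>L P = pullback \<pi>"
      unfolding P_def comp[OF partial_inverse_id \<pi>] comp[OF \<pi> partial_inverse_id]
      by (intro arg_cong[of _ _ pullback] ext option_eqI; use that in \<open>auto simp: bind_eq_Some_conv\<close>)+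
    then show "pullback \<pi> \<in> ops"
      using adjoint_pair_pullback[OF \<pi>] pullback_mult_i[OF \<pi>, folded J_def]
      by (auto simp: ops_def)
    show "adjoint (pullback \<pi>) = pullback \<sigma>"
      by (rule adjoint_eqI[OF adjoint_pair_pullback[OF \<pi>]])
  qed
  define w where "w p = enc (pullback (left_division S p))" for p
  define f where "f X = enc (pullback (partial_id X))" for X :: "'s set"
  have w: "pullback (left_division S p) \<in> ops"
    "adjoint (pullback (left_division S p)) = pullback (left_mult S p)" if "p \<in> carrier S" for p
    by (rule in_ops[OF inverse[OF that]]; simp add: division[OF that] that)+
  have f: "pullback (partial_id X) \<in> ops"
    "adjoint (pullback (partial_id X)) = pullback (partial_id X)" if "X \<subseteq> carrier S" for X
    by (rule in_ops[OF partial_inverse_id]; use that in auto)+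
  note sub = constructible_ideals_subset[OF \<open>monoid S\<close>]
  have "isometry alg (w p)" if "p \<in> carrier S" for p
  proof -
    have "pullback (left_mult S p) o\<^sub>L pullback (left_division S p) = P"
      unfolding P_def comp[OF partial_inverse_sym[OF inverse[OF that]] inverse[OF that]]
      using cancel that
      by (intro arg_cong[of _ _ pullback] ext option_eqI)
        (auto simp: bind_eq_Some_conv division left_mult_def left_cancellative_def)
    then show ?thesis
      using w[OF that] by (simp add: isometry_def w_def)
  qed
  moreover have "projection alg (f X)" if "X \<in> constructible_ideals S" for X
  proof -
    have "pullback (partial_id X) o\<^sub>L pullback (partial_id X) = pullback (partial_id X)"
      using partial_inverse_id by (intro pullback_compose) (auto simp: partial_id_def)
    then show ?thesis
      using f[OF sub[OF that]] by (simp add: projection_def f_def)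
  qed
  moreover have "w p \<otimes>\<^bsub>alg\<^esub> w q = w (p \<otimes>\<^bsub>S\<^esub> q)" if "p \<in> carrier S" "q \<in> carrier S" for p q
  proof -
    have "pullback (left_division S p) o\<^sub>L pullback (left_division S q)
        = pullback (left_division S (p \<otimes>\<^bsub>S\<^esub> q))"
      unfolding comp[OF inverse[OF that(1)] inverse[OF that(2)]] using that
      by (intro arg_cong[of _ _ pullback] ext option_eqI)
        (auto simp: bind_eq_Some_conv division S.m_assoc)
    then show ?thesis
      by (simp add: w_def)
  qed
  moreover have "w p \<otimes>\<^bsub>alg\<^esub> f X \<otimes>\<^bsub>alg\<^esub> (w p)\<^sup>\<star>\<^bsub>alg\<^esub> = f (p <#\<^bsub>S\<^esub> X)"
    if "p \<in> carrier S" "X \<in> constructible_ideals S" for p X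
  proof -
    note inv = inverse[OF that(1)]
    have "(pullback (left_division S p) o\<^sub>L pullback (partial_id X)) o\<^sub>L pullback (left_mult S p)
        = pullback (partial_id (p <#\<^bsub>S\<^esub> X))"
      unfolding comp[OF inv partial_inverse_id]
        comp[OF partial_inverse_compose[OF inv partial_inverse_id] partial_inverse_sym[OF inv]]
      using that sub[OF that(2)]
      by (intro arg_cong[of _ _ pullback] ext option_eqI)
        (auto simp: bind_eq_Some_conv division left_mult_def l_coset_def)
    then show ?thesis
      using w(2)[OF that(1)] by (simp add: w_def f_def)
  qed
  moreover have "f X \<otimes>\<^bsub>alg\<^esub> f Y = f (X \<inter> Y)" for X Y
  proof -
    have "pullback (partial_id X) o\<^sub>L pullback (partial_id Y) = pullback (partial_id (X \<inter> Y))"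
      using partial_inverse_id by (intro pullback_compose) (auto simp: partial_id_def)
    then show ?thesis
      by (simp add: f_def)
  qed
  moreover have "f {} = \<zero>\<^bsub>alg\<^esub>"
  proof -
    have "pullback (partial_id {}) = (0 :: 's ell2 \<Rightarrow>\<^sub>L 's ell2)"
      by (rule blinfun_eqI, rule ell2_eqI)
        (simp add: pullback_apply[OF partial_inverse_id] pullback_fun_def partial_id_def ell2_fun_simps)
    then show ?thesis
      by (simp add: f_def)
  qed
  moreover have "f (carrier S) = \<one>\<^bsub>alg\<^esub>"
    unfolding f_def P_def[symmetric] by simp
  ultimately have "semigroup_cstar_relations S alg w f"
    unfolding semigroup_cstar_relations_def by blast
  moreover have "P \<noteq> 0"
  proof
    assume "P = 0"
    let ?\<delta> = "\<lambda>i. if i = \<one>\<^bsub>S\<^esub> then 1 else 0 :: complex"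
    have "{i. (cmod (?\<delta> i))\<^sup>2 \<noteq> 0} = {\<one>\<^bsub>S\<^esub>}"
      by auto
    then have "ell2_fun (Abs_ell2 ?\<delta>) = ?\<delta>"
      by (intro ell2_fun_Abs finite_nonzero_values_imp_summable_on) simp
    then have "ell2_fun (P (Abs_ell2 ?\<delta>)) \<one>\<^bsub>S\<^esub> = 1"
      by (simp add: P_def pullback_apply[OF partial_inverse_id] pullback_fun_def partial_id_def)
    then show False
      using \<open>P = 0\<close> by (simp add: ell2_fun_simps)
  qed
  ultimately show thesis
    using that[of alg w f] cstar_algebra_alg alg_adj_mult_self_neq_negative by blast
qed

section \<open>Semidirect products\<close>

lemma (in group) finite_union_rcosets:
  assumes "finite \<H>" "\<And>H. H \<in> \<H> \<Longrightarrow> subgroup H G \<and> infinite (rcosets H)"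
    and "finite F" "F \<subseteq> \<H> \<times> carrier G"
  shows "\<exists>z\<in>carrier G. \<forall>(H, k)\<in>F. z \<notin> H #> k"
  using assms
proof (induction \<H> arbitrary: F rule: finite_induct)
  case empty
  then show ?case
    by auto
next
  case (insert H \<H>)
  have H: "subgroup H G" "infinite (rcosets H)"
    using insert.prems(1) by auto
  define D where "D = {k. (H, k) \<in> F}"
  define F' where "F' = {(K, k) \<in> F. K \<noteq> H}"
  have D: "finite D" "D \<subseteq> carrier G"
    using finite_imageI[OF insert.prems(2), of snd] insert.prems(3) unfolding D_def
    by (auto elim!: finite_subset[rotated] intro: image_eqI[of _ snd "(H, _)"])
  have F': "finite F'" "F' \<subseteq> \<H> \<times> carrier G"
    using insert.prems(2,3) by (auto simp: F'_def elim: finite_subset[rotated])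
  have "\<not> rcosets H \<subseteq> (\<lambda>k. H #> k) ` D"
    using H(2) D(1) finite_subset by blast
  then obtain g where g: "g \<in> carrier G" "\<And>k. k \<in> D \<Longrightarrow> H #> g \<noteq> H #> k"
    by (auto simp: RCOSETS_def)
  \<comment> \<open>Right translation by \<open>inv g \<otimes> k\<close> takes
    \<open>H #> g\<close> back to \<open>H #> k\<close>. Were the moved point in
    \<open>K #> k'\<close>, then \<open>z\<close> would lie in the translate of that coset, which
    \<open>E\<close> forbids.\<close>
  define E where "E = F' \<union> (\<lambda>((K, k'), k). (K, k' \<otimes> (inv g \<otimes> k))) ` (F' \<times> D)"
  have "finite E" "E \<subseteq> \<H> \<times> carrier G"
    using F' D g(1) by (auto simp: E_def)
  then have "\<exists>z\<in>carrier G. \<forall>(K, k)\<in>E. z \<notin> K #> k"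
    by (intro insert.IH insert.prems(1)) simp_all
  then obtain z where z: "z \<in> carrier G" "\<And>K k. (K, k) \<in> E \<Longrightarrow> z \<notin> K #> k"
    by blast
  show ?case
  proof (cases "\<exists>k\<in>D. z \<in> H #> k")
    case False
    then show ?thesis
      using z by (intro bexI[of _ z]) (auto simp: D_def E_def F'_def)
  next
    case True
    then obtain k h where k: "k \<in> D" "k \<in> carrier G" and h: "h \<in> H" "h \<in> carrier G" "z = h \<otimes> k"
      using D(2) subgroup.mem_carrier[OF H(1)] by (auto simp: r_coset_def)
    have "h \<otimes> g \<notin> K #> k'" if "(K, k') \<in> F" for K k'
    proof (cases "K = H")
      case True
      have "h \<otimes> g \<in> H #> g"
        using h g(1) by (auto simp: r_coset_def)
      moreover have "k' \<in> D"
        using that True by (simp add: D_def)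
      ultimately show ?thesis
        using True g D(2) repr_independence[OF _ _ H(1)] by (metis subsetD)
    next
      case False
      then have K: "(K, k') \<in> F'" "subgroup K G" "k' \<in> carrier G"
        using that F'(2) insert.prems(1) by (auto simp: F'_def)
      show ?thesis
      proof
        assume "h \<otimes> g \<in> K #> k'"
        then obtain u where u: "u \<in> K" "u \<in> carrier G" "h \<otimes> g = u \<otimes> k'"
          using subgroup.mem_carrier[OF K(2)] by (auto simp: r_coset_def)
        have "g \<otimes> (inv g \<otimes> k) = k"
          using g(1) k(2) by (simp flip: m_assoc)
        then have "z = (h \<otimes> g) \<otimes> (inv g \<otimes> k)"
          using h g(1) k(2) by (simp add: m_assoc)
        also have "\<dots> = u \<otimes> (k' \<otimes> (inv g \<otimes> k))"
          unfolding u(3) using u(2) K(3) g(1) k(2) by (simp add: m_assoc)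
        finally have "z \<in> K #> (k' \<otimes> (inv g \<otimes> k))"
          using u(1) by (auto simp: r_coset_def)
        then show False
          using z(2)[of K "k' \<otimes> (inv g \<otimes> k)"] K(1) k(1) by (force simp: E_def)
      qed
    qed
    then show ?thesis
      using h g(1) by (intro bexI[of _ "h \<otimes> g"]) auto
  qed
qed

section \<open>The divisibility order on \<open>P\<close>\<close>

locale lattice_monoid = Group.comm_monoid P for P (structure) +
  assumes cancel: "\<lbrakk>p \<in> carrier P; q \<in> carrier P; r \<in> carrier P; p \<otimes> q = p \<otimes> r\<rbrakk> \<Longrightarrow> q = r"
    and lcm: "\<lbrakk>p \<in> carrier P; q \<in> carrier P\<rbrakk>
      \<Longrightarrow> \<exists>r\<in>carrier P. pideal P p \<inter> pideal P q = pideal P r"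
    and antisym: "\<lbrakk>p \<in> carrier P; q \<in> carrier P; pideal P p = pideal P q\<rbrakk> \<Longrightarrow> p = q"
    and nontrivial: "\<exists>p\<in>carrier P. p \<noteq> \<one>"
begin

lemma common_multiple:
  assumes "finite Q" "Q \<subseteq> carrier P"
  shows "\<exists>r\<in>carrier P. \<forall>q\<in>Q. r \<in> pideal P q"
  using assms
proof (induction rule: finite_induct)
  case (insert q Q)
  then obtain r where r: "r \<in> carrier P" "\<forall>q\<in>Q. r \<in> pideal P q"
    by auto
  have "r \<otimes> q \<in> pideal P q'" if "q' \<in> insert q Q" for q'
  proof (cases "q' = q")
    case True
    then show ?thesis
      using r insert.prems m_comm by (auto simp: mem_pideal)
  next
    case False
    then have "pideal P r \<subseteq> pideal P q'"
      using that r insert.prems by (intro principal_mono) auto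
    moreover have "r \<otimes> q \<in> pideal P r"
      using insert.prems by (auto simp: mem_pideal)
    ultimately show ?thesis
      by blast
  qed
  then show ?case
    using r insert.prems by (intro bexI[of _ "r \<otimes> q"]) auto
qed auto

end

text \<open>As \<open>C\<close> is closed downwards, differences of comparable members lie in
  \<open>C\<close>, so divisibility is the pointwise order. The least common multiple is the
  pointwise maximum, a member of \<open>C\<close> because the sum dominates it. This treats finite
  powers and the infinite direct sum alike.\<close>

lemma lattice_monoid_pointwise:
  fixes P :: "('p, 'k) monoid_scheme" and h :: "'p \<Rightarrow> 'i \<Rightarrow> nat"
  assumes "Group.comm_monoid P"
    and bij: "bij_betw h (carrier P) C"
    and hom: "\<And>p q i. \<lbrakk>p \<in> carrier P; q \<in> carrier P\<rbrakk> \<Longrightarrow> h (p \<otimes>\<^bsub>P\<^esub> q) i = h p i + h q i"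
    and down: "\<And>f g. \<lbrakk>f \<in> C; \<forall>i. g i \<le> f i\<rbrakk> \<Longrightarrow> g \<in> C"
    and "C \<noteq> {\<lambda>_. 0}"
  shows "lattice_monoid P"
proof -
  interpret Group.comm_monoid P
    by fact
  have inj: "p = q" if "p \<in> carrier P" "q \<in> carrier P" "\<And>i. h p i = h q i" for p q
    using bij that(1,2) ext[of "h p" "h q", OF that(3)] by (auto simp: bij_betw_def inj_on_def)
  have surj: "\<exists>p\<in>carrier P. h p = f" if "f \<in> C" for f
    using bij that by (auto simp: bij_betw_def)
  have into: "h p \<in> C" if "p \<in> carrier P" for p
    using bij that by (auto simp: bij_betw_def)
  have one: "h \<one>\<^bsub>P\<^esub> i = 0" for i
    using hom[of "\<one>\<^bsub>P\<^esub>" "\<one>\<^bsub>P\<^esub>" i] by simp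
  have pr: "x \<in> pideal P p \<longleftrightarrow> x \<in> carrier P \<and> (\<forall>i. h p i \<le> h x i)" if p: "p \<in> carrier P" for p x
  proof
    assume "x \<in> pideal P p"
    then show "x \<in> carrier P \<and> (\<forall>i. h p i \<le> h x i)"
      using p by (auto simp: mem_pideal hom)
  next
    assume x: "x \<in> carrier P \<and> (\<forall>i. h p i \<le> h x i)"
    then obtain a where a: "a \<in> carrier P" "h a = (\<lambda>i. h x i - h p i)"
      using surj[OF down[OF into[of x], of "\<lambda>i. h x i - h p i"]] by auto
    have "x = p \<otimes>\<^bsub>P\<^esub> a"
      using x p a by (intro inj) (auto simp: hom)
    then show "x \<in> pideal P p"
      using a(1) by (auto simp: mem_pideal)
  qed
  show ?thesis
  proof
    fix p q r assume pqr: "p \<in> carrier P" "q \<in> carrier P" "r \<in> carrier P" "p \<otimes>\<^bsub>P\<^esub> q = p \<otimes>\<^bsub>P\<^esub> r"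
    have "h p i + h q i = h p i + h r i" for i
      using hom[of p q i] hom[of p r i] pqr by simp
    then show "q = r"
      using pqr by (intro inj) auto
  next
    fix p q assume pq: "p \<in> carrier P" "q \<in> carrier P"
    have "(\<lambda>i. max (h p i) (h q i)) \<in> C"
      using pq by (intro down[OF into[of "p \<otimes>\<^bsub>P\<^esub> q"]]) (auto simp: hom)
    then obtain r where r: "r \<in> carrier P" "h r = (\<lambda>i. max (h p i) (h q i))"
      using surj by blast
    then have "pideal P p \<inter> pideal P q = pideal P r"
      using pq by (auto simp: pr)
    then show "\<exists>r\<in>carrier P. pideal P p \<inter> pideal P q = pideal P r"
      using r(1) by blast
  next
    fix p q assume pq: "p \<in> carrier P" "q \<in> carrier P" "pideal P p = pideal P q"
    then have "\<forall>i. h p i \<le> h q i" "\<forall>i. h q i \<le> h p i"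
      using pr[OF pq(1)] pr[OF pq(2)] by blast+
    then show "p = q"
      using pq(1,2) by (intro inj) (auto intro: antisym)
  next
    show "\<exists>p\<in>carrier P. p \<noteq> \<one>\<^bsub>P\<^esub>"
    proof (rule ccontr)
      assume "\<not> ?thesis"
      then have "carrier P = {\<one>\<^bsub>P\<^esub>}"
        by auto
      moreover have "C = h ` carrier P"
        using bij by (simp add: bij_betw_def)
      ultimately show False
        using \<open>C \<noteq> {\<lambda>_. 0}\<close> one by (auto simp: fun_eq_iff)
    qed
  qed
qed

section \<open>Ideals of the semidirect product as cosets in \<open>G\<close> paired with ideals of
  \<open>P\<close>\<close>

locale ordered_semidirect = group G + P: lattice_monoid P
  for G :: "('g, 'm) monoid_scheme" (structure) and P :: "('p, 'k) monoid_scheme" +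
  fixes \<theta> :: "'p \<Rightarrow> 'g \<Rightarrow> 'g"
  assumes action: "semigroup_action P G \<theta>"
    and inj: "p \<in> carrier P \<Longrightarrow> inj_on (\<theta> p) (carrier G)"
    and order: "respects_order P G \<theta>"
    and Inter: "(\<Inter>p\<in>carrier P. \<theta> p ` carrier G) = {\<one>}"
    and index: "\<lbrakk>p \<in> carrier P; p \<noteq> \<one>\<^bsub>P\<^esub>\<rbrakk> \<Longrightarrow> infinite (rcosets (\<theta> p ` carrier G))"
begin

abbreviation S :: "('g \<times> 'p) monoid" where "S \<equiv> semidirect_product G P \<theta>"
abbreviation S_mult (infixl \<open>\<cdot>\<close> 70) where "s \<cdot> t \<equiv> s \<otimes>\<^bsub>S\<^esub> t"

lemma S_simps [simp]:
  "x \<in> carrier S \<longleftrightarrow> fst x \<in> carrier G \<and> snd x \<in> carrier P"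
  "(g, p) \<cdot> (h, q) = (g \<otimes> \<theta> p h, p \<otimes>\<^bsub>P\<^esub> q)"
  "\<one>\<^bsub>S\<^esub> = (\<one>, \<one>\<^bsub>P\<^esub>)"
  by (cases x) (auto simp: semidirect_product_def)

lemma \<theta>_hom: "p \<in> carrier P \<Longrightarrow> group_hom G G (\<theta> p)"
  using action is_group by (simp add: semigroup_action_def group_hom_def group_hom_axioms_def)

lemma \<theta>_closed [simp]: "\<lbrakk>p \<in> carrier P; g \<in> carrier G\<rbrakk> \<Longrightarrow> \<theta> p g \<in> carrier G"
  by (rule group_hom.hom_closed[OF \<theta>_hom])

lemma \<theta>_mult: "\<lbrakk>p \<in> carrier P; g \<in> carrier G; h \<in> carrier G\<rbrakk> \<Longrightarrow> \<theta> p (g \<otimes> h) = \<theta> p g \<otimes> \<theta> p h"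
  by (rule group_hom.hom_mult[OF \<theta>_hom])

lemma \<theta>_inv: "\<lbrakk>p \<in> carrier P; g \<in> carrier G\<rbrakk> \<Longrightarrow> \<theta> p (inv g) = inv (\<theta> p g)"
  by (rule group_hom.hom_inv[OF \<theta>_hom])

lemma \<theta>_one [simp]: "p \<in> carrier P \<Longrightarrow> \<theta> p \<one> = \<one>"
  by (rule group_hom.hom_one[OF \<theta>_hom])

lemma \<theta>_subgroup: "p \<in> carrier P \<Longrightarrow> subgroup (\<theta> p ` carrier G) G"
  by (rule group_hom.img_is_subgroup[OF \<theta>_hom])

lemma \<theta>_\<theta>: "\<lbrakk>p \<in> carrier P; q \<in> carrier P; g \<in> carrier G\<rbrakk> \<Longrightarrow> \<theta> p (\<theta> q g) = \<theta> (p \<otimes>\<^bsub>P\<^esub> q) g"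
  and \<theta>_one_left: "g \<in> carrier G \<Longrightarrow> \<theta> \<one>\<^bsub>P\<^esub> g = g"
  using action by (auto simp: semigroup_action_def)

lemma \<theta>_inj: "\<lbrakk>p \<in> carrier P; g \<in> carrier G; h \<in> carrier G; \<theta> p g = \<theta> p h\<rbrakk> \<Longrightarrow> g = h"
  using inj by (auto dest: inj_onD)

lemma \<theta>_image_Int:
  assumes "p \<in> carrier P" "q \<in> carrier P" "r \<in> carrier P"
    and "pideal P p \<inter> pideal P q = pideal P r"
  shows "\<theta> p ` carrier G \<inter> \<theta> q ` carrier G = \<theta> r ` carrier G"
proof -
  have "pideal P p \<inter> pideal P q \<noteq> {}"
    using P.self_mem_pideal[OF assms(3)] assms(4) by auto
  then show ?thesis
    using order assms unfolding respects_order_def pideal_def by blast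
qed

lemma \<theta>_image_mono:
  assumes "q \<in> carrier P" "p \<in> pideal P q"
  shows "\<theta> p ` carrier G \<subseteq> \<theta> q ` carrier G"
proof -
  obtain a where a: "a \<in> carrier P" "p = q \<otimes>\<^bsub>P\<^esub> a"
    using assms(2) by (auto simp: mem_pideal)
  then have "\<theta> p g = \<theta> q (\<theta> a g)" if "g \<in> carrier G" for g
    using \<theta>_\<theta> assms(1) that by simp
  then show ?thesis
    using a(1) by auto
qed

lemma inv_cancel [simp]:
  "\<lbrakk>a \<in> carrier G; b \<in> carrier G\<rbrakk> \<Longrightarrow> inv a \<otimes> (a \<otimes> b) = b"
  "\<lbrakk>a \<in> carrier G; b \<in> carrier G\<rbrakk> \<Longrightarrow> a \<otimes> (inv a \<otimes> b) = b"
  by (simp_all flip: m_assoc)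

lemma monoid_S: "monoid S"
proof (rule monoidI)
  fix x y z assume "x \<in> carrier S" "y \<in> carrier S" "z \<in> carrier S"
  then show "x \<cdot> y \<cdot> z = x \<cdot> (y \<cdot> z)"
    by (cases x; cases y; cases z) (simp add: \<theta>_mult \<theta>_\<theta> m_assoc P.m_assoc)
next
  fix x y assume "x \<in> carrier S" "y \<in> carrier S"
  then show "x \<cdot> y \<in> carrier S"
    by (cases x; cases y) simp
next
  fix x assume "x \<in> carrier S"
  then show "\<one>\<^bsub>S\<^esub> \<cdot> x = x" "x \<cdot> \<one>\<^bsub>S\<^esub> = x"
    by (cases x; simp add: \<theta>_one_left)+
qed simp

sublocale S: monoid S
  by (rule monoid_S)

lemma left_cancellative_S: "left_cancellative S"
  unfolding left_cancellative_def
proof (intro ballI impI)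
  fix s x y assume "s \<in> carrier S" "x \<in> carrier S" "y \<in> carrier S" "s \<cdot> x = s \<cdot> y"
  then show "x = y"
    by (cases s; cases x; cases y) (auto intro: \<theta>_inj P.cancel)
qed

lemma right_cancel_S:
  assumes "s \<in> carrier S" "t \<in> carrier S" "x \<in> carrier S" "s \<cdot> x = t \<cdot> x"
  shows "s = t"
proof -
  obtain g p h q k m where eqs: "s = (g, p)" "t = (h, q)" "x = (k, m)"
    by (metis surj_pair)
  then have carr: "g \<in> carrier G" "p \<in> carrier P" "h \<in> carrier G" "q \<in> carrier P"
    "k \<in> carrier G" "m \<in> carrier P"
    and eq: "g \<otimes> \<theta> p k = h \<otimes> \<theta> q k" "p \<otimes>\<^bsub>P\<^esub> m = q \<otimes>\<^bsub>P\<^esub> m"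
    using assms by auto
  have "p = q"
    using P.cancel[of m p q] carr eq(2) P.m_comm by metis
  then show ?thesis
    using eq(1) carr eqs by simp
qed

text \<open>The ideal of \<open>(g, p)\<close> is the product of the coset
  \<open>g \<theta>\<^sub>p(G)\<close> and the ideal \<open>pP\<close>. Questions about
  \<open>S\<close> thereby split into cosets in \<open>G\<close> and divisibility in
  \<open>P\<close>.\<close>

lemma mem_pideal_S:
  "(x, y) \<in> pideal S (g, p) \<longleftrightarrow> (\<exists>h\<in>carrier G. x = g \<otimes> \<theta> p h) \<and> y \<in> pideal P p"
proof
  assume "(x, y) \<in> pideal S (g, p)"
  then obtain h q where "(h, q) \<in> carrier S" "(x, y) = (g, p) \<cdot> (h, q)"
    unfolding mem_pideal by (metis surj_pair)
  then show "(\<exists>h\<in>carrier G. x = g \<otimes> \<theta> p h) \<and> y \<in> pideal P p"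
    by (auto simp: mem_pideal)
next
  assume "(\<exists>h\<in>carrier G. x = g \<otimes> \<theta> p h) \<and> y \<in> pideal P p"
  then obtain h q where "h \<in> carrier G" "q \<in> carrier P" "x = g \<otimes> \<theta> p h" "y = p \<otimes>\<^bsub>P\<^esub> q"
    by (auto simp: mem_pideal)
  then show "(x, y) \<in> pideal S (g, p)"
    unfolding mem_pideal by (intro bexI[of _ "(h, q)"]) simp_all
qed

text \<open>If \<open>q\<close> divides \<open>n\<close>, then \<open>\<theta>\<^sub>n(G)\<close> is
  contained in \<open>\<theta>\<^sub>q(G)\<close>, so a coset of the smaller subgroup lies inside a
  coset of the larger one or misses it. Making the second component a large multiple thus reduces
  intersection to membership.\<close>

lemma principal_S_absorb:
  assumes "g \<in> carrier G" "n \<in> carrier P" "h \<in> carrier G" "q \<in> carrier P" "n \<in> pideal P q"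
    and "pideal S (g, n) \<inter> pideal S (h, q) \<noteq> {}"
  shows "(g, n) \<in> pideal S (h, q)"
proof -
  obtain x y where "(x, y) \<in> pideal S (g, n)" "(x, y) \<in> pideal S (h, q)"
    using assms(6) by (metis disjoint_iff surj_pair)
  then obtain a b where ab: "a \<in> carrier G" "b \<in> carrier G" "g \<otimes> \<theta> n a = h \<otimes> \<theta> q b"
    by (auto simp: mem_pideal_S)
  obtain c where c: "c \<in> carrier G" "\<theta> n a = \<theta> q c"
    using \<theta>_image_mono[OF assms(4,5)] ab(1) by auto
  have "g = (g \<otimes> \<theta> n a) \<otimes> inv (\<theta> n a)"
    using assms(1,2) ab(1) by (simp add: m_assoc)
  also have "\<dots> = h \<otimes> \<theta> q (b \<otimes> inv c)"
    using assms(3,4) ab(2) c unfolding ab(3) by (simp add: \<theta>_mult \<theta>_inv m_assoc)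
  finally have "g = h \<otimes> \<theta> q (b \<otimes> inv c)" .
  then have "\<exists>x\<in>carrier G. g = h \<otimes> \<theta> q x"
    using ab(2) c(1) by (metis inv_closed m_closed)
  then show ?thesis
    unfolding mem_pideal_S using assms(5) by (rule conjI)
qed

text \<open>Two common points of the cosets differ by an element of both subgroups, and the
  intersection of these is \<open>\<theta>\<^sub>r(G)\<close> because the action respects the
  order.\<close>

lemma coset_Int:
  assumes p: "p \<in> carrier P" "q \<in> carrier P" "r \<in> carrier P" "pideal P p \<inter> pideal P q = pideal P r"
    and "g \<in> carrier G" "h \<in> carrier G" "a \<in> carrier G" "b \<in> carrier G" "a' \<in> carrier G" "b' \<in> carrier G"
    and "g \<otimes> \<theta> p a = h \<otimes> \<theta> q b" "g \<otimes> \<theta> p a' = h \<otimes> \<theta> q b'"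
  shows "\<theta> p (inv a \<otimes> a') \<in> \<theta> r ` carrier G"
proof -
  have "inv (g \<otimes> \<theta> p a) \<otimes> (g \<otimes> \<theta> p a') = \<theta> p (inv a \<otimes> a')"
    using assms(1-10) by (simp add: \<theta>_mult \<theta>_inv inv_mult_group m_assoc)
  moreover have "inv (h \<otimes> \<theta> q b) \<otimes> (h \<otimes> \<theta> q b') = \<theta> q (inv b \<otimes> b')"
    using assms(1-10) by (simp add: \<theta>_mult \<theta>_inv inv_mult_group m_assoc)
  ultimately have "\<theta> p (inv a \<otimes> a') = \<theta> q (inv b \<otimes> b')"
    using assms(11,12) by simp
  moreover have "\<theta> p (inv a \<otimes> a') \<in> \<theta> p ` carrier G" "\<theta> q (inv b \<otimes> b') \<in> \<theta> q ` carrier G"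
    using assms(7-10) by (auto intro!: imageI)
  ultimately have "\<theta> p (inv a \<otimes> a') \<in> \<theta> p ` carrier G \<inter> \<theta> q ` carrier G"
    by simp
  then show ?thesis
    using \<theta>_image_Int[OF p] by simp
qed

text \<open>Any common point \<open>x\<close> of the two cosets, paired with the least common
  multiple \<open>r\<close> in \<open>P\<close>, generates the intersection.\<close>

lemma right_lcm_S: "right_lcm S"
  unfolding right_lcm_def
proof (intro ballI)
  fix s t assume st: "s \<in> carrier S" "t \<in> carrier S"
  obtain g p h q where eqs: "s = (g, p)" "t = (h, q)"
    by (metis surj_pair)
  have carr: "g \<in> carrier G" "p \<in> carrier P" "h \<in> carrier G" "q \<in> carrier P"
    using st eqs by auto
  obtain r where r: "r \<in> carrier P" "pideal P p \<inter> pideal P q = pideal P r"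
    using P.lcm carr by blast
  have "\<exists>w\<in>carrier S. pideal S s \<inter> pideal S t = pideal S w"
    if "pideal S s \<inter> pideal S t \<noteq> {}"
  proof -
    obtain x y where "(x, y) \<in> pideal S s" "(x, y) \<in> pideal S t"
      using \<open>pideal S s \<inter> pideal S t \<noteq> {}\<close> by (metis disjoint_iff surj_pair)
    then obtain a b where ab: "a \<in> carrier G" "b \<in> carrier G" "x = g \<otimes> \<theta> p a" "x = h \<otimes> \<theta> q b"
      by (auto simp: mem_pideal_S eqs)
    have x: "x \<in> carrier G"
      using ab carr by simp
    have "(x', y') \<in> pideal S s \<and> (x', y') \<in> pideal S t \<longleftrightarrow> (x', y') \<in> pideal S (x, r)" for x' y'
    proof
      assume "(x', y') \<in> pideal S s \<and> (x', y') \<in> pideal S t"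
      then obtain a' b' where ab': "a' \<in> carrier G" "b' \<in> carrier G" "x' = g \<otimes> \<theta> p a'" "x' = h \<otimes> \<theta> q b'"
        and y': "y' \<in> pideal P r"
        using r(2) unfolding eqs mem_pideal_S by blast
      have "\<theta> p (inv a \<otimes> a') \<in> \<theta> r ` carrier G"
        using coset_Int[OF carr(2,4) r carr(1,3) ab(1,2) ab'(1,2)] ab ab' by simp
      moreover have "x' = x \<otimes> \<theta> p (inv a \<otimes> a')"
        using ab(1) ab'(1) carr unfolding ab(3) ab'(3) by (simp add: \<theta>_mult \<theta>_inv m_assoc)
      ultimately show "(x', y') \<in> pideal S (x, r)"
        using y' by (auto simp: mem_pideal_S)
    next
      assume "(x', y') \<in> pideal S (x, r)"
      then obtain c where c: "c \<in> carrier G" "x' = x \<otimes> \<theta> r c" and y': "y' \<in> pideal P r"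
        by (auto simp: mem_pideal_S)
      obtain d d' where d: "d \<in> carrier G" "\<theta> r c = \<theta> p d" "d' \<in> carrier G" "\<theta> r c = \<theta> q d'"
        using \<theta>_image_Int[OF carr(2,4) r] c(1) by blast
      have "x' = g \<otimes> \<theta> p (a \<otimes> d)"
        unfolding c(2) d(2) ab(3) using ab(1) d(1) carr by (simp add: \<theta>_mult m_assoc)
      moreover have "x' = h \<otimes> \<theta> q (b \<otimes> d')"
        unfolding c(2) d(4) ab(4) using ab(2) d(3) carr by (simp add: \<theta>_mult m_assoc)
      ultimately show "(x', y') \<in> pideal S s \<and> (x', y') \<in> pideal S t"
        using y' r(2) m_closed[OF ab(1) d(1)] m_closed[OF ab(2) d(3)]
        unfolding eqs mem_pideal_S by blast
    qed
    then have "pideal S s \<inter> pideal S t = pideal S (x, r)"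
      by auto
    then show ?thesis
      using x r(1) by (intro bexI[of _ "(x, r)"]) auto
  qed
  then show "pideal S s \<inter> pideal S t = {} \<or>
      (\<exists>w\<in>carrier S. pideal S s \<inter> pideal S t = pideal S w)"
    by blast
qed

text \<open>The \<open>z\<close> for which the cosets still meet differ by elements of
  \<open>\<theta>\<^sub>m(G)\<close>, where \<open>p m\<close> is the least common multiple of
  \<open>p\<close> and \<open>q\<close>. If \<open>m\<close> were the identity, \<open>q\<close>
  would divide \<open>p\<close> and absorption would put \<open>(g, p)\<close> into the ideal of
  \<open>(h, q)\<close>. Inverses appear because the \<open>z\<close> fill a left coset while the
  covering lemma speaks of right ones.\<close>

lemma bad_coset:
  assumes carr: "g \<in> carrier G" "p \<in> carrier P" "h \<in> carrier G" "q \<in> carrier P"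
    and "(g, p) \<notin> pideal S (h, q)"
  shows "\<exists>m\<in>carrier P. \<exists>k\<in>carrier G. m \<noteq> \<one>\<^bsub>P\<^esub> \<and>
    (\<forall>z\<in>carrier G. \<forall>u\<in>carrier G. g \<otimes> \<theta> p z = h \<otimes> \<theta> q u \<longrightarrow> inv z \<in> \<theta> m ` carrier G #> k)"
proof (cases "\<exists>z\<in>carrier G. \<exists>u\<in>carrier G. g \<otimes> \<theta> p z = h \<otimes> \<theta> q u")
  case False
  \<comment> \<open>The condition on \<open>z\<close> is now vacuous, and any nontrivial
    \<open>m\<close> will do.\<close>
  then show ?thesis
    using P.nontrivial by blast
next
  case True
  then obtain k u where k: "k \<in> carrier G" "u \<in> carrier G" "g \<otimes> \<theta> p k = h \<otimes> \<theta> q u"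
    by blast
  obtain r where r: "r \<in> carrier P" "pideal P p \<inter> pideal P q = pideal P r"
    using P.lcm carr by blast
  then have "r \<in> pideal P p" "r \<in> pideal P q"
    using P.self_mem_pideal by blast+
  then obtain m where m: "m \<in> carrier P" "r = p \<otimes>\<^bsub>P\<^esub> m"
    by (auto simp: mem_pideal)
  have "m \<noteq> \<one>\<^bsub>P\<^esub>"
  proof
    assume "m = \<one>\<^bsub>P\<^esub>"
    then have "p \<in> pideal P q"
      using m carr \<open>r \<in> pideal P q\<close> by simp
    moreover have "(g \<otimes> \<theta> p k, p) \<in> pideal S (g, p) \<inter> pideal S (h, q)"
      unfolding mem_pideal_S Int_iff using k calculation P.self_mem_pideal[OF carr(2)] by blast
    ultimately show False
      using principal_S_absorb[OF carr] assms(5) by blast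
  qed
  moreover have "inv z \<in> \<theta> m ` carrier G #> inv k"
    if z: "z \<in> carrier G" "u' \<in> carrier G" "g \<otimes> \<theta> p z = h \<otimes> \<theta> q u'" for z u'
  proof -
    have "\<theta> p (inv z \<otimes> k) \<in> \<theta> r ` carrier G"
      by (rule coset_Int[OF carr(2,4) r carr(1,3) z(1,2) k(1,2) z(3) k(3)])
    then obtain c where c: "c \<in> carrier G" "\<theta> p (inv z \<otimes> k) = \<theta> p (\<theta> m c)"
      using carr m by (auto simp: \<theta>_\<theta>)
    then have "inv z \<otimes> k = \<theta> m c"
      using \<theta>_inj[OF carr(2)] z(1) k(1) m(1) by simp
    then have "inv z = \<theta> m c \<otimes> inv k"
      using z(1) k(1) by (metis inv_closed inv_solve_right m_closed)
    then show ?thesis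
      using c(1) by (auto simp: r_coset_def)
  qed
  ultimately show ?thesis
    using m(1) k(1) by (intro bexI[of _ m] bexI[of _ "inv k"]) auto
qed

text \<open>The first component \<open>z\<close> of the multiplier escapes the finitely many bad
  cosets by Neumann's lemma. Its second component \<open>n\<close> is a multiple of all second
  components in \<open>F\<close>, so that by absorption an ideal that still met one of theirs would
  be contained in it, which the choice of \<open>z\<close> prevents.\<close>

lemma avoid_S:
  assumes t: "t \<in> carrier S" and F: "finite F" "F \<subseteq> carrier S" "\<forall>s\<in>F. t \<notin> pideal S s"
  shows "\<exists>x\<in>carrier S. \<forall>s\<in>F. pideal S (t \<cdot> x) \<inter> pideal S s = {}"
proof -
  obtain g p where gp: "t = (g, p)" "g \<in> carrier G" "p \<in> carrier P"
    using t by (cases t) auto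
  have "\<forall>s\<in>F. \<exists>m k. m \<in> carrier P \<and> k \<in> carrier G \<and> m \<noteq> \<one>\<^bsub>P\<^esub> \<and>
    (\<forall>z\<in>carrier G. \<forall>u\<in>carrier G. g \<otimes> \<theta> p z = fst s \<otimes> \<theta> (snd s) u \<longrightarrow> inv z \<in> \<theta> m ` carrier G #> k)"
  proof
    fix s assume "s \<in> F"
    then show "\<exists>m k. m \<in> carrier P \<and> k \<in> carrier G \<and> m \<noteq> \<one>\<^bsub>P\<^esub> \<and>
      (\<forall>z\<in>carrier G. \<forall>u\<in>carrier G. g \<otimes> \<theta> p z = fst s \<otimes> \<theta> (snd s) u \<longrightarrow> inv z \<in> \<theta> m ` carrier G #> k)"
      using bad_coset[OF gp(2,3), of "fst s" "snd s"] F(2,3) gp(1) subsetD[OF F(2), of s]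
      by (simp only: S_simps(1) prod.collapse) blast
  qed
  then obtain m k where mk: "\<And>s. s \<in> F \<Longrightarrow> m s \<in> carrier P \<and> k s \<in> carrier G \<and> m s \<noteq> \<one>\<^bsub>P\<^esub> \<and>
    (\<forall>z\<in>carrier G. \<forall>u\<in>carrier G. g \<otimes> \<theta> p z = fst s \<otimes> \<theta> (snd s) u \<longrightarrow> inv z \<in> \<theta> (m s) ` carrier G #> k s)"
    by metis
  have "\<exists>w\<in>carrier G. \<forall>(H, k)\<in>(\<lambda>s. (\<theta> (m s) ` carrier G, k s)) ` F. w \<notin> H #> k"
    using F(1) mk \<theta>_subgroup index
    by (intro finite_union_rcosets[of "(\<lambda>s. \<theta> (m s) ` carrier G) ` F"]) auto
  then obtain w where w: "w \<in> carrier G" "\<forall>s\<in>F. w \<notin> \<theta> (m s) ` carrier G #> k s"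
    by auto
  \<comment> \<open>The bad cosets were recorded for inverses, so the point avoiding them has to be
    inverted.\<close>
  define z where "z = inv w"
  have z: "z \<in> carrier G" "inv z = w"
    using w(1) by (simp_all add: z_def)
  have "snd ` F \<subseteq> carrier P"
    using F(2) S_simps(1) by blast
  then obtain n where n: "n \<in> carrier P" "\<forall>q\<in>snd ` F. n \<in> pideal P q"
    using P.common_multiple[of "snd ` F"] F(1) by blast
  have "pideal S (t \<cdot> (z, n)) \<inter> pideal S s = {}" if "s \<in> F" for s
  proof (rule ccontr)
    assume nonempty: "\<not> ?thesis"
    have "s \<in> carrier S"
      using that F(2) by blast
    then obtain h q where hq: "s = (h, q)" "h \<in> carrier G" "q \<in> carrier P"
      by (cases s) simp
    have "n \<in> pideal P q"
      using n(2) that hq(1) by force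
    moreover have "p \<otimes>\<^bsub>P\<^esub> n \<in> pideal P n"
      unfolding mem_pideal using n(1) gp(3) P.m_comm[of p n] by blast
    ultimately have "p \<otimes>\<^bsub>P\<^esub> n \<in> pideal P q"
      using P.principal_mono[OF hq(3)] by blast
    then have "(g \<otimes> \<theta> p z, p \<otimes>\<^bsub>P\<^esub> n) \<in> pideal S (h, q)"
      using nonempty gp hq z(1) n(1) by (intro principal_S_absorb) auto
    then obtain u where "u \<in> carrier G" "g \<otimes> \<theta> p z = h \<otimes> \<theta> q u"
      by (auto simp: mem_pideal_S)
    then show False
      using mk[OF that] w(2) that z hq(1) by auto
  qed
  then show ?thesis
    using z(1) n(1) by (intro bexI[of _ "(z, n)"]) auto
qed

text \<open>If the two maps agreed, their common image would be \<open>\<theta>\<^sub>r(G)\<close>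
  for the least common multiple \<open>r\<close>. Writing \<open>r = n b\<close> with
  \<open>n\<close> either of the two, injectivity of \<open>\<theta>\<^sub>n\<close> makes
  \<open>\<theta>\<^sub>b\<close> surjective, so its image has finite index and \<open>b\<close> is
  the identity; both elements then equal \<open>r\<close>.\<close>

lemma \<theta>_neq:
  assumes "m \<in> carrier P" "m' \<in> carrier P" "m \<noteq> m'"
  shows "\<exists>z\<in>carrier G. \<theta> m z \<noteq> \<theta> m' z"
proof (rule ccontr)
  assume "\<not> ?thesis"
  then have "\<theta> m ` carrier G = \<theta> m' ` carrier G"
    by (intro image_cong) auto
  moreover obtain r where r: "r \<in> carrier P" "pideal P m \<inter> pideal P m' = pideal P r"
    using P.lcm assms by blast
  ultimately have img: "\<theta> r ` carrier G = \<theta> m ` carrier G" "\<theta> r ` carrier G = \<theta> m' ` carrier G"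
    using \<theta>_image_Int[OF assms(1,2) r] by auto
  have "r = n" if n: "n \<in> carrier P" "r \<in> pideal P n" "\<theta> r ` carrier G = \<theta> n ` carrier G" for n
  proof -
    obtain b where b: "b \<in> carrier P" "r = n \<otimes>\<^bsub>P\<^esub> b"
      using n(2) by (auto simp: mem_pideal)
    have "carrier G \<subseteq> \<theta> b ` carrier G"
    proof
      fix x assume x: "x \<in> carrier G"
      then have "\<theta> n x \<in> \<theta> r ` carrier G"
        using n(3) by simp
      then obtain y where "y \<in> carrier G" "\<theta> n x = \<theta> n (\<theta> b y)"
        using b n(1) by (auto simp: \<theta>_\<theta>)
      then show "x \<in> \<theta> b ` carrier G"
        using \<theta>_inj[OF n(1) x, of "\<theta> b y"] b(1) by auto
    qed
    then have "\<theta> b ` carrier G = carrier G"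
      using b(1) by auto
    moreover have "rcosets (carrier G) \<subseteq> {carrier G}"
      using coset_join2[OF _ subgroup_self] by (auto simp: RCOSETS_def)
    ultimately have "finite (rcosets (\<theta> b ` carrier G))"
      by (simp add: finite_subset)
    then have "b = \<one>\<^bsub>P\<^esub>"
      using index[OF b(1)] by blast
    then show ?thesis
      using b n(1) by simp
  qed
  moreover have "r \<in> pideal P m" "r \<in> pideal P m'"
    using P.self_mem_pideal[OF r(1)] r(2) by auto
  ultimately show False
    using img assms by blast
qed

text \<open>A suitable \<open>z\<close> makes the first components \<open>x\<close> and
  \<open>x'\<close> of the translates distinct. As the images intersect trivially, some
  \<open>\<theta>\<^sub>n(G)\<close> omits \<open>inv x \<otimes> x'\<close>. By commutativity of
  \<open>P\<close>, multiplying by \<open>n\<close> puts the two ideals over different cosets of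
  \<open>\<theta>\<^sub>n(G)\<close>.\<close>

lemma separate_translates:
  assumes "a \<in> carrier S" "a' \<in> carrier S" "a \<noteq> a'"
  shows "\<exists>y\<in>carrier S. pideal S (a \<cdot> y) \<inter> pideal S (a' \<cdot> y) = {}"
proof -
  obtain k m k' m' where eqs: "a = (k, m)" "a' = (k', m')"
    by (metis surj_pair)
  have carr: "k \<in> carrier G" "m \<in> carrier P" "k' \<in> carrier G" "m' \<in> carrier P"
    using assms eqs by auto
  have "\<exists>z\<in>carrier G. k \<otimes> \<theta> m z \<noteq> k' \<otimes> \<theta> m' z"
  proof (cases "k = k'")
    case True
    then show ?thesis
      using \<theta>_neq[of m m'] assms(3) eqs carr by auto
  next
    case False
    then show ?thesis
      using carr by (intro bexI[of _ \<one>]) auto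
  qed
  then obtain z where z: "z \<in> carrier G" "k \<otimes> \<theta> m z \<noteq> k' \<otimes> \<theta> m' z"
    by blast
  define x x' where "x = k \<otimes> \<theta> m z" and "x' = k' \<otimes> \<theta> m' z"
  have x: "x \<in> carrier G" "x' \<in> carrier G" "x \<noteq> x'"
    using z carr by (auto simp: x_def x'_def)
  then have "inv x \<otimes> x' \<noteq> \<one>"
    by (metis inv_cancel(2) inv_closed m_closed r_one)
  then obtain n where n: "n \<in> carrier P" "inv x \<otimes> x' \<notin> \<theta> n ` carrier G"
    using Inter by blast
  have "pideal S (x, m \<otimes>\<^bsub>P\<^esub> n) \<inter> pideal S (x', m' \<otimes>\<^bsub>P\<^esub> n) = {}"
  proof (rule ccontr)
    assume "\<not> ?thesis"
    then obtain y c where "(y, c) \<in> pideal S (x, m \<otimes>\<^bsub>P\<^esub> n)" "(y, c) \<in> pideal S (x', m' \<otimes>\<^bsub>P\<^esub> n)"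
      by (metis disjoint_iff surj_pair)
    then obtain u w where uw: "u \<in> carrier G" "w \<in> carrier G"
      "x \<otimes> \<theta> (m \<otimes>\<^bsub>P\<^esub> n) u = x' \<otimes> \<theta> (m' \<otimes>\<^bsub>P\<^esub> n) w"
      by (auto simp: mem_pideal_S)
    have eq: "x \<otimes> \<theta> n (\<theta> m u) = x' \<otimes> \<theta> n (\<theta> m' w)"
      using uw carr n(1) P.m_comm[of m n] P.m_comm[of m' n] by (simp add: \<theta>_\<theta>)
    have "x' = (x' \<otimes> \<theta> n (\<theta> m' w)) \<otimes> inv (\<theta> n (\<theta> m' w))"
      using x uw carr n(1) by (simp add: m_assoc)
    also have "\<dots> = x \<otimes> \<theta> n (\<theta> m u \<otimes> inv (\<theta> m' w))"
      unfolding eq[symmetric] using x uw carr n(1) by (simp add: m_assoc \<theta>_mult \<theta>_inv)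
    finally have "inv x \<otimes> x' = inv x \<otimes> (x \<otimes> \<theta> n (\<theta> m u \<otimes> inv (\<theta> m' w)))"
      by simp
    then have "inv x \<otimes> x' = \<theta> n (\<theta> m u \<otimes> inv (\<theta> m' w))"
      using x uw carr n(1) by simp
    then show False
      using n(2) uw carr by auto
  qed
  then show ?thesis
    using z(1) n(1) eqs by (intro bexI[of _ "(z, n)"]) (simp_all add: x_def x'_def)
qed

text \<open>Multiplying \<open>t\<close> by \<open>q q'\<close> makes its second component divisible
  by both \<open>q\<close> and \<open>q'\<close>, so by absorption the new element lies in each of
  the two ideals unless it already misses one. Its quotients by \<open>s\<close> and
  \<open>s'\<close> are distinct by right cancellation and can then be separated.\<close>

lemma separate_S:
  assumes "s \<in> carrier S" "s' \<in> carrier S" "s \<noteq> s'" "t \<in> carrier S"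
  shows "\<exists>x\<in>carrier S. pideal S (t \<cdot> x) \<inter> pideal S s = {} \<or>
    pideal S (t \<cdot> x) \<inter> pideal S s' = {} \<or>
    (\<exists>a\<in>carrier S. \<exists>a'\<in>carrier S. t \<cdot> x = s \<cdot> a \<and> t \<cdot> x = s' \<cdot> a' \<and>
      pideal S a \<inter> pideal S a' = {})"
proof -
  obtain g p h q h' q' where eqs: "t = (g, p)" "s = (h, q)" "s' = (h', q')"
    by (metis surj_pair)
  have carr: "g \<in> carrier G" "p \<in> carrier P" "h \<in> carrier G" "q \<in> carrier P" "h' \<in> carrier G" "q' \<in> carrier P"
    using assms eqs by auto
  define n where "n = p \<otimes>\<^bsub>P\<^esub> (q \<otimes>\<^bsub>P\<^esub> q')"
  define x where "x = (\<one>, q \<otimes>\<^bsub>P\<^esub> q')"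
  have x: "x \<in> carrier S" "t \<cdot> x = (g, n)"
    using carr by (simp_all add: x_def n_def eqs)
  have "n = q \<otimes>\<^bsub>P\<^esub> (p \<otimes>\<^bsub>P\<^esub> q')" "n = q' \<otimes>\<^bsub>P\<^esub> (p \<otimes>\<^bsub>P\<^esub> q)"
    using carr by (simp_all add: n_def P.m_ac)
  then have n: "n \<in> carrier P" "n \<in> pideal P q" "n \<in> pideal P q'"
    using carr by (simp add: n_def, unfold mem_pideal) (metis P.m_closed)+
  show ?thesis
  proof (cases "pideal S (g, n) \<inter> pideal S s = {} \<or> pideal S (g, n) \<inter> pideal S s' = {}")
    case True
    then show ?thesis
      using x by (intro bexI[of _ x]) auto
  next
    case False
    then have "(g, n) \<in> pideal S s" "(g, n) \<in> pideal S s'"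
      using principal_S_absorb[OF carr(1) n(1) carr(3,4) n(2)]
        principal_S_absorb[OF carr(1) n(1) carr(5,6) n(3)] eqs by auto
    then obtain a a' where a: "a \<in> carrier S" "a' \<in> carrier S" "(g, n) = s \<cdot> a" "(g, n) = s' \<cdot> a'"
      unfolding mem_pideal by blast
    then have "a \<noteq> a'"
      using right_cancel_S[OF assms(1,2) a(1)] assms(3) by auto
    then obtain y where y: "y \<in> carrier S" "pideal S (a \<cdot> y) \<inter> pideal S (a' \<cdot> y) = {}"
      using separate_translates a(1,2) by blast
    have "t \<cdot> (x \<cdot> y) = (g, n) \<cdot> y"
      using S.m_assoc[OF assms(4) x(1) y(1)] x(2) by simp
    then have "t \<cdot> (x \<cdot> y) = s \<cdot> (a \<cdot> y)" "t \<cdot> (x \<cdot> y) = s' \<cdot> (a' \<cdot> y)"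
      using S.m_assoc[OF assms(1) a(1) y(1)] S.m_assoc[OF assms(2) a(2) y(1)] a(3,4) by simp_all
    then show ?thesis
      using S.m_closed[OF x(1) y(1)] S.m_closed[OF a(1) y(1)] S.m_closed[OF a(2) y(1)] y(2) by blast
  qed
qed

lemma one_not_mem_pideal_S: "\<exists>s\<in>carrier S. \<one>\<^bsub>S\<^esub> \<notin> pideal S s"
proof -
  obtain p where p: "p \<in> carrier P" "p \<noteq> \<one>\<^bsub>P\<^esub>"
    using P.nontrivial by blast
  have "\<one>\<^bsub>P\<^esub> \<notin> pideal P p"
  proof
    assume "\<one>\<^bsub>P\<^esub> \<in> pideal P p"
    then have "pideal P \<one>\<^bsub>P\<^esub> = pideal P p"
      using P.principal_mono[OF p(1)] P.principal_subset[OF p(1)] P.principal_one by blast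
    then show False
      using P.antisym[of "\<one>\<^bsub>P\<^esub>" p] p by simp
  qed
  then show ?thesis
    using p(1) by (intro bexI[of _ "(\<one>, p)"]) (auto simp: mem_pideal_S)
qed

end

text \<open>Both models consist of functions on the natural numbers with pointwise addition and are
  closed downwards. The indicator function of 0 shows that they are nontrivial; for the finite power
  this is where \<open>k \<ge> 1\<close> enters.\<close>

lemma lattice_monoid_if_iso:
  fixes P :: "'p monoid"
  assumes "Group.comm_monoid P" "(\<exists>k\<ge>1. P \<cong> nat_power k) \<or> P \<cong> nat_direct_sum"
  shows "lattice_monoid P"
proof -
  have lattice: "lattice_monoid P"
    if iso: "P \<cong> N" and mult: "\<And>f g. f \<otimes>\<^bsub>N\<^esub> g = (\<lambda>i. f i + g i)"
      and down: "\<And>f g. \<lbrakk>f \<in> carrier N; \<forall>i. g i \<le> f i\<rbrakk> \<Longrightarrow> g \<in> carrier N"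
      and delta: "(\<lambda>i. if i = 0 then 1 else 0) \<in> carrier N"
    for N :: "(nat \<Rightarrow> nat) monoid"
  proof -
    obtain h where h: "h \<in> hom P N" "bij_betw h (carrier P) (carrier N)"
      using iso by (auto simp: is_iso_def iso_def)
    show ?thesis
    proof (rule lattice_monoid_pointwise[OF assms(1) h(2) _ down])
      show "h (p \<otimes>\<^bsub>P\<^esub> q) i = h p i + h q i" if "p \<in> carrier P" "q \<in> carrier P" for p q i
        using hom_mult[OF h(1) that] by (simp add: mult)
      show "carrier N \<noteq> {\<lambda>_. 0}"
      proof
        assume "carrier N = {\<lambda>_. 0}"
        then have "(\<lambda>i. if i = 0 then 1 else 0) = (\<lambda>_ :: nat. 0 :: nat)"
          using delta by blast
        from fun_cong[OF this, of 0] show False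
          by simp
      qed
    qed auto
  qed
  show ?thesis
    using assms(2)
  proof (elim disjE exE conjE)
    fix k :: nat assume "1 \<le> k" and iso: "P \<cong> nat_power k"
    show ?thesis
    proof (rule lattice[OF iso])
      fix f g :: "nat \<Rightarrow> nat"
      assume f: "f \<in> carrier (nat_power k)" and le: "\<forall>i. g i \<le> f i"
      have "g i = 0" if "k \<le> i" for i
        using f le that unfolding nat_power_def by simp (metis le_zero_eq)
      then show "g \<in> carrier (nat_power k)"
        by (simp add: nat_power_def)
    qed (use \<open>1 \<le> k\<close> in \<open>auto simp: nat_power_def\<close>)
  next
    assume iso: "P \<cong> nat_direct_sum"
    show ?thesis
    proof (rule lattice[OF iso])
      fix f g :: "nat \<Rightarrow> nat"
      assume f: "f \<in> carrier nat_direct_sum" and le: "\<forall>i. g i \<le> f i"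
      have "f i \<noteq> 0" if "g i \<noteq> 0" for i
        using le that by (metis le_zero_eq)
      then have "{i. g i \<noteq> 0} \<subseteq> {i. f i \<noteq> 0}"
        by blast
      then show "g \<in> carrier nat_direct_sum"
        using f by (auto simp: nat_direct_sum_def intro: finite_subset)
    qed (auto simp: nat_direct_sum_def)
  qed
qed

text \<open>A unital *-homomorphism preserves the forbidden equation, so it suffices to map into the
  left regular representation. The existence of such a homomorphism is the universal property, used
  here only.\<close>

lemma adj_mult_self_neq_negative:
  fixes S :: "('s, 'k) monoid_scheme" and A :: "('a, 'm) cstar_algebra_scheme"
  assumes "monoid S" "left_cancellative S" and univ: "is_semigroup_cstar S A v e"
    and x: "x \<in> carrier A" and "0 < \<mu>"
  shows "x\<^sup>\<star>\<^bsub>A\<^esub> \<otimes>\<^bsub>A\<^esub> x \<noteq> (- complex_of_real \<mu>) \<odot>\<^bsub>A\<^esub> \<one>\<^bsub>A\<^esub>"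
proof
  assume eq: "x\<^sup>\<star>\<^bsub>A\<^esub> \<otimes>\<^bsub>A\<^esub> x = (- complex_of_real \<mu>) \<odot>\<^bsub>A\<^esub> \<one>\<^bsub>A\<^esub>"
  interpret A: unital_cstar_algebra A
    using univ by (simp add: is_semigroup_cstar_def)
  obtain B :: "(('s \<Rightarrow> complex) \<Rightarrow> 's \<Rightarrow> complex) cstar_algebra" and w f
    where B: "unital_cstar_algebra B" "semigroup_cstar_relations S B w f"
      and B_neq: "\<And>x \<mu>. \<lbrakk>x \<in> carrier B; 0 < \<mu>\<rbrakk>
        \<Longrightarrow> x\<^sup>\<star>\<^bsub>B\<^esub> \<otimes>\<^bsub>B\<^esub> x \<noteq> (- complex_of_real \<mu>) \<odot>\<^bsub>B\<^esub> \<one>\<^bsub>B\<^esub>"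
    using left_regular_representation[OF assms(1,2)] by blast
  then obtain \<phi> where \<phi>: "unital_star_hom A B \<phi>"
    using univ unfolding is_semigroup_cstar_def by blast
  then have hom: "\<phi> \<in> ring_hom A B"
    and smult: "\<And>x c. x \<in> carrier A \<Longrightarrow> \<phi> (c \<odot>\<^bsub>A\<^esub> x) = c \<odot>\<^bsub>B\<^esub> \<phi> x"
    and adj: "\<And>x. x \<in> carrier A \<Longrightarrow> \<phi> (x\<^sup>\<star>\<^bsub>A\<^esub>) = (\<phi> x)\<^sup>\<star>\<^bsub>B\<^esub>"
    by (simp_all add: unital_star_hom_def)
  have "(\<phi> x)\<^sup>\<star>\<^bsub>B\<^esub> \<otimes>\<^bsub>B\<^esub> \<phi> x = \<phi> (x\<^sup>\<star>\<^bsub>A\<^esub> \<otimes>\<^bsub>A\<^esub> x)"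
    using ring_hom_mult[OF hom A.adj_closed[OF x] x] adj[OF x] by simp
  also have "\<dots> = (- complex_of_real \<mu>) \<odot>\<^bsub>B\<^esub> \<one>\<^bsub>B\<^esub>"
    unfolding eq using smult[OF A.one_closed] ring_hom_one[OF hom] by simp
  finally show False
    using B_neq[OF ring_hom_closed[OF hom x] \<open>0 < \<mu>\<close>] by simp
qed

theorem theorem8p12:
  fixes G :: "'g monoid" and P :: "'p monoid" and \<theta> :: "'p \<Rightarrow> 'g \<Rightarrow> 'g"
    and S :: "('g \<times> 'p) monoid"
    and A :: "'a cstar_algebra"
    and v :: "'g \<times> 'p \<Rightarrow> 'a" and e :: "('g \<times> 'p) set \<Rightarrow> 'a" and \<Phi> :: "'a \<Rightarrow> 'a"
  assumes "group G"
    and "comm_monoid P"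
    and "(\<exists>k\<ge>1. P \<cong> nat_power k) \<or> P \<cong> nat_direct_sum"
    and "semigroup_action P G \<theta>"
    and "\<forall>p\<in>carrier P. inj_on (\<theta> p) (carrier G)"
    and "respects_order P G \<theta>"
    and "S = semidirect_product G P \<theta>"
    and "(\<Inter>p\<in>carrier P. \<theta> p ` carrier G) = {\<one>\<^bsub>G\<^esub>}"
    and "\<forall>p\<in>carrier P. p \<noteq> \<one>\<^bsub>P\<^esub> \<longrightarrow> infinite (rcosets\<^bsub>G\<^esub> (\<theta> p ` carrier G))"
    and "is_semigroup_cstar S A v e"
    and "conditional_expectation A (diagonal_subalgebra S A e) \<Phi>"
    and "\<forall>s\<in>carrier S. \<forall>t\<in>carrier S. \<Phi> (v s \<otimes>\<^bsub>A\<^esub> (v t)\<^sup>\<star>\<^bsub>A\<^esub>) =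
      (if s = t then v s \<otimes>\<^bsub>A\<^esub> (v s)\<^sup>\<star>\<^bsub>A\<^esub> else \<zero>\<^bsub>A\<^esub>)"
    and "faithful_on_positive A \<Phi>"
  shows "purely_infinite A \<and> simple_cstar A"
proof -
  interpret P: lattice_monoid P
    using assms(2,3) by (rule lattice_monoid_if_iso)
  interpret G: group G
    by fact
  interpret semi: ordered_semidirect G P \<theta>
    using assms(4-6,8,9) by unfold_locales auto
  have S: "S = semidirect_product G P \<theta>"
    by fact
  interpret A: unital_cstar_algebra A
    using assms(10) by (simp add: is_semigroup_cstar_def)
  interpret right_lcm_cstar_expectation A semi.S v e \<Phi>
  proof
    show "semigroup_cstar_relations semi.S A v e"
      "cstar_generated A (v ` carrier semi.S \<union>
        e ` constructible_ideals semi.S) = carrier A"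
      using assms(10) by (simp_all add: is_semigroup_cstar_def S)
    show "left_cancellative semi.S" "right_lcm semi.S"
      by (rule semi.left_cancellative_S, rule semi.right_lcm_S)
    show "x\<^sup>\<star>\<^bsub>A\<^esub> \<otimes>\<^bsub>A\<^esub> x \<noteq> (- complex_of_real \<mu>) \<odot>\<^bsub>A\<^esub> \<one>\<^bsub>A\<^esub>" if "x \<in> carrier A" "0 < \<mu>" for x \<mu>
      by (rule adj_mult_self_neq_negative
          [OF semi.monoid_S semi.left_cancellative_S assms(10)[unfolded S] that])
    show "conditional_expectation A (diagonal_subalgebra semi.S A e) \<Phi>"
      "faithful_on_positive A \<Phi>"
      using assms(11,13) by (simp_all add: S)
    show "\<Phi> (v s \<otimes>\<^bsub>A\<^esub> (v t)\<^sup>\<star>\<^bsub>A\<^esub>) = (if s = t then v s \<otimes>\<^bsub>A\<^esub> (v s)\<^sup>\<star>\<^bsub>A\<^esub> else \<zero>\<^bsub>A\<^esub>)"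
      if "s \<in> carrier semi.S" "t \<in> carrier semi.S" for s t
      by (rule assms(12)[unfolded S, rule_format, OF that])
  next
    fix t F
    assume "t \<in> carrier semi.S" "finite F"
      "F \<subseteq> carrier semi.S" "\<forall>s\<in>F. t \<notin> pideal semi.S s"
    then show "\<exists>x\<in>carrier semi.S. \<forall>s\<in>F.
        pideal semi.S (t \<otimes>\<^bsub>semi.S\<^esub> x) \<inter>
        pideal semi.S s = {}"
      by (rule semi.avoid_S)
  qed (rule semi.separate_S)
  show ?thesis
    using semi.one_not_mem_pideal_S purely_infinite_simple by blast
qed

end
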